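(* There exists a bounded Lipschitz domain $\Omega \subset \mathbb{R}^2$ such that, for every $x\in\mathbb{R}^2$, $x\in\Omega$ if and only if $-x\in\Omega$, which is homeomorphic to a disk with two holes, and on which any eigenfunction $\psi$ associated with the first nontrivial Neumann eigenvalue $\mu_2(\Omega)$ is symmetric, i.e., $\psi(x) = \psi(-x)$ for all $x \in \overline{\Omega}$.
   Context: A domain is a connected open set. A disk with two holes means an open disk in the plane from which two disjoint closed disks (of positive radius) contained in it have been removed. For a bounded Lipschitz domain $\Omega\subset\mathbb{R}^2$, $0 = \mu_1(\Omega) < \mu_2(\Omega) \leq \mu_3(\Omega) \leq \ldots$ denote the eigenvalues, repeated according to multiplicity, of the Laplacian with Neumann boundary conditions: $-\Delta\psi = \mu\psi$ in $\Omega$, $\frac{\partial\psi}{\partial\nu} = 0$ on $\partial\Omega$, where $\nu$ is the outward-pointing unit normal to $\partial\Omega$. The problem is understood in the weak (variational) sense: a real-valued nonzero $\psi\in H^1(\Omega)$ is an eigenfunction associated with $\mu$ if $\int_\Omega \nabla\psi\cdot\nabla v\,dx = \mu\int_\Omega \psi v\,dx$ for all $v\in H^1(\Omega)$. Eigenfunctions are analytic inside $\Omega$; values on $\partial\Omega$ are understood via the continuous extension or, equivalently, in the sense of traces. *)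

theory Defs
  imports "HOL-Analysis.Analysis" "HOL-Library.Extended_Nat"
begin

text \<open>Near every boundary point, in suitable orthonormal coordinates, the set is the part of
  a ball lying strictly above the graph of a Lipschitz function of one variable.\<close>

definition lipschitz_boundary :: "(real^2) set \<Rightarrow> bool" where
  "lipschitz_boundary \<Omega> \<longleftrightarrow>
     (\<forall>p \<in> frontier \<Omega>. \<exists>r (T :: real^2 \<Rightarrow> real^2) (\<gamma> :: real \<Rightarrow> real) L.
        r > 0 \<and> orthogonal_transformation T \<and> L-lipschitz_on UNIV \<gamma> \<and>
        \<Omega> \<inter> ball p r = {x \<in> ball p r. \<gamma> (T x $ 1) < T x $ 2})"

definition bounded_lipschitz_domain :: "(real^2) set \<Rightarrow> bool" where
  "bounded_lipschitz_domain \<Omega> \<longleftrightarrow>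
     open \<Omega> \<and> connected \<Omega> \<and> bounded \<Omega> \<and> lipschitz_boundary \<Omega>"

definition disk_with_two_holes :: "(real^2) set \<Rightarrow> bool" where
  "disk_with_two_holes D \<longleftrightarrow>
     (\<exists>a r b s c t. 0 < s \<and> 0 < t \<and> cball b s \<subseteq> ball a r \<and> cball c t \<subseteq> ball a r \<and>
        cball b s \<inter> cball c t = {} \<and> D = ball a r - (cball b s \<union> cball c t))"

definition partial_deriv :: "2 \<Rightarrow> (real^2 \<Rightarrow> real) \<Rightarrow> real^2 \<Rightarrow> real" where
  "partial_deriv i f x = frechet_derivative f (at x) (axis i 1)"

primrec continuously_differentiable :: "nat \<Rightarrow> (real^2 \<Rightarrow> real) \<Rightarrow> bool" where
  "continuously_differentiable 0 f \<longleftrightarrow> continuous_on UNIV f"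
| "continuously_differentiable (Suc k) f \<longleftrightarrow>
     f differentiable_on UNIV \<and> (\<forall>i. continuously_differentiable k (partial_deriv i f))"

text \<open>The space of infinitely differentiable functions with compact support in \<open>\<Omega>\<close>.\<close>

definition test_function :: "(real^2) set \<Rightarrow> (real^2 \<Rightarrow> real) \<Rightarrow> bool" where
  "test_function \<Omega> \<phi> \<longleftrightarrow>
     (\<forall>k. continuously_differentiable k \<phi>) \<and>
     compact (closure (support_on UNIV \<phi>)) \<and> closure (support_on UNIV \<phi>) \<subseteq> \<Omega>"

text \<open>Elements of the spaces \<open>L\<^sup>2(\<Omega>)\<close> and \<open>H\<^sup>1(\<Omega>)\<close> are represented by functions on the whole
  plane, of which only the values on \<open>\<Omega>\<close> matter, up to a null set.\<close>

definition square_integrable_on :: "(real^2) set \<Rightarrow> (real^2 \<Rightarrow> 'b::euclidean_space) \<Rightarrow> bool" where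
  "square_integrable_on \<Omega> u \<longleftrightarrow>
     u \<in> borel_measurable (lebesgue_on \<Omega>) \<and> integrable (lebesgue_on \<Omega>) (\<lambda>x. (norm (u x))\<^sup>2)"

text \<open>\<open>has_H1_gradient \<Omega> u g\<close> says that \<open>u\<close> is in \<open>H\<^sup>1(\<Omega>)\<close> and that \<open>g\<close> is its weak gradient
  (which is unique up to a null set of \<open>\<Omega>\<close>).\<close>

definition has_H1_gradient :: "(real^2) set \<Rightarrow> (real^2 \<Rightarrow> real) \<Rightarrow> (real^2 \<Rightarrow> real^2) \<Rightarrow> bool" where
  "has_H1_gradient \<Omega> u g \<longleftrightarrow>
     square_integrable_on \<Omega> u \<and> square_integrable_on \<Omega> g \<and>
     (\<forall>\<phi> i. test_function \<Omega> \<phi> \<longrightarrow>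
        (LINT x|lebesgue_on \<Omega>. u x * partial_deriv i \<phi> x) =
        - (LINT x|lebesgue_on \<Omega>. g x $ i * \<phi> x))"

text \<open>The weak Neumann problem; the zero function is included here, so that the solutions
  form a vector space.\<close>

definition neumann_eigenspace :: "(real^2) set \<Rightarrow> real \<Rightarrow> (real^2 \<Rightarrow> real) set" where
  "neumann_eigenspace \<Omega> \<mu> =
     {\<psi>. \<exists>g. has_H1_gradient \<Omega> \<psi> g \<and>
        (\<forall>v h. has_H1_gradient \<Omega> v h \<longrightarrow>
           (LINT x|lebesgue_on \<Omega>. g x \<bullet> h x) = \<mu> * (LINT x|lebesgue_on \<Omega>. \<psi> x * v x))}"

definition neumann_eigenfunction :: "(real^2) set \<Rightarrow> real \<Rightarrow> (real^2 \<Rightarrow> real) \<Rightarrow> bool" where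
  "neumann_eigenfunction \<Omega> \<mu> \<psi> \<longleftrightarrow>
     \<psi> \<in> neumann_eigenspace \<Omega> \<mu> \<and> \<not> (AE x in lebesgue_on \<Omega>. \<psi> x = 0)"

text \<open>The multiplicity is the dimension of the eigenspace modulo equality almost everywhere
  in \<open>\<Omega>\<close>; it is \<open>0\<close> when \<open>\<mu>\<close> is not an eigenvalue.\<close>

definition independent_ae :: "(real^2) set \<Rightarrow> nat \<Rightarrow> (nat \<Rightarrow> real^2 \<Rightarrow> real) \<Rightarrow> bool" where
  "independent_ae \<Omega> n \<phi> \<longleftrightarrow>
     (\<forall>c :: nat \<Rightarrow> real. (AE x in lebesgue_on \<Omega>. (\<Sum>i<n. c i * \<phi> i x) = 0) \<longrightarrow> (\<forall>i<n. c i = 0))"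

definition neumann_multiplicity :: "(real^2) set \<Rightarrow> real \<Rightarrow> enat" where
  "neumann_multiplicity \<Omega> \<mu> =
     (SUP n \<in> {n. \<exists>\<phi>. (\<forall>i<n. \<phi> i \<in> neumann_eigenspace \<Omega> \<mu>) \<and> independent_ae \<Omega> n \<phi>}. enat n)"

text \<open>The number of eigenvalues in \<open>{..a}\<close>, counted with multiplicity.\<close>

definition neumann_counting :: "(real^2) set \<Rightarrow> real \<Rightarrow> enat" where
  "neumann_counting \<Omega> a =
     (SUP M \<in> {M. finite M \<and> M \<subseteq> {..a}}. \<Sum>\<mu>\<in>M. neumann_multiplicity \<Omega> \<mu>)"

text \<open>The \<open>k\<close>-th eigenvalue (\<open>k \<ge> 1\<close>) in increasing order, repeated according to multiplicity:
  the least \<open>a\<close> such that at least \<open>k\<close> eigenvalues are \<open>\<le> a\<close>. On a bounded Lipschitz domain the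
  spectrum is discrete and unbounded, so that the infimum is attained.\<close>

definition neumann_eigenvalue :: "(real^2) set \<Rightarrow> nat \<Rightarrow> real" where
  "neumann_eigenvalue \<Omega> k = Inf {a. enat k \<le> neumann_counting \<Omega> a}"

text \<open>The symmetry \<open>\<psi>(x) = \<psi>(-x)\<close> for all \<open>x\<close> in the closure of \<open>\<Omega>\<close>, for a function \<open>\<psi>\<close> given up
  to a null set of \<open>\<Omega>\<close>: it holds almost everywhere in \<open>\<Omega>\<close>, and at every point of the closure
  when the values of \<open>\<psi>\<close> are those of its continuous extension to the closure.\<close>

definition symmetric_on_closure :: "(real^2) set \<Rightarrow> (real^2 \<Rightarrow> real) \<Rightarrow> bool" where
  "symmetric_on_closure \<Omega> \<psi> \<longleftrightarrow>
     (AE x in lebesgue_on \<Omega>. \<psi> x = \<psi> (- x)) \<and>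
     (\<forall>\<phi>. continuous_on (closure \<Omega>) \<phi> \<and> (AE x in lebesgue_on \<Omega>. \<phi> x = \<psi> x) \<longrightarrow>
        (\<forall>x \<in> closure \<Omega>. \<phi> x = \<phi> (- x)))"

end

theory Submission
  imports Defs "HOL-Complex_Analysis.Great_Picard"
begin

text \<open>
  The domain consists of the square \<open>(-1,1)\<^sup>2\<close>, of the square ring \<open>{2 < max \<bar>x\<bar> \<bar>y\<bar> < 3}\<close>
  around it, and of two thin channels of width \<open>2 w\<close> along the second axis that join them.
  Odd functions satisfy a Poincare inequality with a constant independent of \<open>w\<close>: they have mean
  value zero on the square and on the strip that contains the channels, and opposite mean values on
  opposite sides of the ring. On the other hand, an even function that is \<open>1\<close> on the square and
  \<open>0\<close> on the ring, with all its variation in the channels, has a Rayleigh quotient \<open>O(w)\<close>, also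
  after subtracting its mean value. So for small \<open>w\<close> the eigenvalue \<open>\<mu>\<^sub>2\<close> is smaller than the
  Rayleigh quotient of any odd function, and the odd part of an eigenfunction, which is again in
  the eigenspace, vanishes.

  That \<open>\<mu>\<^sub>2\<close> is bounded by Rayleigh quotients is the existence of a minimiser. In place of Rellich's
  theorem it uses the following gap property: a function whose averages over
  sufficiently many small rectangles vanish has an arbitrarily large Rayleigh quotient.
\<close>

section \<open>Smooth functions and test functions\<close>

text \<open>Two demands shape the domain. For odd functions every piece must be centrally symmetric
  or tied to its mirror image through overlaps of fixed size, so that thin channels do not spoil the
  Poincare constant; for even functions two pieces of fixed size must communicate only through the
  channels. A square inside a ring meets both, and two opposite channels cut the gap between them
  into exactly two holes.

  The pieces are rectangles because there the Poincare inequality follows from one-dimensional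
  integration: a function close to some w(y) and to some v(x) is close to a constant.

  The second eigenvalue is the infimum of a set given by a counting function, so an upper bound has
  to produce genuine eigenfunctions: the constant, and a minimiser of the Rayleigh quotient among
  functions of mean zero, whose Euler-Lagrange equation is the weak Neumann problem.

  The width 10^-7 comes from the constants: 45000 bounds the squared norm of an odd function by its
  Dirichlet integral, 180 w bounds the eigenvalue, and 45000 * 180 * 10^-7 = 0.81 < 1.\<close>

primrec class_C :: "nat \<Rightarrow> (real \<Rightarrow> real) \<Rightarrow> bool" where
  "class_C 0 f \<longleftrightarrow> continuous_on UNIV f"
| "class_C (Suc k) f \<longleftrightarrow> (\<exists>f'. (\<forall>x. (f has_real_derivative f' x) (at x)) \<and> class_C k f')"

definition smooth :: "(real \<Rightarrow> real) \<Rightarrow> bool" where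
  "smooth f \<longleftrightarrow> (\<forall>k. class_C k f)"

lemma class_C_continuous: "class_C k f \<Longrightarrow> continuous_on UNIV f"
  by (cases k) (auto intro!: continuous_at_imp_continuous_on intro: DERIV_isCont)

lemma class_C_Suc_imp: "class_C (Suc k) f \<Longrightarrow> class_C k f"
proof (induction k arbitrary: f)
  case 0
  then show ?case using class_C_continuous[of "Suc 0" f] by simp
next
  case (Suc k)
  then show ?case by (metis class_C.simps(2))
qed

lemma class_C_const: "class_C k (\<lambda>x. c)"
  by (induction k arbitrary: c) (auto intro!: exI[of _ "\<lambda>x. 0"])

lemma class_C_add: "class_C k f \<Longrightarrow> class_C k g \<Longrightarrow> class_C k (\<lambda>x. f x + g x)"
proof (induction k arbitrary: f g)
  case 0
  then show ?case by (auto intro: continuous_intros)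
next
  case (Suc k)
  then obtain f' g' where "\<forall>x. (f has_real_derivative f' x) (at x)" "class_C k f'"
    "\<forall>x. (g has_real_derivative g' x) (at x)" "class_C k g'" by auto
  then show ?case using Suc.IH by (auto intro!: exI[of _ "\<lambda>x. f' x + g' x"] derivative_intros)
qed

lemma class_C_mult: "class_C k f \<Longrightarrow> class_C k g \<Longrightarrow> class_C k (\<lambda>x. f x * g x)"
proof (induction k arbitrary: f g)
  case 0
  then show ?case by (auto intro: continuous_intros)
next
  case (Suc k)
  then obtain f' g' where *: "\<forall>x. (f has_real_derivative f' x) (at x)" "class_C k f'"
    "\<forall>x. (g has_real_derivative g' x) (at x)" "class_C k g'" by auto
  moreover have "class_C k f" "class_C k g" using Suc.prems class_C_Suc_imp by blast+
  ultimately show ?case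
    using Suc.IH
    by (auto intro!: exI[of _ "\<lambda>x. f' x * g x + g' x * f x"] derivative_intros class_C_add)
qed

lemma class_C_affine: "class_C k f \<Longrightarrow> class_C k (\<lambda>x. f (m * x + q))"
proof (induction k arbitrary: f)
  case 0
  then show ?case by (auto intro!: continuous_on_compose2[of UNIV f] continuous_intros)
next
  case (Suc k)
  then obtain f' where *: "\<forall>x. (f has_real_derivative f' x) (at x)" "class_C k f'" by auto
  have "((\<lambda>x. f (m * x + q)) has_real_derivative f' (m * x + q) * m) (at x)" for x
    by (rule DERIV_chain2[where f = f]) (use * in \<open>auto intro!: derivative_eq_intros\<close>)
  then show ?case
    using class_C_mult[OF Suc.IH[OF *(2)] class_C_const[of k m]]
    by (auto intro!: exI[of _ "\<lambda>x. f' (m * x + q) * m"])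
qed

lemma smooth_mult: "smooth f \<Longrightarrow> smooth g \<Longrightarrow> smooth (\<lambda>x. f x * g x)"
  unfolding smooth_def by (blast intro: class_C_mult)

lemma smooth_add: "smooth f \<Longrightarrow> smooth g \<Longrightarrow> smooth (\<lambda>x. f x + g x)"
  unfolding smooth_def by (blast intro: class_C_add)

lemma smooth_const: "smooth (\<lambda>x. c)"
  unfolding smooth_def by (blast intro: class_C_const)

lemma smooth_affine: "smooth f \<Longrightarrow> smooth (\<lambda>x. f (m * x + q))"
  unfolding smooth_def by (blast intro: class_C_affine)

lemma smooth_diff: 
  assumes "smooth f" "smooth g"
  shows "smooth (\<lambda>x. f x - g x)"
  using smooth_add[OF assms(1) smooth_mult[OF smooth_const[of "-1"] assms(2)]] by simp

lemma smooth_continuous: "smooth f \<Longrightarrow> continuous_on UNIV f"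
  unfolding smooth_def using class_C_continuous by blast

lemma smooth_antiderivative:
  assumes "smooth f'" "\<And>x. (f has_real_derivative f' x) (at x)"
  shows "smooth f"
  unfolding smooth_def
proof
  fix k show "class_C k f"
    using assms class_C_Suc_imp[of k f] unfolding smooth_def by auto
qed

text \<open>The polynomial factor makes the family closed under differentiation.\<close>

definition flat :: "real poly \<Rightarrow> real \<Rightarrow> real" where
  "flat p t = (if t > 0 then poly p (1 / t) * exp (- 1 / t) else 0)"

text \<open>The exponential beats every monomial, and a polynomial is a finite sum of
  monomials.\<close>

lemma poly_exp_tendsto_0: "((\<lambda>s. poly p s * exp (- s)) \<longlongrightarrow> (0::real)) at_top"
proof (induction p)
  case 0
  then show ?case by simp
next
  case (pCons a p)
  have "((\<lambda>s. s ^ k * exp (- s)) \<longlongrightarrow> (0::real)) at_top" for k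
    using tendsto_power_div_exp_0[of k] by (simp add: exp_minus field_simps)
  note * = this
  have "((\<lambda>s. poly q s * exp (- s)) \<longlongrightarrow> (0::real)) at_top" for q :: "real poly"
  proof -
    have "((\<lambda>s. \<Sum>i\<le>degree q. coeff q i * (s ^ i * exp (- s))) \<longlongrightarrow> (\<Sum>i\<le>degree q. coeff q i * (0::real))) at_top"
      by (intro tendsto_intros *)
    then show ?thesis by (simp add: poly_altdef sum_distrib_right mult.assoc)
  qed
  then show ?case .
qed

lemma flat_tendsto_0: "(flat p \<longlongrightarrow> 0) (at 0)"
proof -
  have "((\<lambda>t. poly p (inverse t) * exp (- inverse t)) \<longlongrightarrow> (0::real)) (at_right 0)"
    by (rule filterlim_compose[OF poly_exp_tendsto_0 filterlim_inverse_at_top_right])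
  then have "(flat p \<longlongrightarrow> 0) (at_right 0)"
    by (rule Lim_transform_eventually)
      (auto simp: flat_def eventually_at_right_less field_simps intro!: eventually_mono[OF eventually_at_right_less])
  moreover have "(flat p \<longlongrightarrow> 0) (at_left 0)"
    by (rule tendsto_eventually) (auto simp: flat_def eventually_at_filter)
  ultimately show ?thesis by (simp add: filterlim_split_at)
qed

text \<open>In s = 1/t the derivative of p(s) exp(-s) with respect to t is s^2 (p(s) - p'(s))
  exp(-s), which explains the new polynomial. At 0 the difference quotient of \<open>flat p\<close>
  is \<open>flat\<close> of X p, which tends to 0.\<close>

lemma flat_DERIV:
  "(flat p has_real_derivative flat ([:0,0,1:] * (p - pderiv p)) t) (at t)"
proof -
  consider "t > 0" | "t < 0" | "t = 0" by linarith
  then show ?thesis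
  proof cases
    case 1
    have "((\<lambda>t. poly p (1 / t) * exp (- 1 / t)) has_real_derivative
        (poly (pderiv p) (1 / t) * (- 1 / t\<^sup>2)) * exp (- 1 / t) + exp (- 1 / t) * (1 / t\<^sup>2) * poly p (1 / t)) (at t)"
      by (rule DERIV_mult; (rule DERIV_chain2[OF poly_DERIV] DERIV_chain2[OF DERIV_exp])?)
        (use 1 in \<open>auto intro!: derivative_eq_intros simp: power2_eq_square\<close>)
    then have "((\<lambda>t. poly p (1 / t) * exp (- 1 / t)) has_real_derivative flat ([:0,0,1:] * (p - pderiv p)) t) (at t)"
      by (rule DERIV_cong) (use 1 in \<open>simp add: flat_def power2_eq_square field_simps\<close>)
    then show ?thesis
      by (rule has_field_derivative_transform_within_open[where S = "{0<..}"]) (use 1 in \<open>auto simp: flat_def\<close>)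
  next
    case 2
    have "((\<lambda>t. 0) has_real_derivative 0) (at t)" by simp
    then have "(flat p has_real_derivative 0) (at t)"
      by (rule has_field_derivative_transform_within_open[where S = "{..<0}"]) (use 2 in \<open>auto simp: flat_def\<close>)
    then show ?thesis using 2 by (simp add: flat_def)
  next
    case 3
    have "(\<lambda>h. (flat p (0 + h) - flat p 0) / h) = flat ([:0,1:] * p)"
      by (auto simp: flat_def field_simps fun_eq_iff)
    then have "(flat p has_real_derivative 0) (at 0)"
      unfolding DERIV_def using flat_tendsto_0 by simp
    then show ?thesis using 3 by (simp add: flat_def)
  qed
qed

lemma smooth_flat: "smooth (flat p)"
proof -
  have "class_C k (flat p)" for k
  proof (induction k arbitrary: p)
    case 0
    then show ?case using flat_DERIV
      by (auto intro!: DERIV_continuous_on intro: has_field_derivative_at_within)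
  next
    case (Suc k)
    then show ?case using flat_DERIV by (auto intro!: exI[of _ "flat ([:0,0,1:] * (p - pderiv p))"])
  qed
  then show ?thesis by (simp add: smooth_def)
qed

text \<open>The factor n + 1 steepens both edges while the support stays in [a, b], so the bumps
  tend to the indicator of (a, b) and stay below it. They carry identities for smooth functions over
  to boxes by dominated convergence.\<close>

definition bump :: "real \<Rightarrow> real \<Rightarrow> nat \<Rightarrow> real \<Rightarrow> real" where
  "bump a b n x = flat 1 (real (Suc n) * (x - a)) * flat 1 (real (Suc n) * (b - x))"

lemma smooth_bump: "smooth (bump a b n)"
proof -
  have "smooth (\<lambda>x. flat 1 (real (Suc n) * x + (- real (Suc n) * a)) *
                flat 1 (- real (Suc n) * x + real (Suc n) * b))"
    by (intro smooth_mult smooth_affine smooth_flat)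
  then show ?thesis unfolding bump_def [abs_def] by (simp add: algebra_simps)
qed

lemma flat_1_bounds: "0 \<le> flat 1 t" "flat 1 t \<le> 1"
  by (auto simp: flat_def)

lemma bump_bounds: "0 \<le> bump a b n x" "bump a b n x \<le> 1"
  using flat_1_bounds by (auto simp: bump_def mult_le_one)

lemma bump_outside: "x \<notin> {a<..<b} \<Longrightarrow> bump a b n x = 0"
  by (auto simp: bump_def flat_def zero_less_mult_iff)

lemma flat_1_tendsto: 
  assumes "t > 0"
  shows "(\<lambda>n. flat 1 (real (Suc n) * t)) \<longlonglongrightarrow> 1"
proof -
  have "(\<lambda>n. - (inverse (real (Suc n)) * (1/t))) \<longlonglongrightarrow> - (0 * (1/t))"
    by (intro tendsto_intros LIMSEQ_inverse_real_of_nat)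
  then have "(\<lambda>n. exp (- (inverse (real (Suc n)) * (1/t)))) \<longlonglongrightarrow> exp (- (0 * (1/t)))"
    by (rule tendsto_exp)
  then have "(\<lambda>n. exp (- (1 / (t + t * real n)))) \<longlonglongrightarrow> 1"
    using assms by (simp add: field_simps)
  moreover have "t + t * real n > 0" for n
    using assms by (simp add: add_pos_nonneg)
  ultimately show ?thesis by (simp add: flat_def algebra_simps)
qed

lemma bump_tendsto: "(\<lambda>n. bump a b n x) \<longlonglongrightarrow> indicator {a<..<b} x"
proof (cases "x \<in> {a<..<b}")
  case True
  then have "(\<lambda>n. flat 1 (real (Suc n) * (x - a)) * flat 1 (real (Suc n) * (b - x))) \<longlonglongrightarrow> 1 * 1"
    by (intro tendsto_mult flat_1_tendsto) auto
  then show ?thesis using True by (simp add: bump_def)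
next
  case False
  then show ?thesis by (simp add: bump_outside)
qed

lemma continuous_compact_support_integrable:
  fixes f :: "real \<Rightarrow> real"
  assumes "continuous_on UNIV f" "\<And>x. x \<notin> {a..b} \<Longrightarrow> f x = 0"
  shows "integrable lborel f"
proof -
  have "set_integrable lborel {a..b} f"
    unfolding set_integrable_def
    by (rule borel_integrable_compact) (use assms in \<open>auto intro: continuous_on_subset\<close>)
  moreover have "(\<lambda>x. indicator {a..b} x *\<^sub>R f x) = f"
    using assms(2) by (fastforce simp: indicator_def)
  ultimately show ?thesis by (simp only: set_integrable_def)
qed

text \<open>The primitive that starts at a is zero to the left of a, and to the right of b it equals
  the full integral, which vanishes. Hence a test function of mean zero is the derivative of a test
  function.\<close>

lemma smooth_antiderivative_compact_support:
  assumes "smooth \<eta>" "\<And>x. x \<notin> {a..b} \<Longrightarrow> \<eta> x = 0" "(LINT x|lborel. \<eta> x) = 0" "a \<le> b"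
  obtains \<alpha> where "smooth \<alpha>" "\<And>x. x \<notin> {a..b} \<Longrightarrow> \<alpha> x = 0" "\<And>x. (\<alpha> has_real_derivative \<eta> x) (at x)"
proof -
  have cont: "continuous_on UNIV \<eta>" using assms smooth_continuous by auto
  define \<alpha> where "\<alpha> x = (LBINT t=a..x. \<eta> t)" for x :: real
  have int: "integrable lborel \<eta>"
    using continuous_compact_support_integrable[OF cont assms(2)] by blast
  have D: "(\<alpha> has_real_derivative \<eta> x) (at x)" for x
  proof -
    have "((\<lambda>u. LBINT t=a..u. \<eta> t) has_vector_derivative \<eta> x) (at x within {min a x - 1..max a x + 1})"
      by (rule interval_integral_FTC2) (use cont in \<open>auto intro: continuous_on_subset\<close>)
    then have "((\<lambda>u. LBINT t=a..u. \<eta> t) has_vector_derivative \<eta> x) (at x within {min a x - 1<..<max a x + 1})"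
      by (rule has_vector_derivative_within_subset) auto
    then have "((\<lambda>u. LBINT t=a..u. \<eta> t) has_vector_derivative \<eta> x) (at x)"
      by (subst (asm) at_within_open) auto
    then show ?thesis unfolding \<alpha>_def has_real_derivative_iff_has_vector_derivative .
  qed
  have "\<alpha> x = 0" if "x \<notin> {a..b}" for x
  proof (cases "x < a")
    case True
    have "\<alpha> x = - (LBINT t:{x..a}. \<eta> t)"
      using True by (simp add: \<alpha>_def interval_integral_Icc interval_integral_endpoints_reverse[of a x])
    also have "(LBINT t:{x..a}. \<eta> t) = (LBINT t::real. 0)"
      unfolding set_lebesgue_integral_def
    proof (rule integral_cong_AE)
      show "AE t in lborel. indicat_real {x..a} t *\<^sub>R \<eta> t = 0"
        using assms(2) by (auto intro!: eventually_mono[OF AE_lborel_singleton[of a]] simp: indicator_def)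
    qed (use borel_measurable_continuous_onI[OF cont] in auto)
    finally show ?thesis by simp
  next
    case False
    then have "x > b" using that assms(4) by auto
    then have "\<alpha> x = (LBINT t:{a..x}. \<eta> t)"
      using assms(4) by (simp add: \<alpha>_def interval_integral_Icc)
    also have "\<dots> = (LBINT t. \<eta> t)"
      unfolding set_lebesgue_integral_def
    proof (rule Bochner_Integration.integral_cong)
      fix t show "indicat_real {a..x} t *\<^sub>R \<eta> t = \<eta> t"
        using assms(2)[of t] \<open>x > b\<close> by (cases "t \<in> {a..x}") auto
    qed simp
    finally show ?thesis using assms by simp
  qed
  then show ?thesis
    using that[of \<alpha>] D smooth_antiderivative[OF assms(1), of \<alpha>] by auto
qed

section \<open>Partial derivatives in the plane and test functions of product form\<close>

lemma differentiable_on_UNIV_at: "f differentiable_on UNIV \<longleftrightarrow> (\<forall>x. f differentiable (at x))"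
  by (auto simp: differentiable_on_def)

lemma partial_deriv_eqI: "(f has_derivative f') (at x) \<Longrightarrow> partial_deriv i f x = f' (axis i 1)"
  unfolding partial_deriv_def by (metis frechet_derivative_at)

lemma has_derivative_partial:
  assumes "f differentiable (at x)"
  shows "(f has_derivative frechet_derivative f (at x)) (at x)"
  using assms frechet_derivative_works by blast

lemma continuously_differentiable_continuous:
  "continuously_differentiable k f \<Longrightarrow> continuous_on UNIV f"
  by (cases k) (auto intro: differentiable_imp_continuous_on)

lemma continuously_differentiable_SucD:
  "continuously_differentiable (Suc k) f \<Longrightarrow> continuously_differentiable k f"
proof (induction k arbitrary: f)
  case 0
  then show ?case by (auto intro: differentiable_imp_continuous_on)
next
  case (Suc k)
  then show ?case by (metis continuously_differentiable.simps(2))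
qed

lemma continuously_differentiable_add:
  "continuously_differentiable k f \<Longrightarrow> continuously_differentiable k g \<Longrightarrow>
   continuously_differentiable k (\<lambda>x. f x + g x)"
proof (induction k arbitrary: f g)
  case 0
  then show ?case by (auto intro: continuous_intros)
next
  case (Suc k)
  then have d: "f differentiable (at x)" "g differentiable (at x)" for x
    by (auto simp: differentiable_on_UNIV_at)
  have "partial_deriv i (\<lambda>x. f x + g x) = (\<lambda>x. partial_deriv i f x + partial_deriv i g x)" for i
  proof
    fix x
    show "partial_deriv i (\<lambda>x. f x + g x) x = partial_deriv i f x + partial_deriv i g x"
      using partial_deriv_eqI[OF has_derivative_add[OF has_derivative_partial[OF d(1)] has_derivative_partial[OF d(2)]]]
      by (simp add: partial_deriv_def)
  qed
  with Suc d show ?case by (auto simp: differentiable_on_UNIV_at)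
qed

lemma partial_deriv_mult:
  assumes "f differentiable (at x)" "g differentiable (at x)"
  shows "partial_deriv i (\<lambda>x. f x * g x) x = f x * partial_deriv i g x + partial_deriv i f x * g x"
  using partial_deriv_eqI[OF has_derivative_mult[OF has_derivative_partial[OF assms(1)] has_derivative_partial[OF assms(2)]]]
  by (simp add: partial_deriv_def)

lemma continuously_differentiable_mult:
  "continuously_differentiable k f \<Longrightarrow> continuously_differentiable k g \<Longrightarrow>
   continuously_differentiable k (\<lambda>x. f x * g x)"
proof (induction k arbitrary: f g)
  case 0
  then show ?case by (auto intro: continuous_intros)
next
  case (Suc k)
  then have d: "f differentiable (at x)" "g differentiable (at x)" for x
    by (auto simp: differentiable_on_UNIV_at)
  have "partial_deriv i (\<lambda>x. f x * g x) = (\<lambda>x. f x * partial_deriv i g x + partial_deriv i f x * g x)" for i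
    using d partial_deriv_mult by auto
  moreover have "continuously_differentiable k f" "continuously_differentiable k g"
    using Suc.prems continuously_differentiable_SucD by blast+
  ultimately show ?case using Suc d
    by (auto simp: differentiable_on_UNIV_at intro!: continuously_differentiable_add)
qed

lemma has_derivative_component:
  assumes "(a has_real_derivative a') (at (x $ j))"
  shows "((\<lambda>x::real^2. a (x $ j)) has_derivative (\<lambda>h. h $ j * a')) (at x)"
proof -
  have "(a has_derivative (\<lambda>h. h * a')) (at (x $ j))"
    using assms by (simp add: has_field_derivative_def mult_commute_abs)
  then show ?thesis
    by (rule has_derivative_compose[of "\<lambda>x. x $ j" "\<lambda>h. h $ j" x UNIV a, rotated])
      (auto intro!: bounded_linear_imp_has_derivative bounded_linear_vec_nth)
qed

lemma partial_deriv_component: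
  assumes "(a has_real_derivative a') (at (x $ j))"
  shows "partial_deriv i (\<lambda>x. a (x $ j)) x = (if i = j then a' else 0)"
  using partial_deriv_eqI[OF has_derivative_component[OF assms]] by (auto simp: axis_def)

lemma continuously_differentiable_const: "continuously_differentiable k (\<lambda>x. c)"
proof (induction k arbitrary: c)
  case (Suc k)
  have "partial_deriv i (\<lambda>x. c) = (\<lambda>x. 0)" for i
    using partial_deriv_eqI[OF has_derivative_const] by auto
  with Suc show ?case by (auto simp: differentiable_on_UNIV_at)
qed auto

lemma continuously_differentiable_component:
  "class_C k a \<Longrightarrow> continuously_differentiable k (\<lambda>x. a (x $ j))"
proof (induction k arbitrary: a)
  case 0
  then show ?case by (auto intro!: continuous_on_compose2[of UNIV a] continuous_intros)
next
  case (Suc k)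
  then obtain a' where a': "\<And>x. (a has_real_derivative a' x) (at x)" "class_C k a'" by auto
  have "partial_deriv i (\<lambda>x. a (x $ j)) = (if i = j then (\<lambda>x. a' (x $ j)) else (\<lambda>x. 0))" for i
    using partial_deriv_component[OF a'(1)] by auto
  moreover have "(\<lambda>x. a (x $ j)) differentiable_on UNIV"
    using has_derivative_component[OF a'(1)] by (auto simp: differentiable_on_UNIV_at differentiable_def)
  ultimately show ?case
    using Suc.IH[OF a'(2)] continuously_differentiable_const[of k 0] by auto
qed

text \<open>The Poincare inequality on rectangles probes the weak gradient with such products alone,
  which reduces it to calculus in one variable.\<close>

lemma test_function_tensor:
  assumes "smooth \<alpha>" "smooth \<beta>"
    and "\<And>t. t \<notin> {a..b} \<Longrightarrow> \<alpha> t = 0" "\<And>t. t \<notin> {c..d} \<Longrightarrow> \<beta> t = 0"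
    and sub: "\<And>x. a \<le> x $ 1 \<Longrightarrow> x $ 1 \<le> b \<Longrightarrow> c \<le> x $ 2 \<Longrightarrow> x $ 2 \<le> d \<Longrightarrow> x \<in> \<Omega>"
  shows "test_function \<Omega> (\<lambda>x. \<alpha> (x $ 1) * \<beta> (x $ 2))"
proof -
  let ?K = "cbox (vector [a, c]) (vector [b, d]) :: (real^2) set"
  have "support_on UNIV (\<lambda>x. \<alpha> (x $ 1) * \<beta> (x $ 2)) \<subseteq> ?K"
    using assms(3,4) by (fastforce simp: support_on_def mem_box_cart forall_2)
  then have *: "closure (support_on UNIV (\<lambda>x. \<alpha> (x $ 1) * \<beta> (x $ 2))) \<subseteq> ?K"
    by (rule closure_minimal) (rule closed_cbox)
  moreover have "?K \<subseteq> \<Omega>"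
    using sub by (auto simp: mem_box_cart forall_2)
  moreover have "compact (closure (support_on UNIV (\<lambda>x::real^2. \<alpha> (x $ 1) * \<beta> (x $ 2))))"
    using * by (meson bounded_cbox bounded_subset closed_closure compact_eq_bounded_closed)
  moreover have "continuously_differentiable k (\<lambda>x. \<alpha> (x $ 1) * \<beta> (x $ 2))" for k
    using assms(1,2) unfolding smooth_def
    by (intro continuously_differentiable_mult continuously_differentiable_component) auto
  ultimately show ?thesis unfolding test_function_def by blast
qed

lemma partial_deriv_tensor:
  assumes "\<And>t. (\<alpha> has_real_derivative \<alpha>' t) (at t)" "\<And>t. (\<beta> has_real_derivative \<beta>' t) (at t)"
  shows "partial_deriv 1 (\<lambda>x. \<alpha> (x $ 1) * \<beta> (x $ 2)) x = \<alpha>' (x $ 1) * \<beta> (x $ 2)"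
    "partial_deriv 2 (\<lambda>x. \<alpha> (x $ 1) * \<beta> (x $ 2)) x = \<alpha> (x $ 1) * \<beta>' (x $ 2)"
proof -
  have d: "(\<lambda>x. \<alpha> (x $ 1)) differentiable (at x)" "(\<lambda>x. \<beta> (x $ 2)) differentiable (at x)"
    using has_derivative_component[OF assms(1)] has_derivative_component[OF assms(2)]
    unfolding differentiable_def by blast+
  show "partial_deriv 1 (\<lambda>x. \<alpha> (x $ 1) * \<beta> (x $ 2)) x = \<alpha>' (x $ 1) * \<beta> (x $ 2)"
    "partial_deriv 2 (\<lambda>x. \<alpha> (x $ 1) * \<beta> (x $ 2)) x = \<alpha> (x $ 1) * \<beta>' (x $ 2)"
    unfolding partial_deriv_mult[OF d]
    using partial_deriv_component[OF assms(1), where j=1] partial_deriv_component[OF assms(2), where j=2] by auto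
qed

section \<open>Integration in the plane by coordinates\<close>

text \<open>Product measures and Fubini live on pairs of reals, the domain in \<open>real^2\<close>;
  integrals are carried from one type to the other along this map.\<close>

definition pair_vec :: "real \<times> real \<Rightarrow> real^2" where
  "pair_vec p = (\<chi> i. if i = 1 then fst p else snd p)"

lemma pair_vec_nth [simp]: "pair_vec p $ 1 = fst p" "pair_vec p $ 2 = snd p"
  by (auto simp: pair_vec_def)

lemma continuous_on_pair_vec [continuous_intros]:
  assumes "continuous_on S f" "continuous_on S g"
  shows "continuous_on S (\<lambda>x. pair_vec (f x, g x))"
proof -
  have "continuous_on S (\<lambda>x. if i = 1 then f x else g x)" for i :: 2
    using assms by (cases "i = 1") auto
  then show ?thesis unfolding pair_vec_def fst_conv snd_conv by (rule continuous_on_vec_lambda)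
qed

lemma pair_vec_measurable [measurable]: "pair_vec \<in> borel \<rightarrow>\<^sub>M borel"
  using continuous_on_pair_vec[OF continuous_on_fst continuous_on_snd, OF continuous_on_id continuous_on_id]
  by (intro borel_measurable_continuous_onI) simp

lemma Basis_vec2: "(Basis :: (real^2) set) = {axis 1 1, axis 2 1}"
  by (auto simp: Basis_vec_def UNIV_2 image_Un)

lemma prod_Basis_vec2: "(\<Prod>b\<in>(Basis :: (real^2) set). f b) = f (axis 1 1) * f (axis 2 (1::real))"
  by (simp add: Basis_vec2 axis_eq_axis)

text \<open>Lebesgue measure is determined by the volumes of boxes, and the preimage of a box is a
  product of two intervals.\<close>

lemma distr_pair_vec: "distr (lborel \<Otimes>\<^sub>M lborel) borel pair_vec = (lborel :: (real^2) measure)"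
proof (rule sym, rule lborel_eqI)
  fix l u :: "real^2"
  assume le: "\<And>b. b \<in> Basis \<Longrightarrow> l \<bullet> b \<le> u \<bullet> b"
  then have le': "l $ i \<le> u $ i" for i
    by (metis axis_in_Basis_iff Basis_real_def inner_axis insertI1 inner_real_def mult.right_neutral)
  have "emeasure (distr (lborel \<Otimes>\<^sub>M lborel) borel pair_vec) (box l u) =
    emeasure (lborel \<Otimes>\<^sub>M lborel) (pair_vec -` box l u \<inter> space (lborel \<Otimes>\<^sub>M lborel))"
    by (rule emeasure_distr) (auto simp: lborel_prod)
  also have "pair_vec -` box l u \<inter> space (lborel \<Otimes>\<^sub>M lborel) = {l $ 1<..<u $ 1} \<times> {l $ 2<..<u $ 2}"
    by (auto simp: mem_box_cart forall_2 space_pair_measure)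
  also have "emeasure (lborel \<Otimes>\<^sub>M lborel) \<dots> = ennreal (u $ 1 - l $ 1) * ennreal (u $ 2 - l $ 2)"
    using le' by (subst lborel.emeasure_pair_measure_Times) auto
  also have "\<dots> = (\<Prod>b\<in>Basis. (u - l) \<bullet> b)"
    using le' by (simp add: prod_Basis_vec2 inner_axis ennreal_mult)
  finally show "emeasure (distr (lborel \<Otimes>\<^sub>M lborel) borel pair_vec) (box l u) = (\<Prod>b\<in>Basis. (u - l) \<bullet> b)" .
qed simp

lemma integral_pair_vec:
  fixes f :: "real^2 \<Rightarrow> 'b::{banach, second_countable_topology}"
  assumes [measurable]: "f \<in> borel_measurable borel"
  shows "(LINT x|lborel. f x) = (LINT p|(lborel \<Otimes>\<^sub>M lborel). f (pair_vec p))"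
  by (subst distr_pair_vec[symmetric], subst integral_distr) (auto simp: lborel_prod)

lemma integrable_pair_vec:
  fixes f :: "real^2 \<Rightarrow> 'b::{banach, second_countable_topology}"
  assumes [measurable]: "f \<in> borel_measurable borel"
  shows "integrable lborel f \<longleftrightarrow> integrable (lborel \<Otimes>\<^sub>M lborel) (\<lambda>p. f (pair_vec p))"
  by (subst distr_pair_vec[symmetric], subst integrable_distr_eq) (auto simp: lborel_prod)

text \<open>The reflection is the diagonal map with all factors -1, whose determinant has absolute
  value 1.\<close>

lemma lebesgue_distr_uminus_vec:
  shows "distr lebesgue lebesgue uminus = (lebesgue :: (real^2) measure)"
    and uminus_lebesgue_measurable: "(uminus :: real^2 \<Rightarrow> real^2) \<in> lebesgue \<rightarrow>\<^sub>M lebesgue"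
proof -
  have "(\<Sum>j\<in>Basis. (- 1 * (x \<bullet> j)) *\<^sub>R j) = - x" for x :: "real^2"
    using euclidean_representation[of "-x"] by (simp add: sum_negf)
  then have eq: "(\<lambda>x::real^2. 0 + (\<Sum>j\<in>Basis. (- 1 * (x \<bullet> j)) *\<^sub>R j)) = uminus"
    by (simp add: fun_eq_iff)
  show "(uminus :: real^2 \<Rightarrow> real^2) \<in> lebesgue \<rightarrow>\<^sub>M lebesgue"
    using lebesgue_affine_measurable[of "\<lambda>_. -1 :: real" "0 :: real^2"] unfolding eq by simp
  show "distr lebesgue lebesgue uminus = (lebesgue :: (real^2) measure)"
    using lebesgue_affine_euclidean[of "\<lambda>_. -1 :: real" "0 :: real^2"] unfolding eq
    by (simp add: density_1)
qed

lemma integral_reflect_vec: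
  fixes f :: "real^2 \<Rightarrow> 'b::euclidean_space"
  assumes S: "S \<in> sets lebesgue" and f: "f \<in> borel_measurable (lebesgue_on (uminus ` S))"
  shows "(LINT x|lebesgue_on (uminus ` S). f x) = (LINT x|lebesgue_on S. f (- x))"
    "integrable (lebesgue_on (uminus ` S)) f \<longleftrightarrow> integrable (lebesgue_on S) (\<lambda>x. f (- x))"
    "(\<lambda>x. f (- x)) \<in> borel_measurable (lebesgue_on S)"
proof -
  have S': "uminus ` S \<in> sets lebesgue"
  proof -
    have "uminus ` S = uminus -` S \<inter> space lebesgue" by (auto simp: image_iff) (metis minus_minus)
    then show ?thesis using measurable_sets[OF uminus_lebesgue_measurable S] by simp
  qed
  have ind: "indicator (uminus ` S) x = indicator S (- x)" for x :: "real^2"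
    by (auto simp: indicator_def image_iff) (metis minus_minus)
  have m: "(\<lambda>x. indicator (uminus ` S) x *\<^sub>R f x) \<in> borel_measurable lebesgue"
    using f S' by (subst (asm) borel_measurable_restrict_space_iff) auto
  show "(LINT x|lebesgue_on (uminus ` S). f x) = (LINT x|lebesgue_on S. f (- x))"
  proof -
    have "(LINT x|lebesgue_on (uminus ` S). f x) = (LINT x|distr lebesgue lebesgue uminus. indicator (uminus ` S) x *\<^sub>R f x)"
      unfolding lebesgue_distr_uminus_vec using S' by (subst integral_restrict_space) auto
    also have "\<dots> = (LINT x|lebesgue. indicator S x *\<^sub>R f (- x))"
      by (subst integral_distr[OF uminus_lebesgue_measurable m]) (simp add: ind)
    also have "\<dots> = (LINT x|lebesgue_on S. f (- x))"
      using S by (subst integral_restrict_space) auto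
    finally show ?thesis .
  qed
  show "integrable (lebesgue_on (uminus ` S)) f \<longleftrightarrow> integrable (lebesgue_on S) (\<lambda>x. f (- x))"
  proof -
    have "integrable (lebesgue_on (uminus ` S)) f \<longleftrightarrow>
      integrable (distr lebesgue lebesgue uminus) (\<lambda>x. indicator (uminus ` S) x *\<^sub>R f x)"
      unfolding lebesgue_distr_uminus_vec using S' by (subst integrable_restrict_space) (auto simp: set_integrable_def)
    also have "\<dots> \<longleftrightarrow> integrable lebesgue (\<lambda>x. indicator S x *\<^sub>R f (- x))"
      by (subst integrable_distr_eq[OF uminus_lebesgue_measurable m]) (simp add: ind)
    also have "\<dots> \<longleftrightarrow> integrable (lebesgue_on S) (\<lambda>x. f (- x))"
      using S by (subst integrable_restrict_space) (auto simp: set_integrable_def)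
    finally show ?thesis .
  qed
  show "(\<lambda>x. f (- x)) \<in> borel_measurable (lebesgue_on S)"
    using measurable_compose[OF uminus_lebesgue_measurable m] S
    by (subst borel_measurable_restrict_space_iff) (auto simp: ind)
qed

lemma AE_reflect_vec:
  fixes S :: "(real^2) set"
  assumes S: "S \<in> sets lebesgue" "uminus ` S = S" and ae: "AE x in lebesgue_on S. P x"
  shows "AE x in lebesgue_on S. P (- x)"
proof -
  have "AE x in lebesgue. x \<in> S \<longrightarrow> P x"
    using ae S by (subst (asm) AE_restrict_space_iff) auto
  then have "AE x in distr lebesgue lebesgue uminus. x \<in> S \<longrightarrow> P x"
    unfolding lebesgue_distr_uminus_vec .
  then have "AE x in lebesgue. - x \<in> S \<longrightarrow> P (- x)"
    by (rule AE_distrD[OF uminus_lebesgue_measurable])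
  moreover have "- x \<in> S \<longleftrightarrow> x \<in> S" for x
    using S(2) by (metis image_eqI minus_minus)
  ultimately show ?thesis
    using S by (subst AE_restrict_space_iff) auto
qed

text \<open>A Dynkin class argument: the sets over which \<open>f\<close> integrates to zero contain the boxes.\<close>

lemma AE_zero_if_box_integrals_zero:
  fixes f :: "'a::euclidean_space \<Rightarrow> real"
  assumes f: "integrable lborel f"
    and zero: "\<And>l u. (LINT x|lborel. indicator (box l u) x * f x) = 0"
  shows "AE x in lborel. f x = 0"
proof -
  have [measurable]: "f \<in> borel_measurable borel" using f by auto
  have fin: "integral\<^sup>N lborel (\<lambda>x. ennreal (f x)) \<noteq> \<infinity>" "integral\<^sup>N lborel (\<lambda>x. ennreal (- f x)) \<noteq> \<infinity>"
    using f by (auto simp: real_integrable_def)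
  \<comment> \<open>\<open>ennreal\<close> cuts negative values off at 0, so these are the densities
    of the positive and the negative part. A vanishing integral over A says that the two finite
    measures agree on A.\<close>
  let ?P = "density lborel (\<lambda>x. ennreal (f x))" and ?N = "density lborel (\<lambda>x. ennreal (- f x))"
  have fA: "integrable lborel (\<lambda>x. indicator A x * f x)" if "A \<in> sets borel" for A
    using integrable_mult_indicator[OF _ f, of A] that by simp
  have eq: "emeasure ?P A = emeasure ?N A" if A: "A \<in> sets borel" "(LINT x|lborel. indicator A x * f x) = 0" for A
  proof -
    have i: "integrable lborel (\<lambda>x. indicator A x * f x)" using fA A by auto
    have "emeasure ?P A = (\<integral>\<^sup>+x. ennreal (indicator A x * f x) \<partial>lborel)"
      using A by (subst emeasure_density) (auto intro!: nn_integral_cong simp: indicator_def)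
    moreover have "emeasure ?N A = (\<integral>\<^sup>+x. ennreal (- (indicator A x * f x)) \<partial>lborel)"
      using A by (subst emeasure_density) (auto intro!: nn_integral_cong simp: indicator_def)
    moreover have "enn2real (\<integral>\<^sup>+x. ennreal (indicator A x * f x) \<partial>lborel) = enn2real (\<integral>\<^sup>+x. ennreal (- (indicator A x * f x)) \<partial>lborel)"
      using A(2) unfolding real_lebesgue_integral_def[OF i] by simp
    moreover have "(\<integral>\<^sup>+x. ennreal (indicator A x * f x) \<partial>lborel) \<noteq> \<infinity>" "(\<integral>\<^sup>+x. ennreal (- (indicator A x * f x)) \<partial>lborel) \<noteq> \<infinity>"
      using i by (auto simp: real_integrable_def)
    ultimately show ?thesis
      by (metis ennreal_enn2real infinity_ennreal_def less_top)
  qed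
  have PN: "?P = ?N"
  proof (rule measure_eqI_generator_eq)
    let ?E = "range (\<lambda>(a, b). box a b::'a set)"
    show "Int_stable ?E" by (auto simp: Int_stable_def box_Int_box)
    show "?E \<subseteq> Pow UNIV" "sets ?P = sigma_sets UNIV ?E" "sets ?N = sigma_sets UNIV ?E"
      by (simp_all add: borel_eq_box)
    let ?A = "\<lambda>n::nat. box (- (real n *\<^sub>R One)) (real n *\<^sub>R One) :: 'a set"
    show "range ?A \<subseteq> ?E" "(\<Union>i. ?A i) = UNIV" unfolding UN_box_eq_UNIV by auto
    show "emeasure ?P X = emeasure ?N X" if "X \<in> ?E" for X
      using that by (auto intro!: eq zero)
    show "emeasure ?P (?A i) \<noteq> \<infinity>" for i
    proof -
      have "emeasure ?P (?A i) \<le> emeasure ?P UNIV" by (rule emeasure_mono) auto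
      also have "\<dots> = integral\<^sup>N lborel (\<lambda>x. ennreal (f x))" by (subst emeasure_density) auto
      finally show ?thesis using fin(1) by (auto simp: top_unique)
    qed
  qed
  have "(LINT x|lborel. indicator A x * f x) = 0" if A: "A \<in> sets borel" for A
  proof -
    have "emeasure ?P A = emeasure ?N A" using PN by simp
    moreover have "emeasure ?P A = (\<integral>\<^sup>+x. ennreal (indicator A x * f x) \<partial>lborel)"
      using A by (subst emeasure_density) (auto intro!: nn_integral_cong simp: indicator_def)
    moreover have "emeasure ?N A = (\<integral>\<^sup>+x. ennreal (- (indicator A x * f x)) \<partial>lborel)"
      using A by (subst emeasure_density) (auto intro!: nn_integral_cong simp: indicator_def)
    ultimately show ?thesis using A fA by (subst real_lebesgue_integral_def) auto
  qed
  then show ?thesis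
    by (intro sigma_finite_measure.density_zero[OF lborel.sigma_finite_measure_axioms f]) (auto simp: set_lebesgue_integral_def)
qed

section \<open>Representation of functions by their weak derivative\<close>

lemma square_integrable_mult:
  fixes f g :: "'a \<Rightarrow> real"
  assumes [measurable]: "f \<in> borel_measurable M" "g \<in> borel_measurable M"
    and "integrable M (\<lambda>x. (f x)\<^sup>2)" "integrable M (\<lambda>x. (g x)\<^sup>2)"
  shows "integrable M (\<lambda>x. f x * g x)"
proof (rule Bochner_Integration.integrable_bound)
  show "integrable M (\<lambda>x. (f x)\<^sup>2 + (g x)\<^sup>2)" using assms by auto
  have "\<bar>a * b\<bar> \<le> a\<^sup>2 + b\<^sup>2" for a b :: real
  proof -
    have "0 \<le> \<bar>a\<bar> * \<bar>b\<bar>" by simp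
    then show ?thesis using sum_squares_bound[of "\<bar>a\<bar>" "\<bar>b\<bar>"] unfolding abs_mult power2_abs by linarith
  qed
  then show "AE x in M. norm (f x * g x) \<le> norm ((f x)\<^sup>2 + (g x)\<^sup>2)" by simp
qed measurable

text \<open>The integral of (f - t g)^2 is a quadratic in t that never becomes negative. For C > 0
  the choice t = B / C gives the claim; for C = 0 the quadratic is affine, which forces B =
  0.\<close>

lemma Cauchy_Schwarz_integral:
  fixes f g :: "'a \<Rightarrow> real"
  assumes m: "f \<in> borel_measurable M" "g \<in> borel_measurable M"
    and i: "integrable M (\<lambda>x. (f x)\<^sup>2)" "integrable M (\<lambda>x. (g x)\<^sup>2)"
  shows "(LINT x|M. f x * g x)\<^sup>2 \<le> (LINT x|M. (f x)\<^sup>2) * (LINT x|M. (g x)\<^sup>2)"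
proof -
  let ?A = "LINT x|M. (f x)\<^sup>2" and ?B = "LINT x|M. f x * g x" and ?C = "LINT x|M. (g x)\<^sup>2"
  note fg = square_integrable_mult[OF m i]
  have nn: "0 \<le> ?A - 2 * t * ?B + t\<^sup>2 * ?C" for t
  proof -
    have "0 \<le> (LINT x|M. (f x - t * g x)\<^sup>2)" by simp
    also have "\<dots> = (LINT x|M. (f x)\<^sup>2 - 2 * t * (f x * g x) + t\<^sup>2 * (g x)\<^sup>2)"
      by (simp add: power2_diff power_mult_distrib algebra_simps)
    also have "\<dots> = ?A - 2 * t * ?B + t\<^sup>2 * ?C"
      using i fg by simp
    finally show ?thesis .
  qed
  show ?thesis
  proof (cases "?C = 0")
    case True
    have "?B = 0"
    proof (rule ccontr)
      assume "?B \<noteq> 0"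
      \<comment> \<open>At this t the affine function takes the value -1.\<close>
      then show False using nn[of "(?A + 1) / (2 * ?B)"] True by (simp add: field_simps)
    qed
    then show ?thesis using True by simp
  next
    case False
    moreover have "?C \<ge> 0" by simp
    ultimately have "?C > 0" by linarith
    then show ?thesis using nn[of "?B / ?C"] by (simp add: field_simps power2_eq_square)
  qed
qed

lemma integrable_product_lborel:
  fixes f g :: "real \<Rightarrow> real"
  assumes "integrable lborel f" "integrable lborel g"
  shows "integrable (lborel \<Otimes>\<^sub>M lborel) (\<lambda>z. f (fst z) * g (snd z))"
proof -
  have [measurable]: "f \<in> borel_measurable borel" "g \<in> borel_measurable borel" using assms by auto
  have "integrable (lborel \<Otimes>\<^sub>M lborel) (\<lambda>(x, y). f x * g y)"
    by (rule lborel_pair.Fubini_integrable) (use assms in \<open>auto simp: abs_mult\<close>)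
  then show ?thesis by (simp add: case_prod_unfold)
qed

lemma integral_product_lborel:
  fixes f g :: "real \<Rightarrow> real"
  assumes "integrable lborel f" "integrable lborel g"
  shows "(LINT z|(lborel \<Otimes>\<^sub>M lborel). f (fst z) * g (snd z)) = (LINT x|lborel. f x) * (LINT y|lborel. g y)"
  using lborel_pair.integral_fst[of "\<lambda>x y. f x * g y"] integrable_product_lborel[OF assms]
  by (simp add: case_prod_unfold)

text \<open>Only x > t contributes, and the primitive vanishes far to the right, so what remains is
  its value at the lower end with a minus sign.\<close>

lemma integral_indicator_antiderivative:
  assumes cont: "continuous_on UNIV \<eta>" and D: "\<And>x. (\<alpha> has_real_derivative \<eta> x) (at x)"
    and \<eta>0: "\<And>x. x \<notin> {p..q} \<Longrightarrow> \<eta> x = 0" and \<alpha>0: "\<And>x. x \<notin> {p..q} \<Longrightarrow> \<alpha> x = 0"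
  shows "(LINT x|lborel. indicator {..<x} t * \<eta> x) = - \<alpha> t"
proof -
  define u where "u = max t q + 1"
  have "(LINT x|lborel. indicator {..<x} t * \<eta> x) = (LINT x|lborel. \<eta> x * indicator {t..u} x)"
  proof (rule integral_cong_AE)
    have eq: "indicator {..<x} t = (indicator {t<..} x :: real)" for x by (auto simp: indicator_def)
    show "(\<lambda>x. indicator {..<x} t * \<eta> x) \<in> borel_measurable lborel"
      unfolding eq using borel_measurable_continuous_onI[OF cont] by auto
    show "AE x in lborel. indicator {..<x} t * \<eta> x = \<eta> x * indicator {t..u} x"
      using AE_lborel_singleton[of t] by eventually_elim (use \<eta>0 in \<open>force simp: indicator_def u_def\<close>)
  qed (use borel_measurable_continuous_onI[OF cont] in auto)
  also have "\<dots> = \<alpha> u - \<alpha> t"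
    by (rule integral_FTC_Icc_real) (use cont D in \<open>auto simp: u_def continuous_on_eq_continuous_at\<close>)
  also have "\<alpha> u = 0" by (rule \<alpha>0) (auto simp: u_def)
  finally show ?thesis by simp
qed

text \<open>Fubini on the half plane t < x. The primitive of g is never differentiated, so
  integrability of g is enough.\<close>

lemma integral_primitive_by_parts:
  assumes g: "integrable lborel (g :: real \<Rightarrow> real)"
    and cont: "continuous_on UNIV \<eta>" and D: "\<And>x. (\<alpha> has_real_derivative \<eta> x) (at x)"
    and \<eta>0: "\<And>x. x \<notin> {p..q} \<Longrightarrow> \<eta> x = 0" and \<alpha>0: "\<And>x. x \<notin> {p..q} \<Longrightarrow> \<alpha> x = 0"
  shows "(LINT x|lborel. (LINT t|lborel. indicator {..<x} t * g t) * \<eta> x) = - (LINT t|lborel. g t * \<alpha> t)"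
proof -
  have [measurable]: "g \<in> borel_measurable borel" "\<eta> \<in> borel_measurable borel"
    using g cont by (auto intro: borel_measurable_continuous_onI)
  have \<eta>: "integrable lborel \<eta>" using continuous_compact_support_integrable[OF cont \<eta>0] by blast
  have ind: "(\<lambda>z. indicator {..<fst z} (snd z)) = (indicator {z. snd z < fst z} :: real \<times> real \<Rightarrow> real)"
    by (auto simp: indicator_def fun_eq_iff)
  have set: "{z :: real \<times> real. snd z < fst z} \<in> sets (lborel \<Otimes>\<^sub>M lborel)"
    unfolding lborel_prod sets_lborel by (intro borel_open open_Collect_less continuous_intros)
  have "integrable (lborel \<Otimes>\<^sub>M lborel) (\<lambda>z. indicator {z. snd z < fst z} z *\<^sub>R (\<eta> (fst z) * g (snd z)))"
    by (rule integrable_mult_indicator[OF set integrable_product_lborel[OF \<eta> g]])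
  then have int: "integrable (lborel \<Otimes>\<^sub>M lborel) (\<lambda>(x, t). indicator {..<x} t * g t * \<eta> x)"
    unfolding ind[symmetric] by (simp add: case_prod_unfold mult_ac)
  have "(LINT x|lborel. (LINT t|lborel. indicator {..<x} t * g t) * \<eta> x) = (LINT x|lborel. LINT t|lborel. indicator {..<x} t * g t * \<eta> x)"
    by simp
  also have "\<dots> = (LINT t|lborel. LINT x|lborel. indicator {..<x} t * g t * \<eta> x)"
    using lborel_pair.Fubini_integral[OF int] by simp
  also have "\<dots> = (LINT t|lborel. g t * (LINT x|lborel. indicator {..<x} t * \<eta> x))"
    by (simp add: mult_ac flip: integral_mult_right_zero)
  also have "\<dots> = - (LINT t|lborel. g t * \<alpha> t)"
  proof -
    have "(LINT x|lborel. indicator {..<x} t * \<eta> x) = - \<alpha> t" for t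
      by (rule integral_indicator_antiderivative[OF cont D \<eta>0 \<alpha>0])
    then show ?thesis by simp
  qed
  finally show ?thesis .
qed

section \<open>Primitives in the first coordinate and the lemma of du Bois-Reymond\<close>

definition partial_primitive :: "(real \<times> real \<Rightarrow> real) \<Rightarrow> real \<times> real \<Rightarrow> real" where
  "partial_primitive G z = (LINT t|lborel. indicator {..<fst z} t * G (t, snd z))"

lemma partial_primitive_measurable [measurable]:
  assumes [measurable]: "G \<in> borel_measurable (lborel \<Otimes>\<^sub>M lborel)"
  shows "partial_primitive G \<in> borel_measurable (lborel \<Otimes>\<^sub>M lborel)"
proof -
  have "Measurable.pred ((lborel \<Otimes>\<^sub>M lborel) \<Otimes>\<^sub>M lborel) (\<lambda>p :: (real \<times> real) \<times> real. snd p < fst (fst p))"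
    by measurable
  then have [measurable]: "(\<lambda>p :: (real \<times> real) \<times> real. indicator {..<fst (fst p)} (snd p) :: real) \<in> borel_measurable ((lborel \<Otimes>\<^sub>M lborel) \<Otimes>\<^sub>M lborel)"
    by (simp add: indicator_def lessThan_def)
  show ?thesis
    unfolding partial_primitive_def [abs_def]
    by (rule lborel.borel_measurable_lebesgue_integral) (simp add: case_prod_unfold)
qed

lemma partial_primitive_bound:
  "\<bar>partial_primitive G (x, y)\<bar> \<le> (LINT t|lborel. \<bar>G (t, y)\<bar>)" if "integrable lborel (\<lambda>t. G (t, y))"
proof -
  have "\<bar>partial_primitive G (x, y)\<bar> \<le> (LINT t|lborel. \<bar>indicator {..<x} t * G (t, y)\<bar>)"
    unfolding partial_primitive_def by simp
  also have "\<dots> \<le> (LINT t|lborel. \<bar>G (t, y)\<bar>)"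
  proof (rule integral_mono)
    show "integrable lborel (\<lambda>t. \<bar>indicator {..<x} t * G (t, y)\<bar>)"
      using integrable_mult_indicator[OF _ that, of "{..<x}"] by (auto intro: integrable_abs)
    show "integrable lborel (\<lambda>t. \<bar>G (t, y)\<bar>)" using that by (rule integrable_abs)
  qed (auto simp: indicator_def)
  finally show ?thesis .
qed

text \<open>On almost every slice the primitive is bounded by the L1 norm of the slice, which is
  integrable in the second coordinate. In the first coordinate it need not decay, hence the
  integrable factor f.\<close>

lemma partial_primitive_integrable:
  assumes G: "integrable (lborel \<Otimes>\<^sub>M lborel) G"
    and f: "integrable lborel (f :: real \<Rightarrow> real)"
  shows "integrable (lborel \<Otimes>\<^sub>M lborel) (\<lambda>z. f (fst z) * partial_primitive G z)"
proof -
  have G': "integrable (lborel \<Otimes>\<^sub>M lborel) (\<lambda>(x, y). G (x, y))" using G by simp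
  have [measurable]: "G \<in> borel_measurable (lborel \<Otimes>\<^sub>M lborel)" using G by auto
  have [measurable]: "f \<in> borel_measurable borel" using f by auto
  define N where "N y = (LINT t|lborel. \<bar>G (t, y)\<bar>)" for y
  have N: "integrable lborel N"
    unfolding N_def by (rule lborel_pair.integrable_snd) (use integrable_abs[OF G] in \<open>simp add: case_prod_unfold\<close>)
  have "AE y in lborel. integrable lborel (\<lambda>t. G (t, y))"
    by (rule lborel_pair.AE_integrable_snd[OF G'])
  \<comment> \<open>Passing from almost every slice to almost every point of the plane requires the
    set of good points to be measurable.\<close>
  moreover have "{z \<in> space (lborel \<Otimes>\<^sub>M lborel). integrable lborel (\<lambda>t. G (t, snd (z :: real \<times> real)))} \<in> sets (lborel \<Otimes>\<^sub>M lborel)"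
  proof -
    have "Measurable.pred (lborel \<Otimes>\<^sub>M lborel) (\<lambda>z :: real \<times> real. (\<integral>\<^sup>+ t. ennreal (norm (G (t, snd z))) \<partial>lborel) < \<infinity>)"
      by measurable
    moreover have "(\<lambda>t. G (t, snd z)) \<in> borel_measurable lborel" for z :: "real \<times> real"
      by measurable
    ultimately show ?thesis unfolding integrable_iff_bounded pred_def by simp
  qed
  ultimately have ae: "AE z in lborel \<Otimes>\<^sub>M lborel. integrable lborel (\<lambda>t. G (t, snd (z :: real \<times> real)))"
    by (intro lborel_pair.AE_pair_measure) auto
  show ?thesis
  proof (rule Bochner_Integration.integrable_bound[OF integrable_product_lborel[OF f N]])
    show "AE z in lborel \<Otimes>\<^sub>M lborel. norm (f (fst z) * partial_primitive G z) \<le> norm (f (fst z) * N (snd z))"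
      using ae
    proof eventually_elim
      case (elim z)
      have "\<bar>partial_primitive G z\<bar> \<le> N (snd z)"
        using partial_primitive_bound[of G "snd z" "fst z"] elim by (simp add: N_def)
      then show ?case by (simp add: abs_mult mult_left_mono)
    qed
  qed simp
qed

text \<open>Integration by parts on almost every slice, with the second coordinate as a parameter;
  the bounds on \<alpha> and \<beta> make the products integrable over the plane.\<close>

lemma partial_primitive_by_parts:
  assumes G: "integrable (lborel \<Otimes>\<^sub>M lborel) G"
    and cont: "continuous_on UNIV \<eta>" "continuous_on UNIV \<beta>"
    and D: "\<And>x. (\<alpha> has_real_derivative \<eta> x) (at x)"
    and \<eta>0: "\<And>x. x \<notin> {p..q} \<Longrightarrow> \<eta> x = 0" and \<alpha>0: "\<And>x. x \<notin> {p..q} \<Longrightarrow> \<alpha> x = 0"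
    and b: "\<And>x. \<bar>\<beta> x\<bar> \<le> B" and a: "\<And>x. \<bar>\<alpha> x\<bar> \<le> A"
  shows "(LINT z|(lborel \<Otimes>\<^sub>M lborel). partial_primitive G z * (\<eta> (fst z) * \<beta> (snd z))) =
    - (LINT z|(lborel \<Otimes>\<^sub>M lborel). G z * (\<alpha> (fst z) * \<beta> (snd z)))"
proof -
  let ?M = "lborel \<Otimes>\<^sub>M lborel :: (real \<times> real) measure"
  have [measurable]: "G \<in> borel_measurable (lborel \<Otimes>\<^sub>M lborel)" using G by auto
  have conta: "continuous_on UNIV \<alpha>" using D by (auto intro!: continuous_at_imp_continuous_on DERIV_isCont)
  have [measurable]: "\<eta> \<in> borel_measurable borel" "\<beta> \<in> borel_measurable borel" "\<alpha> \<in> borel_measurable borel"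
    using cont conta by (auto intro: borel_measurable_continuous_onI)
  have \<eta>: "integrable lborel \<eta>" using continuous_compact_support_integrable[OF cont(1) \<eta>0] by blast
  have G': "integrable ?M (\<lambda>(x, y). G (x, y))" using G by simp
  have "integrable ?M (\<lambda>z. (\<eta> (fst z) * partial_primitive G z) * \<beta> (snd z))"
    by (rule Bochner_Integration.integrable_bound[OF integrable_mult_left[OF partial_primitive_integrable[OF G \<eta>], of B]])
      (use b in \<open>auto simp: abs_mult intro!: mult_left_mono order_trans[OF b abs_ge_self]\<close>)
  then have i1: "integrable ?M (\<lambda>(x, y). partial_primitive G (x, y) * (\<eta> x * \<beta> y))"
    by (simp add: case_prod_unfold mult_ac)
  have bd: "\<bar>\<alpha> x * \<beta> y\<bar> \<le> A * B" for x y
    using a[of x] b[of y] by (auto simp: abs_mult intro!: mult_mono order_trans[OF abs_ge_zero a])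
  have "integrable ?M (\<lambda>z. G z * (\<alpha> (fst z) * \<beta> (snd z)))"
    by (rule Bochner_Integration.integrable_bound[OF integrable_mult_left[OF G, of "A * B"]])
      (use bd in \<open>auto simp: abs_mult[of "G _"] intro!: mult_left_mono order_trans[OF bd abs_ge_self]\<close>)
  then have i2: "integrable ?M (\<lambda>(x, y). G (x, y) * (\<alpha> x * \<beta> y))"
    by (simp add: case_prod_unfold)
  have "(LINT z|?M. partial_primitive G z * (\<eta> (fst z) * \<beta> (snd z))) =
    (LINT y|lborel. LINT x|lborel. partial_primitive G (x, y) * (\<eta> x * \<beta> y))"
    using lborel_pair.integral_snd[OF i1] by (simp add: case_prod_unfold)
  also have "\<dots> = (LINT y|lborel. - (LINT t|lborel. G (t, y) * (\<alpha> t * \<beta> y)))"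
  proof (rule integral_cong_AE)
    show "(\<lambda>y. LINT x|lborel. partial_primitive G (x, y) * (\<eta> x * \<beta> y)) \<in> borel_measurable lborel"
      using borel_measurable_integrable[OF lborel_pair.integrable_snd[OF i1]] by simp
    show "(\<lambda>y. - (LINT t|lborel. G (t, y) * (\<alpha> t * \<beta> y))) \<in> borel_measurable lborel"
      using borel_measurable_integrable[OF lborel_pair.integrable_snd[OF i2]] by simp
    show "AE y in lborel. (LINT x|lborel. partial_primitive G (x, y) * (\<eta> x * \<beta> y)) = - (LINT t|lborel. G (t, y) * (\<alpha> t * \<beta> y))"
      using lborel_pair.AE_integrable_snd[OF G']
    proof eventually_elim
      case (elim y)
      show ?case
        using integral_primitive_by_parts[OF elim cont(1) D \<eta>0 \<alpha>0]
        by (simp add: partial_primitive_def mult.assoc[symmetric])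
    qed
  qed
  also have "\<dots> = - (LINT z|?M. G z * (\<alpha> (fst z) * \<beta> (snd z)))"
    using lborel_pair.integral_snd[OF i2] by (simp add: case_prod_unfold)
  finally show ?thesis .
qed

lemma integrable_indicator_Ioo: "integrable lborel (indicat_real {p<..<q::real})"
  by (cases "p \<le> q") (auto intro!: integrable_real_indicator)

text \<open>Stated for the first coordinate; the second is handled by swapping the variables. The
  supports lie in closed intervals strictly inside the rectangle, so that the products are test
  functions of the open rectangle.\<close>

definition weak_x_derivative ::
    "real \<Rightarrow> real \<Rightarrow> real \<Rightarrow> real \<Rightarrow> (real \<times> real \<Rightarrow> real) \<Rightarrow> (real \<times> real \<Rightarrow> real) \<Rightarrow> bool" where
  "weak_x_derivative a b c d U G \<longleftrightarrow> (\<forall>\<alpha> \<alpha>' \<beta> p q r s.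
      a < p \<and> q < b \<and> c < r \<and> s < d \<and> p \<le> q \<and> r \<le> s \<and> smooth \<alpha> \<and> smooth \<beta> \<and>
      (\<forall>x. (\<alpha> has_real_derivative \<alpha>' x) (at x)) \<and>
      (\<forall>x. x \<notin> {p..q} \<longrightarrow> \<alpha> x = 0) \<and> (\<forall>x. x \<notin> {r..s} \<longrightarrow> \<beta> x = 0) \<longrightarrow>
      (LINT z|(lborel \<Otimes>\<^sub>M lborel). U z * (\<alpha>' (fst z) * \<beta> (snd z))) =
      - (LINT z|(lborel \<Otimes>\<^sub>M lborel). G z * (\<alpha> (fst z) * \<beta> (snd z))))"

text \<open>The difference W of U and the primitive of G has weak x-derivative zero. A test function
  of mean zero in x is a derivative, so over boxes with the same y-range the integral of W is
  proportional to the x-extent, and W is a function of y alone: the lemma of du Bois-Reymond with a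
  parameter.\<close>

lemma weak_derivative_representation:
  fixes U G :: "real \<times> real \<Rightarrow> real"
  assumes U: "integrable (lborel \<Otimes>\<^sub>M lborel) U" and G: "integrable (lborel \<Otimes>\<^sub>M lborel) G"
    and ab: "a < b"
    and weak: "weak_x_derivative a b c d U G"
  obtains w where "w \<in> borel_measurable borel"
    "AE z in lborel \<Otimes>\<^sub>M lborel. fst z \<in> {a<..<b} \<and> snd z \<in> {c<..<d} \<longrightarrow> U z = w (snd z) + partial_primitive G z"
proof -
  let ?M = "lborel \<Otimes>\<^sub>M lborel :: (real \<times> real) measure"
  have [measurable]: "G \<in> borel_measurable (lborel \<Otimes>\<^sub>M lborel)" "U \<in> borel_measurable (lborel \<Otimes>\<^sub>M lborel)"
    using G U by auto
  define W where "W z = U z - partial_primitive G z" for z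
  have [measurable]: "W \<in> borel_measurable (lborel \<Otimes>\<^sub>M lborel)" unfolding W_def by measurable
  \<comment> \<open>The primitive need not decay in the first coordinate, so W is made integrable by
    this cutoff; test functions supported in (a, b) do not notice it.\<close>
  define J :: "real \<Rightarrow> real" where "J = indicator {a<..<b}"
  have [measurable]: "J \<in> borel_measurable borel" unfolding J_def by simp
  have Ji: "integrable lborel J" unfolding J_def by (rule integrable_indicator_Ioo)
  have JW: "integrable ?M (\<lambda>z. J (fst z) * W z)"
  proof -
    have "integrable ?M (\<lambda>z. J (fst z) * U z)"
      by (rule Bochner_Integration.integrable_bound[OF U]) (auto simp: J_def indicator_def)
    from Bochner_Integration.integrable_diff[OF this partial_primitive_integrable[OF G Ji]]
    show ?thesis by (simp add: W_def algebra_simps)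
  qed
  have cut: "W z * (\<eta> (fst z) * \<beta> (snd z)) = J (fst z) * W z * (\<eta> (fst z) * \<beta> (snd z))"
    if "a < p" "q < b" "\<And>x. x \<notin> {p..q} \<Longrightarrow> \<eta> x = 0" for z and p q :: real and \<eta> \<beta> :: "real \<Rightarrow> real"
  proof (cases "fst z \<in> {p..q}")
    case True
    then have "fst z \<in> {a<..<b}" using that by auto
    then show ?thesis by (simp add: J_def)
  next
    case False then show ?thesis using that(3) by simp
  qed
  have bounded: "\<exists>B. \<forall>x. \<bar>f x\<bar> \<le> B" if "continuous_on UNIV f" "\<And>x. x \<notin> {p..q} \<Longrightarrow> f x = 0"
    for f :: "real \<Rightarrow> real" and p q
  proof -
    have "bounded (f ` {p..q})"
      by (rule compact_imp_bounded[OF compact_continuous_image]) (use that in \<open>auto intro: continuous_on_subset\<close>)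
    then obtain B where "\<forall>y \<in> f ` {p..q}. \<bar>y\<bar> \<le> B" unfolding bounded_real by blast
    then have B: "\<And>x. x \<in> {p..q} \<Longrightarrow> \<bar>f x\<bar> \<le> B" by blast
    have "\<bar>f x\<bar> \<le> max B 0" for x using B[of x] that(2)[of x] by (cases "x \<in> {p..q}") auto
    then show ?thesis by blast
  qed
  have mean0: "(LINT z|?M. W z * (\<eta> (fst z) * \<beta> (snd z))) = 0"
    if pq: "a < p" "q < b" "p \<le> q" and rs: "c < r" "s < d" "r \<le> s" and \<eta>: "smooth \<eta>" "\<And>x. x \<notin> {p..q} \<Longrightarrow> \<eta> x = 0"
      and \<beta>: "smooth \<beta>" "\<And>x. x \<notin> {r..s} \<Longrightarrow> \<beta> x = 0" and mean: "(LINT x|lborel. \<eta> x) = 0" for \<eta> \<beta> p q r s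
  proof -
    obtain \<alpha> where \<alpha>: "smooth \<alpha>" "\<And>x. x \<notin> {p..q} \<Longrightarrow> \<alpha> x = 0" "\<And>x. (\<alpha> has_real_derivative \<eta> x) (at x)"
      using smooth_antiderivative_compact_support[OF \<eta> mean pq(3)] by blast
    note cont = smooth_continuous[OF \<eta>(1)] smooth_continuous[OF \<beta>(1)] smooth_continuous[OF \<alpha>(1)]
    have [measurable]: "\<eta> \<in> borel_measurable borel" "\<beta> \<in> borel_measurable borel"
      using cont by (auto intro: borel_measurable_continuous_onI)
    obtain A where A: "\<And>x. \<bar>\<alpha> x\<bar> \<le> A" using bounded[OF cont(3) \<alpha>(2)] by blast
    obtain B where B: "\<And>x. \<bar>\<beta> x\<bar> \<le> B" using bounded[OF cont(2) \<beta>(2)] by blast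
    obtain E where E: "\<And>x. \<bar>\<eta> x\<bar> \<le> E" using bounded[OF cont(1) \<eta>(2)] by blast
    have EB: "\<bar>\<eta> x * \<beta> y\<bar> \<le> E * B" for x y
      using E[of x] B[of y] by (auto simp: abs_mult intro!: mult_mono order_trans[OF abs_ge_zero E])
    have iU: "integrable ?M (\<lambda>z. U z * (\<eta> (fst z) * \<beta> (snd z)))"
      by (rule Bochner_Integration.integrable_bound[OF integrable_mult_left[OF U, of "E * B"]])
        (use EB in \<open>auto simp: abs_mult[of "U _"] intro!: mult_left_mono order_trans[OF EB abs_ge_self]\<close>)
    have "integrable ?M (\<lambda>z. J (fst z) * W z * (\<eta> (fst z) * \<beta> (snd z)))"
      by (rule Bochner_Integration.integrable_bound[OF integrable_mult_left[OF JW, of "E * B"]])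
        (use EB in \<open>auto simp: abs_mult[of "J _ * W _"] intro!: mult_left_mono order_trans[OF EB abs_ge_self]\<close>)
    moreover have "(\<lambda>z. W z * (\<eta> (fst z) * \<beta> (snd z))) = (\<lambda>z. J (fst z) * W z * (\<eta> (fst z) * \<beta> (snd z)))"
      by (rule ext, rule cut[OF pq(1,2)], rule \<eta>(2))
    ultimately have "integrable ?M (\<lambda>z. W z * (\<eta> (fst z) * \<beta> (snd z)))" by simp
    with iU have "integrable ?M (\<lambda>z. U z * (\<eta> (fst z) * \<beta> (snd z)) - W z * (\<eta> (fst z) * \<beta> (snd z)))"
      "(LINT z|?M. U z * (\<eta> (fst z) * \<beta> (snd z)) - W z * (\<eta> (fst z) * \<beta> (snd z))) =
       (LINT z|?M. U z * (\<eta> (fst z) * \<beta> (snd z))) - (LINT z|?M. W z * (\<eta> (fst z) * \<beta> (snd z)))"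
      by auto
    moreover have "U z * (\<eta> (fst z) * \<beta> (snd z)) - W z * (\<eta> (fst z) * \<beta> (snd z)) = partial_primitive G z * (\<eta> (fst z) * \<beta> (snd z))" for z
      by (simp add: W_def algebra_simps)
    ultimately have "(LINT z|?M. W z * (\<eta> (fst z) * \<beta> (snd z))) = 
      (LINT z|?M. U z * (\<eta> (fst z) * \<beta> (snd z))) - (LINT z|?M. partial_primitive G z * (\<eta> (fst z) * \<beta> (snd z)))"
      by simp
    also have "\<dots> = 0"
      using partial_primitive_by_parts[OF G cont(1,2) \<alpha>(3) \<eta>(2) \<alpha>(2) B A]
        weak[unfolded weak_x_derivative_def, rule_format, of p q r s \<alpha> \<beta> \<eta>] pq rs \<alpha> \<beta> by simp
    finally show ?thesis .
  qed
  have bumpI: "integrable lborel (bump p q n)" for p q n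
    by (rule continuous_compact_support_integrable[OF smooth_continuous[OF smooth_bump], of p q]) (auto simp: bump_outside)
  have [measurable]: "bump p q n \<in> borel_measurable borel" for p q n
    using smooth_continuous[OF smooth_bump] by (rule borel_measurable_continuous_onI)
  have JWB: "integrable ?M (\<lambda>z. W z * (bump p q n (fst z) * bump r s m (snd z)))"
    if "a < p" "q < b" for p q r s n m
  proof -
    have "integrable ?M (\<lambda>z. J (fst z) * W z * (bump p q n (fst z) * bump r s m (snd z)))"
      by (rule Bochner_Integration.integrable_bound[OF JW])
        (auto simp: abs_mult bump_bounds intro!: mult_right_le_one_le mult_le_one)
    moreover have "(\<lambda>z. W z * (bump p q n (fst z) * bump r s m (snd z))) = (\<lambda>z. J (fst z) * W z * (bump p q n (fst z) * bump r s m (snd z)))"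
      by (rule ext, rule cut[OF that]) (auto simp: bump_outside)
    ultimately show ?thesis by simp
  qed
  have pre: "(LINT x|lborel. bump p0 q0 n x) * (LINT z|?M. W z * (bump p q n (fst z) * bump r s n (snd z))) =
    (LINT x|lborel. bump p q n x) * (LINT z|?M. W z * (bump p0 q0 n (fst z) * bump r s n (snd z)))"
    if pq: "a < p" "q < b" "p \<le> q" and rs: "c < r" "s < d" "r \<le> s" and pq0: "a < p0" "q0 < b" "p0 \<le> q0" for p q r s p0 q0 n
  proof -
    let ?\<nu> = "LINT x|lborel. bump p0 q0 n x" and ?m = "LINT x|lborel. bump p q n x"
    \<comment> \<open>Each bump is weighted with the mass of the other, so that the combination has
      mean zero.\<close>
    let ?\<eta> = "\<lambda>x. ?\<nu> * bump p q n x - ?m * bump p0 q0 n x"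
    have "(LINT z|?M. W z * (?\<eta> (fst z) * bump r s n (snd z))) = 0"
    proof (rule mean0[where p = "min p p0" and q = "max q q0"])
      show "smooth ?\<eta>" by (intro smooth_diff smooth_mult smooth_const smooth_bump)
      have "(LINT x|lborel. ?\<eta> x) = (LINT x|lborel. ?\<nu> * bump p q n x) - (LINT x|lborel. ?m * bump p0 q0 n x)"
        by (intro Bochner_Integration.integral_diff integrable_mult_right bumpI)
      then show "(LINT x|lborel. ?\<eta> x) = 0" by (simp add: mult.commute)
      show "?\<eta> x = 0" if "x \<notin> {min p p0..max q q0}" for x
        using that bump_outside[of x p q n] bump_outside[of x p0 q0 n] by force
      show "bump r s n x = 0" if "x \<notin> {r..s}" for x using that bump_outside[of x r s n] by force
    qed (use that smooth_bump in auto)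
    moreover have "(\<lambda>z. W z * (?\<eta> (fst z) * bump r s n (snd z))) =
      (\<lambda>z. ?\<nu> * (W z * (bump p q n (fst z) * bump r s n (snd z))) - ?m * (W z * (bump p0 q0 n (fst z) * bump r s n (snd z))))"
      by (simp add: fun_eq_iff algebra_simps)
    moreover have "(LINT z|?M. ?\<nu> * (W z * (bump p q n (fst z) * bump r s n (snd z))) - ?m * (W z * (bump p0 q0 n (fst z) * bump r s n (snd z)))) =
      ?\<nu> * (LINT z|?M. W z * (bump p q n (fst z) * bump r s n (snd z))) - ?m * (LINT z|?M. W z * (bump p0 q0 n (fst z) * bump r s n (snd z)))"
      using JWB[OF pq(1,2), of n r s n] JWB[OF pq0(1,2), of n r s n]
      by (subst Bochner_Integration.integral_diff) auto
    ultimately show ?thesis by simp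
  qed
  have lim1: "(\<lambda>n. LINT x|lborel. bump p q n x) \<longlonglongrightarrow> q - p" if "p \<le> q" for p q
  proof -
    have "(\<lambda>n. LINT x|lborel. bump p q n x) \<longlonglongrightarrow> (LINT x|lborel. indicator {p<..<q} x)"
      by (rule integral_dominated_convergence[where w = "indicator {p<..<q}"])
        (use integrable_indicator_Ioo bump_tendsto bump_bounds bump_outside in \<open>auto simp: indicator_def\<close>)
    then show ?thesis using that by simp
  qed
  have lim2: "(\<lambda>n. LINT z|?M. W z * (bump p q n (fst z) * bump r s n (snd z))) \<longlonglongrightarrow>
      (LINT z|?M. W z * (indicator {p<..<q} (fst z) * indicator {r<..<s} (snd z)))" if "a < p" "q < b" for p q r s
  proof (rule integral_dominated_convergence[where w = "\<lambda>z. \<bar>J (fst z) * W z\<bar>"])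
    show "integrable ?M (\<lambda>z. \<bar>J (fst z) * W z\<bar>)" using JW by (rule integrable_abs)
    show "AE z in ?M. (\<lambda>n. W z * (bump p q n (fst z) * bump r s n (snd z)))
         \<longlonglongrightarrow> W z * (indicat_real {p<..<q} (fst z) * indicat_real {r<..<s} (snd z))"
      by (intro AE_I2 tendsto_intros bump_tendsto)
    show "AE z in ?M. norm (W z * (bump p q n (fst z) * bump r s n (snd z))) \<le> \<bar>J (fst z) * W z\<bar>" for n
    proof (rule AE_I2)
      fix z :: "real \<times> real"
      have "norm (W z * (bump p q n (fst z) * bump r s n (snd z))) = norm (J (fst z) * W z * (bump p q n (fst z) * bump r s n (snd z)))"
        by (rule arg_cong[OF cut[OF that]]) (auto simp: bump_outside)
      also have "\<dots> \<le> \<bar>J (fst z) * W z\<bar>"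
        by (simp add: abs_mult bump_bounds mult_right_le_one_le mult_le_one)
      finally show "norm (W z * (bump p q n (fst z) * bump r s n (snd z))) \<le> \<bar>J (fst z) * W z\<bar>" .
    qed
  qed measurable
  have key: "(q0 - p0) * (LINT z|?M. W z * (indicator {p<..<q} (fst z) * indicator {r<..<s} (snd z))) =
    (q - p) * (LINT z|?M. W z * (indicator {p0<..<q0} (fst z) * indicator {r<..<s} (snd z)))"
    if pq: "a < p" "q < b" "p \<le> q" and rs: "c < r" "s < d" "r \<le> s" and pq0: "a < p0" "q0 < b" "p0 \<le> q0" for p q r s p0 q0
    by (rule LIMSEQ_unique[OF tendsto_mult[OF lim1[OF pq0(3)] lim2[OF pq(1,2), of r s]]])
      (use tendsto_mult[OF lim1[OF pq(3)] lim2[OF pq0(1,2), of r s]] pre[OF pq rs pq0] in simp)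
  \<comment> \<open>The middle third serves as a fixed reference interval; the average of W over it
    is the candidate for w.\<close>
  define p0 where "p0 = a + (b - a) / 3"
  define q0 where "q0 = b - (b - a) / 3"
  have pq0: "a < p0" "q0 < b" "p0 \<le> q0" "p0 < q0" using ab by (auto simp: p0_def q0_def field_simps)
  define w where "w y = (LINT x|lborel. W (x, y) * indicator {p0<..<q0} x) / (q0 - p0)" for y
  have i0: "integrable ?M (\<lambda>(x, y). W (x, y) * indicator {p0<..<q0} x)"
  proof -
    have "integrable ?M (\<lambda>z. J (fst z) * W z * indicator {p0<..<q0} (fst z))"
      by (rule Bochner_Integration.integrable_bound[OF JW]) (auto simp: indicator_def)
    moreover have "J (fst z) * W z * indicator {p0<..<q0} (fst z) = W z * indicator {p0<..<q0} (fst z)" for z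
      using pq0 by (auto simp: J_def indicator_def)
    ultimately show ?thesis by (simp add: case_prod_unfold)
  qed
  have w: "integrable lborel w"
    unfolding w_def using lborel_pair.integrable_snd[OF i0] by simp
  have [measurable]: "w \<in> borel_measurable borel" using w by auto
  have wint: "(q0 - p0) * (LINT y|lborel. w y * indicator {r<..<s} y) =
     (LINT z|?M. W z * (indicator {p0<..<q0} (fst z) * indicator {r<..<s} (snd z)))" for r s
  proof -
    have "integrable ?M (\<lambda>z. (case z of (x, y) \<Rightarrow> W (x, y) * indicator {p0<..<q0} x) * indicator {r<..<s} (snd z))"
      by (rule Bochner_Integration.integrable_bound[OF i0]) (auto simp: indicator_def)
    then have i1: "integrable ?M (\<lambda>(x, y). W (x, y) * (indicator {p0<..<q0} x * indicator {r<..<s} y))"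
      by (simp add: case_prod_unfold mult.assoc)
    have "(LINT z|?M. W z * (indicator {p0<..<q0} (fst z) * indicator {r<..<s} (snd z))) =
      (LINT y|lborel. LINT x|lborel. W (x, y) * (indicator {p0<..<q0} x * indicator {r<..<s} y))"
      using lborel_pair.integral_snd[OF i1] by (simp add: case_prod_unfold)
    also have "\<dots> = (LINT y|lborel. (q0 - p0) * (w y * indicator {r<..<s} y))"
      using pq0(4) by (simp add: w_def mult.assoc[symmetric])
    finally show ?thesis by simp
  qed
  \<comment> \<open>Integrals are compared only on boxes that stay away from the edges. In the end
    the margin \<delta> runs through 1 / (n + 1), which exhausts the rectangle.\<close>
  define f where "f \<delta> z = indicator {a + \<delta><..<b - \<delta>} (fst z) * indicator {c + \<delta><..<d - \<delta>} (snd z) * (W z - w (snd z))" for \<delta> z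
  have f0: "AE z in ?M. f \<delta> z = 0" if "\<delta> > 0" for \<delta>
  proof -
    have Jw: "integrable ?M (\<lambda>z. J (fst z) * w (snd z))" by (rule integrable_product_lborel[OF Ji w])
    have fi: "integrable ?M (f \<delta>)"
    proof (rule Bochner_Integration.integrable_bound[OF Bochner_Integration.integrable_diff[OF JW Jw]])
      show "f \<delta> \<in> borel_measurable ?M" unfolding f_def by measurable
      show "AE z in ?M. norm (f \<delta> z) \<le> norm (J (fst z) * W z - J (fst z) * w (snd z))"
        using that by (auto simp: f_def J_def indicator_def)
    qed
    have "(LINT z|lborel. indicator (box l u) z * f \<delta> z) = 0" for l u
    proof -
      define p q r s where "p = max (fst l) (a + \<delta>)" "q = min (fst u) (b - \<delta>)"
        "r = max (snd l) (c + \<delta>)" "s = min (snd u) (d - \<delta>)"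
      note defs = this
      have eq: "indicator (box l u) z * f \<delta> z = (W z - w (snd z)) * (indicator {p<..<q} (fst z) * indicator {r<..<s} (snd z))" for z
        by (cases z; cases l; cases u) (auto simp: f_def defs indicator_def mem_box Basis_prod_def)
      show ?thesis
      proof (cases "p \<le> q \<and> r \<le> s")
        case False
        then have "(\<lambda>z. indicator (box l u) z * f \<delta> z) = (\<lambda>z. 0)" unfolding eq by (auto simp: indicator_def)
        then show ?thesis by simp
      next
        case True
        have pq: "a < p" "q < b" "p \<le> q" "c < r" "s < d" "r \<le> s" using True that by (auto simp: defs)
        have "integrable ?M (\<lambda>z. J (fst z) * W z * (indicator {p<..<q} (fst z) * indicator {r<..<s} (snd z)))"
          by (rule Bochner_Integration.integrable_bound[OF JW]) (auto simp: indicator_def)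
        then have i1: "integrable ?M (\<lambda>z. W z * (indicator {p<..<q} (fst z) * indicator {r<..<s} (snd z)))"
          by (subst cut[OF pq(1,2)]) auto
        have wr: "integrable lborel (\<lambda>y. w y * indicator {r<..<s} y)"
          by (rule Bochner_Integration.integrable_bound[OF w]) (auto simp: indicator_def)
        have i2: "integrable ?M (\<lambda>z. indicator {p<..<q} (fst z) * (w (snd z) * indicator {r<..<s} (snd z)))"
          by (rule integrable_product_lborel[OF integrable_indicator_Ioo wr])
        have "(LINT z|lborel. indicator (box l u) z * f \<delta> z) =
          (LINT z|?M. W z * (indicator {p<..<q} (fst z) * indicator {r<..<s} (snd z)) - indicator {p<..<q} (fst z) * (w (snd z) * indicator {r<..<s} (snd z)))"
          unfolding eq lborel_prod by (simp add: algebra_simps)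
        also have "\<dots> = (LINT z|?M. W z * (indicator {p<..<q} (fst z) * indicator {r<..<s} (snd z))) -
          (LINT z|?M. indicator {p<..<q} (fst z) * (w (snd z) * indicator {r<..<s} (snd z)))"
          using i1 i2 by simp
        also have "(LINT z|?M. indicator {p<..<q} (fst z) * (w (snd z) * indicator {r<..<s} (snd z))) =
          (q - p) * (LINT y|lborel. w y * indicator {r<..<s} y)"
          using integral_product_lborel[OF integrable_indicator_Ioo wr, of p q] pq by simp
        also have "(LINT z|?M. W z * (indicator {p<..<q} (fst z) * indicator {r<..<s} (snd z))) = (q - p) * (LINT y|lborel. w y * indicator {r<..<s} y)"
        proof -
          have cancel: "X = k * V" if "e * X = k * Y" "e * V = Y" "e \<noteq> 0" for e k X Y V :: real
          proof -
            have "e * X = e * (k * V)" using that by (simp add: mult.left_commute)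
            then show ?thesis using that(3) by simp
          qed
          show ?thesis by (rule cancel[OF key[OF pq pq0(1-3)] wint[of r s]]) (use pq0(4) in simp)
        qed
        finally show ?thesis by simp
      qed
    qed
    from AE_zero_if_box_integrals_zero[OF fi[unfolded lborel_prod] this]
    show ?thesis unfolding lborel_prod .
  qed
  have "AE z in ?M. \<forall>n. f (1 / real (Suc n)) z = 0"
    by (subst AE_all_countable) (auto intro!: f0)
  then have "AE z in ?M. fst z \<in> {a<..<b} \<and> snd z \<in> {c<..<d} \<longrightarrow> U z = w (snd z) + partial_primitive G z"
  proof eventually_elim
    case (elim z)
    show ?case
    proof
      assume z: "fst z \<in> {a<..<b} \<and> snd z \<in> {c<..<d}"
      define \<epsilon> where "\<epsilon> = Min {fst z - a, b - fst z, snd z - c, d - snd z}"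
      have "\<epsilon> > 0" using z by (simp add: \<epsilon>_def)
      then obtain n where n: "1 / real (Suc n) < \<epsilon>" using nat_approx_posE by blast
      have "1 / real (Suc n) < fst z - a" "1 / real (Suc n) < b - fst z" "1 / real (Suc n) < snd z - c" "1 / real (Suc n) < d - snd z"
        using n by (simp_all add: \<epsilon>_def)
      moreover have "f (1 / real (Suc n)) z = 0" using elim by blast
      ultimately have "W z = w (snd z)" unfolding f_def by (auto simp: indicator_def split: if_splits)
      then show "U z = w (snd z) + partial_primitive G z" by (simp add: W_def)
    qed
  qed
  then show ?thesis using that[of w] by simp
qed

section \<open>The Poincare inequality on rectangles\<close>

text \<open>U - w(y) is the primitive of the slice of G, and Cauchy-Schwarz on an interval of length
  b - a bounds its square by (b - a) times the integral of G^2 over the slice. Integrating over x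
  gives the second factor b - a.\<close>

lemma directional_Poincare:
  fixes U G :: "real \<times> real \<Rightarrow> real"
  assumes U: "integrable (lborel \<Otimes>\<^sub>M lborel) U" and G: "integrable (lborel \<Otimes>\<^sub>M lborel) G"
    and G2: "integrable (lborel \<Otimes>\<^sub>M lborel) (\<lambda>z. (G z)\<^sup>2)"
    and ab: "a < b" and G0: "\<And>z. \<not> (fst z \<in> {a<..<b} \<and> snd z \<in> {c<..<d}) \<Longrightarrow> G z = 0"
    and weak: "weak_x_derivative a b c d U G"
  obtains w where "w \<in> borel_measurable borel"
    "integrable (lborel \<Otimes>\<^sub>M lborel) (\<lambda>z. indicator ({a<..<b} \<times> {c<..<d}) z * (U z - w (snd z))\<^sup>2)"
    "(LINT z|(lborel \<Otimes>\<^sub>M lborel). indicator ({a<..<b} \<times> {c<..<d}) z * (U z - w (snd z))\<^sup>2) \<le>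
     (b - a)\<^sup>2 * (LINT z|(lborel \<Otimes>\<^sub>M lborel). (G z)\<^sup>2)"
proof -
  let ?M = "lborel \<Otimes>\<^sub>M lborel :: (real \<times> real) measure"
  let ?I = "indicator ({a<..<b} \<times> {c<..<d}) :: real \<times> real \<Rightarrow> real"
  have [measurable]: "G \<in> borel_measurable (lborel \<Otimes>\<^sub>M lborel)" "U \<in> borel_measurable (lborel \<Otimes>\<^sub>M lborel)"
    using G U by auto
  obtain w where w [measurable]: "w \<in> borel_measurable borel"
    and rep: "AE z in ?M. fst z \<in> {a<..<b} \<and> snd z \<in> {c<..<d} \<longrightarrow> U z = w (snd z) + partial_primitive G z"
    using weak_derivative_representation[OF U G ab weak] by blast
  have G': "integrable ?M (\<lambda>(x, y). G (x, y))" using G by simp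
  have G2': "integrable ?M (\<lambda>(x, y). (G (x, y))\<^sup>2)" using G2 by (simp add: case_prod_unfold)
  define Q where "Q y = (LINT t|lborel. (G (t, y))\<^sup>2)" for y
  have Q: "integrable lborel Q" unfolding Q_def by (rule lborel_pair.integrable_snd[OF G2'])
  have QG: "(LINT y|lborel. Q y) = (LINT z|?M. (G z)\<^sup>2)"
    unfolding Q_def using lborel_pair.integral_snd[OF G2'] by (simp add: case_prod_unfold)
  have ppQ: "(partial_primitive G (x, y))\<^sup>2 \<le> (b - a) * Q y"
    if i: "integrable lborel (\<lambda>t. G (t, y))" and i2: "integrable lborel (\<lambda>t. (G (t, y))\<^sup>2)" for x y
  proof -
    have "(partial_primitive G (x, y))\<^sup>2 \<le> (LINT t|lborel. \<bar>G (t, y)\<bar>)\<^sup>2"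
      using partial_primitive_bound[of G y x, OF i] abs_le_square_iff by fastforce
    also have "(LINT t|lborel. \<bar>G (t, y)\<bar>) = (LINT t|lborel. indicator {a<..<b} t * \<bar>G (t, y)\<bar>)"
    proof (rule Bochner_Integration.integral_cong)
      fix t show "\<bar>G (t, y)\<bar> = indicator {a<..<b} t * \<bar>G (t, y)\<bar>"
        using G0[of "(t, y)"] by (cases "t \<in> {a<..<b}") auto
    qed simp
    also have "\<dots>\<^sup>2 \<le> (LINT t|lborel. (indicat_real {a<..<b} t)\<^sup>2) * (LINT t|lborel. \<bar>G (t, y)\<bar>\<^sup>2)"
      using i i2 by (intro Cauchy_Schwarz_integral) (auto simp: integrable_indicator_Ioo power2_eq_square
          simp flip: indicator_inter_arith)
    also have "\<dots> = (b - a) * Q y"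
    proof -
      have "(\<lambda>t. (indicat_real {a<..<b} t)\<^sup>2) = indicator {a<..<b}" by (auto simp: indicator_def)
      then show ?thesis using ab by (simp add: Q_def)
    qed
    finally show ?thesis .
  qed
  have J: "integrable lborel (\<lambda>x. (b - a) * indicat_real {a<..<b} x)"
    using integrable_indicator_Ioo by simp
  have i: "integrable ?M (\<lambda>z. ((b - a) * indicator {a<..<b} (fst z)) * Q (snd z))"
    by (rule integrable_product_lborel[OF J Q])
  have "AE y in lborel. integrable lborel (\<lambda>t. G (t, y))" "AE y in lborel. integrable lborel (\<lambda>t. (G (t, y))\<^sup>2)"
    using lborel_pair.AE_integrable_snd[OF G'] lborel_pair.AE_integrable_snd[OF G2'] by auto
  then have aey: "AE y in lborel. \<forall>x. (partial_primitive G (x, y))\<^sup>2 \<le> (b - a) * Q y"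
    by eventually_elim (use ppQ in auto)
  have "AE z in ?M. (partial_primitive G z)\<^sup>2 \<le> (b - a) * Q (snd z)"
  proof (rule lborel_pair.AE_pair_measure)
    have [measurable]: "Q \<in> borel_measurable borel" using Q by auto
    have "Measurable.pred ?M (\<lambda>z. (partial_primitive G z)\<^sup>2 \<le> (b - a) * Q (snd z))" by measurable
    then show "{z \<in> space ?M. (partial_primitive G z)\<^sup>2 \<le> (b - a) * Q (snd z)} \<in> sets ?M"
      by (simp add: pred_def)
    have "AE y in lborel. (partial_primitive G (x, y))\<^sup>2 \<le> (b - a) * Q (snd (x, y))" for x
      using aey by eventually_elim simp
    then show "AE x in lborel. AE y in lborel. (partial_primitive G (x, y))\<^sup>2 \<le> (b - a) * Q (snd (x, y))"
      by simp
  qed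
  with rep have bd: "AE z in ?M. norm (?I z * (U z - w (snd z))\<^sup>2) \<le> ((b - a) * indicator {a<..<b} (fst z)) * Q (snd z)"
  proof eventually_elim
    case (elim z)
    then show ?case by (cases "fst z \<in> {a<..<b} \<and> snd z \<in> {c<..<d}")
      (auto simp: indicator_def Q_def ab less_imp_le mem_Times_iff)
  qed
  have int: "integrable ?M (\<lambda>z. ?I z * (U z - w (snd z))\<^sup>2)"
    by (rule Bochner_Integration.integrable_bound[OF i]) (use bd in \<open>auto elim!: eventually_mono\<close>)
  have "(LINT z|?M. ?I z * (U z - w (snd z))\<^sup>2) \<le> (LINT z|?M. ((b - a) * indicator {a<..<b} (fst z)) * Q (snd z))"
    by (rule integral_mono_AE[OF int i]) (use bd in \<open>auto elim!: eventually_mono\<close>)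
  also have "\<dots> = (b - a)\<^sup>2 * (LINT z|?M. (G z)\<^sup>2)"
    using integral_product_lborel[OF J Q] ab QG by (simp add: power2_eq_square)
  finally show ?thesis using that[OF w int] by blast
qed

text \<open>U is close to some w(y) and to some v(x), so w(y) and v(x) are close to each other in
  the mean. On a slice x0 where this is no worse than average, \<kappa> = v(x0) approximates w,
  hence U. Using (p + q)^2 <= 2 p^2 + 2 q^2 twice gives 2 A + 2 (2 A + 2 B), and so the factor
  6.\<close>

lemma Poincare_product:
  fixes U G1 G2 :: "real \<times> real \<Rightarrow> real"
  defines "M \<equiv> (lborel \<Otimes>\<^sub>M lborel :: (real \<times> real) measure)"
  assumes U: "integrable M U" and G: "integrable M G1" "integrable M G2"
    and sq: "integrable M (\<lambda>z. (G1 z)\<^sup>2)" "integrable M (\<lambda>z. (G2 z)\<^sup>2)"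
    and ab: "a < b" "c < d" 
    and zero: "\<And>z. \<not> (fst z \<in> {a<..<b} \<and> snd z \<in> {c<..<d}) \<Longrightarrow> G1 z = 0 \<and> G2 z = 0"
    and weak1: "weak_x_derivative a b c d U G1"
    and weak2: "weak_x_derivative c d a b (\<lambda>z. U (snd z, fst z)) (\<lambda>z. G2 (snd z, fst z))"
  obtains \<kappa> where
    "(LINT z|M. indicator ({a<..<b} \<times> {c<..<d}) z * (U z - \<kappa>)\<^sup>2) \<le>
     6 * ((b - a)\<^sup>2 * (LINT z|M. (G1 z)\<^sup>2) + (d - c)\<^sup>2 * (LINT z|M. (G2 z)\<^sup>2))"
proof -
  let ?I = "indicator ({a<..<b} \<times> {c<..<d}) :: real \<times> real \<Rightarrow> real"
  let ?A = "(b - a)\<^sup>2 * (LINT z|M. (G1 z)\<^sup>2)" and ?B = "(d - c)\<^sup>2 * (LINT z|M. (G2 z)\<^sup>2)"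
  have [measurable]: "U \<in> borel_measurable (lborel \<Otimes>\<^sub>M lborel)" using U by (auto simp: M_def)
  obtain w where w [measurable]: "w \<in> borel_measurable borel"
    and wi: "integrable M (\<lambda>z. ?I z * (U z - w (snd z))\<^sup>2)"
    and wl: "(LINT z|M. ?I z * (U z - w (snd z))\<^sup>2) \<le> ?A"
    using directional_Poincare[OF U[unfolded M_def] G(1)[unfolded M_def] sq(1)[unfolded M_def] ab(1), where c = c and d = d]
      zero weak1 unfolding M_def by blast
  let ?s = "\<lambda>f :: real \<times> real \<Rightarrow> real. \<lambda>z. f (snd z, fst z)"
  have sw: "integrable M (?s f) \<longleftrightarrow> integrable M f" for f
    using lborel_pair.integrable_product_swap_iff[of f] by (simp add: M_def case_prod_unfold)
  have swl: "(LINT z|M. ?s f z) = (LINT z|M. f z)" if "f \<in> borel_measurable M" for f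
    using lborel_pair.integral_product_swap[of f] that by (simp add: M_def case_prod_unfold)
  obtain v where v [measurable]: "v \<in> borel_measurable borel"
    and vi: "integrable M (\<lambda>z. indicator ({c<..<d} \<times> {a<..<b}) z * (?s U z - v (snd z))\<^sup>2)"
    and vl: "(LINT z|M. indicator ({c<..<d} \<times> {a<..<b}) z * (?s U z - v (snd z))\<^sup>2) \<le> (d - c)\<^sup>2 * (LINT z|M. (?s G2 z)\<^sup>2)"
  proof (rule directional_Poincare[where U = "?s U" and G = "?s G2" and a = c and b = d and c = a and d = b, folded M_def])
    show "integrable M (?s U)" "integrable M (?s G2)" "integrable M (\<lambda>z. (?s G2 z)\<^sup>2)"
      using U G sq sw[of "\<lambda>z. (G2 z)\<^sup>2"] by (auto simp: sw)
    show "?s G2 z = 0" if "\<not> (fst z \<in> {c<..<d} \<and> snd z \<in> {a<..<b})" for z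
      using zero[of "(snd z, fst z)"] that by auto
  qed (use ab weak2 in auto)
  have eqv: "indicator ({c<..<d} \<times> {a<..<b}) z * (?s U z - v (snd z))\<^sup>2 = ?s (\<lambda>z. ?I z * (U z - v (fst z))\<^sup>2) z" for z
    by (auto simp: indicator_def mem_Times_iff)
  have vi': "integrable M (\<lambda>z. ?I z * (U z - v (fst z))\<^sup>2)"
    using vi unfolding eqv by (subst (asm) sw)
  have "(LINT z|M. (?s G2 z)\<^sup>2) = (LINT z|M. (G2 z)\<^sup>2)"
    using swl[of "\<lambda>z. (G2 z)\<^sup>2"] sq(2) by auto
  then have vl': "(LINT z|M. ?I z * (U z - v (fst z))\<^sup>2) \<le> ?B"
    using vl unfolding eqv by (subst (asm) swl) (use vi' in auto)
  let ?f = "\<lambda>z. ?I z * (w (snd z) - v (fst z))\<^sup>2"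
  have le: "?f z \<le> 2 * (?I z * (U z - w (snd z))\<^sup>2) + 2 * (?I z * (U z - v (fst z))\<^sup>2)" for z
  proof -
    have "(p - q)\<^sup>2 \<le> 2 * (u - p)\<^sup>2 + 2 * (u - q)\<^sup>2" for p q u :: real
      using sum_squares_ge_zero[of "(u - p) + (u - q)" 0] by (simp add: power2_eq_square algebra_simps)
    then show ?thesis by (auto simp: indicator_def)
  qed
  have fi: "integrable M ?f"
    by (rule Bochner_Integration.integrable_bound[where f = "\<lambda>z. 2 * (?I z * (U z - w (snd z))\<^sup>2) + 2 * (?I z * (U z - v (fst z))\<^sup>2)"])
      (use wi vi' le in \<open>auto simp: M_def\<close>)
  have "(LINT z|M. ?f z) \<le> (LINT z|M. 2 * (?I z * (U z - w (snd z))\<^sup>2) + 2 * (?I z * (U z - v (fst z))\<^sup>2))"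
    by (rule integral_mono[OF fi]) (use wi vi' le in auto)
  also have "\<dots> \<le> 2 * ?A + 2 * ?B" using wi vi' wl vl' by simp
  finally have fl: "(LINT z|M. ?f z) \<le> 2 * ?A + 2 * ?B" .
  have fi2: "integrable (lborel \<Otimes>\<^sub>M lborel) (\<lambda>(x, y). ?f (x, y))" using fi by (simp add: M_def case_prod_unfold)
  define F where "F x = (LINT y|lborel. ?f (x, y))" for x
  have F: "integrable lborel F" "(LINT x|lborel. F x) = (LINT z|M. ?f z)"
    unfolding F_def using lborel_pair.integrable_fst[OF fi2] lborel_pair.integral_fst[OF fi2] by (auto simp: M_def case_prod_unfold)
  let ?Bd = "2 * ?A + 2 * ?B"
  \<comment> \<open>The slice integral F cannot exceed its average almost everywhere. Integrability
    of the slice is demanded as well, since a slice that is not integrable has F x = 0 by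
    default.\<close>
  obtain x0 where x0: "x0 \<in> {a<..<b}" "F x0 * (b - a) \<le> ?Bd" "integrable lborel (\<lambda>y. ?f (x0, y))"
  proof (rule ccontr)
    assume "\<not> thesis"
    then have neg: "\<And>x. x \<in> {a<..<b} \<Longrightarrow> integrable lborel (\<lambda>y. ?f (x, y)) \<Longrightarrow> F x * (b - a) > ?Bd"
      using that by force
    have ae: "AE x in lborel. x \<in> {a<..<b} \<longrightarrow> F x * (b - a) > ?Bd"
      using lborel_pair.AE_integrable_fst[OF fi2] by eventually_elim (use neg in auto)
    have Feq: "(F x * (b - a) - ?Bd) * indicator {a<..<b} x = (b - a) * F x - ?Bd * indicator {a<..<b} x" for x
    proof (cases "x \<in> {a<..<b}")
      case False
      then have "F x = 0" by (auto simp: F_def)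
      with False show ?thesis by simp
    qed (simp add: mult.commute)
    have iF: "integrable lborel (\<lambda>x. (F x * (b - a) - ?Bd) * indicator {a<..<b} x)"
      unfolding Feq by (intro Bochner_Integration.integrable_diff integrable_mult_right F integrable_indicator_Ioo)
    have "(LINT x|lborel. (F x * (b - a) - ?Bd) * indicator {a<..<b} x) = (LINT x|lborel. (b - a) * F x - ?Bd * indicator {a<..<b} x)"
      unfolding Feq ..
    also have "\<dots> = (LINT x|lborel. (b - a) * F x) - (LINT x|lborel. ?Bd * indicator {a<..<b} x)"
      by (intro Bochner_Integration.integral_diff integrable_mult_right F integrable_indicator_Ioo)
    also have "\<dots> = (b - a) * (LINT z|M. ?f z) - ?Bd * (b - a)" using F ab by simp
    also have "\<dots> \<le> 0" using fl ab by (simp add: mult.commute mult_left_mono)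
    finally have le0: "(LINT x|lborel. (F x * (b - a) - ?Bd) * indicator {a<..<b} x) \<le> 0" .
    have "AE x in lborel. 0 \<le> (F x * (b - a) - ?Bd) * indicator {a<..<b} x"
      using ae by eventually_elim (auto simp: indicator_def)
    moreover from this have "(LINT x|lborel. (F x * (b - a) - ?Bd) * indicator {a<..<b} x) = 0"
      by (rule antisym[OF le0 integral_nonneg_AE])
    ultimately have "AE x in lborel. (F x * (b - a) - ?Bd) * indicator {a<..<b} x = 0"
      using integral_nonneg_eq_0_iff_AE[OF iF] by simp
    with ae have "AE x in lborel. x \<notin> {a<..<b}" by eventually_elim (auto simp: indicator_def)
    then have "{a<..<b} \<in> null_sets lborel" by (subst AE_iff_null_sets) auto
    then show False using ab by (simp add: null_sets_def)
  qed
  define \<kappa> where "\<kappa> = v x0"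
  have k: "?f (x0, y) = indicator {c<..<d} y * (w y - \<kappa>)\<^sup>2" for y
    using x0(1) by (auto simp: indicator_def \<kappa>_def)
  have ki: "integrable M (\<lambda>z. indicator {a<..<b} (fst z) * (indicator {c<..<d} (snd z) * (w (snd z) - \<kappa>)\<^sup>2))"
    unfolding M_def using integrable_product_lborel[OF integrable_indicator_Ioo[of a b] x0(3)[unfolded k]] by simp
  have kl: "(LINT z|M. indicator {a<..<b} (fst z) * (indicator {c<..<d} (snd z) * (w (snd z) - \<kappa>)\<^sup>2)) \<le> ?Bd"
    using integral_product_lborel[OF integrable_indicator_Ioo[of a b] x0(3)[unfolded k], folded M_def]
      x0(2)[unfolded F_def k] ab by (simp add: mult.commute[of _ "b - a"])
  have keq: "indicator {a<..<b} (fst z) * (indicator {c<..<d} (snd z) * (w (snd z) - \<kappa>)\<^sup>2) = ?I z * (w (snd z) - \<kappa>)\<^sup>2" for z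
    by (auto simp: indicator_def mem_Times_iff)
  have le2: "?I z * (U z - \<kappa>)\<^sup>2 \<le> 2 * (?I z * (U z - w (snd z))\<^sup>2) + 2 * (?I z * (w (snd z) - \<kappa>)\<^sup>2)" for z
  proof -
    have "(u - q)\<^sup>2 \<le> 2 * (u - p)\<^sup>2 + 2 * (p - q)\<^sup>2" for p q u :: real
      using sum_squares_ge_zero[of "(u - p) - (p - q)" 0] by (simp add: power2_eq_square algebra_simps)
    then show ?thesis by (auto simp: indicator_def)
  qed
  have "(LINT z|M. ?I z * (U z - \<kappa>)\<^sup>2) \<le> (LINT z|M. 2 * (?I z * (U z - w (snd z))\<^sup>2) + 2 * (?I z * (w (snd z) - \<kappa>)\<^sup>2))"
  proof (rule integral_mono)
    show i: "integrable M (\<lambda>z. 2 * (?I z * (U z - w (snd z))\<^sup>2) + 2 * (?I z * (w (snd z) - \<kappa>)\<^sup>2))"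
      using wi ki unfolding keq by auto
    show "integrable M (\<lambda>z. ?I z * (U z - \<kappa>)\<^sup>2)"
      by (rule Bochner_Integration.integrable_bound[OF i]) (use le2 in \<open>auto simp: M_def\<close>)
  qed (use le2 in auto)
  also have "\<dots> = 2 * (LINT z|M. ?I z * (U z - w (snd z))\<^sup>2) + 2 * (LINT z|M. ?I z * (w (snd z) - \<kappa>)\<^sup>2)"
    using wi ki unfolding keq by auto
  also have "\<dots> \<le> 2 * ?A + 2 * ?Bd" 
    using wl kl unfolding keq by (intro add_mono mult_left_mono) auto
  also have "\<dots> \<le> 6 * (?A + ?B)"
  proof -
    have "2 * A + 2 * (2 * A + 2 * B) \<le> 6 * (A + B)" if "A \<ge> 0" "B \<ge> 0" for A B :: real
      using that by simp
    moreover have "?A \<ge> 0" "?B \<ge> 0" by simp_all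
    ultimately show ?thesis by blast
  qed
  finally show ?thesis using that by blast
qed

section \<open>Rectangles in the plane and the transfer from Borel to Lebesgue measurable
  functions\<close>

definition rect :: "real \<Rightarrow> real \<Rightarrow> real \<Rightarrow> real \<Rightarrow> (real^2) set" where
  "rect a b c d = {x. a < x $ 1 \<and> x $ 1 < b \<and> c < x $ 2 \<and> x $ 2 < d}"

lemma rect_eq_box: "rect a b c d = box (vector [a, c]) (vector [b, d])"
  by (auto simp: rect_def mem_box_cart forall_2)

lemma open_rect: "open (rect a b c d)" and bounded_rect: "bounded (rect a b c d)"
  and convex_rect: "convex (rect a b c d)"
  by (auto simp: rect_eq_box open_box convex_box)

lemma lmeasurable_rect: "rect a b c d \<in> lmeasurable"
  by (simp add: rect_eq_box)

lemma measure_rect: "a \<le> b \<Longrightarrow> c \<le> d \<Longrightarrow> measure lebesgue (rect a b c d) = (b - a) * (d - c)"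
  unfolding rect_eq_box by (subst measure_completion) 
    (auto simp: measure_lborel_box_eq Basis_vec2 inner_axis axis_eq_axis)

lemma indicator_rect_pair_vec: "indicator (rect a b c d) (pair_vec p) = indicator ({a<..<b} \<times> {c<..<d}) p"
  by (auto simp: indicator_def rect_def mem_Times_iff)

lemma
  fixes F :: "real^2 \<Rightarrow> real"
  assumes [measurable]: "F \<in> borel_measurable borel"
  shows integral_rect: "(LINT x|lebesgue_on (rect a b c d). F x) =
      (LINT p|(lborel \<Otimes>\<^sub>M lborel). indicator ({a<..<b} \<times> {c<..<d}) p * F (pair_vec p))"
    and integrable_rect: "integrable (lebesgue_on (rect a b c d)) F \<longleftrightarrow>
      integrable (lborel \<Otimes>\<^sub>M lborel) (\<lambda>p. indicator ({a<..<b} \<times> {c<..<d}) p * F (pair_vec p))"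
proof -
  have [measurable]: "rect a b c d \<in> sets borel" using open_rect by (rule borel_open)
  have m: "(\<lambda>x. indicator (rect a b c d) x * F x) \<in> borel_measurable borel" by measurable
  have "(LINT x|lebesgue_on (rect a b c d). F x) = (LINT x|lebesgue. indicator (rect a b c d) x *\<^sub>R F x)"
    by (subst integral_restrict_space) auto
  also have "\<dots> = (LINT x|lborel. indicator (rect a b c d) x * F x)"
    using m by (subst integral_completion) auto
  also have "\<dots> = (LINT p|(lborel \<Otimes>\<^sub>M lborel). indicator ({a<..<b} \<times> {c<..<d}) p * F (pair_vec p))"
    by (subst integral_pair_vec[OF m]) (simp add: indicator_rect_pair_vec)
  finally show "(LINT x|lebesgue_on (rect a b c d). F x) =
      (LINT p|(lborel \<Otimes>\<^sub>M lborel). indicator ({a<..<b} \<times> {c<..<d}) p * F (pair_vec p))" .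
  have "integrable (lebesgue_on (rect a b c d)) F \<longleftrightarrow> integrable lebesgue (\<lambda>x. indicator (rect a b c d) x *\<^sub>R F x)"
    by (subst integrable_restrict_space) (auto simp: set_integrable_def)
  also have "\<dots> \<longleftrightarrow> integrable lborel (\<lambda>x. indicator (rect a b c d) x * F x)"
    using m by (subst integrable_completion) auto
  also have "\<dots> \<longleftrightarrow> integrable (lborel \<Otimes>\<^sub>M lborel) (\<lambda>p. indicator ({a<..<b} \<times> {c<..<d}) p * F (pair_vec p))"
    by (subst integrable_pair_vec[OF m]) (simp add: indicator_rect_pair_vec)
  finally show "integrable (lebesgue_on (rect a b c d)) F \<longleftrightarrow>
      integrable (lborel \<Otimes>\<^sub>M lborel) (\<lambda>p. indicator ({a<..<b} \<times> {c<..<d}) p * F (pair_vec p))" .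
qed

text \<open>Integrals over rectangles are transported to the product space for Borel functions,
  whereas elements of the Sobolev space are only Lebesgue measurable; they are replaced by Borel
  representatives.\<close>

lemma lebesgue_on_ex_borel:
  fixes f :: "real^2 \<Rightarrow> real"
  assumes "f \<in> borel_measurable (lebesgue_on S)" "S \<in> sets lebesgue"
  obtains f' where "f' \<in> borel_measurable borel" "AE x in lebesgue_on S. f x = f' x"
proof -
  have "(\<lambda>x. indicator S x *\<^sub>R f x) \<in> borel_measurable lebesgue"
    using assms by (subst (asm) borel_measurable_restrict_space_iff) auto
  then have "\<exists>f'\<in>borel_measurable lborel. AE x in lborel. indicator S x *\<^sub>R f x = f' x"
    by (rule completion_ex_borel_measurable_real)
  then obtain f' where f': "f' \<in> borel_measurable lborel" and ae: "AE x in lborel. indicator S x *\<^sub>R f x = f' x"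
    by blast
  from ae have "AE x in lebesgue. indicator S x *\<^sub>R f x = f' x" by (rule AE_completion)
  then have "AE x in lebesgue_on S. f x = f' x"
    using assms(2) by (subst AE_restrict_space_iff) (auto elim!: eventually_mono)
  with f' that show ?thesis by auto
qed

lemma finite_measure_lebesgue_on: "S \<in> lmeasurable \<Longrightarrow> finite_measure (lebesgue_on S)"
  by (auto simp: fmeasurable_def emeasure_restrict_space intro!: finite_measureI)

lemma (in finite_measure) square_integrable_imp_integrable:
  fixes f :: "'a \<Rightarrow> real"
  assumes "f \<in> borel_measurable M" "integrable M (\<lambda>x. (f x)\<^sup>2)"
  shows "integrable M f"
  using square_integrable_mult[OF assms(1) borel_measurable_const[of 1] assms(2)] by simp

lemma square_integrable_on_component:
  fixes g :: "real^2 \<Rightarrow> real^2"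
  assumes "square_integrable_on S g"
  shows "(\<lambda>x. g x $ i) \<in> borel_measurable (lebesgue_on S)" "integrable (lebesgue_on S) (\<lambda>x. (g x $ i)\<^sup>2)"
proof -
  have g [measurable]: "g \<in> borel_measurable (lebesgue_on S)" and i: "integrable (lebesgue_on S) (\<lambda>x. (norm (g x))\<^sup>2)"
    using assms by (auto simp: square_integrable_on_def)
  show m [measurable]: "(\<lambda>x. g x $ i) \<in> borel_measurable (lebesgue_on S)"
    by (rule borel_measurable_continuous_on[OF _ g, of "\<lambda>v. v $ i"]) (intro continuous_intros)
  show "integrable (lebesgue_on S) (\<lambda>x. (g x $ i)\<^sup>2)"
    by (rule Bochner_Integration.integrable_bound[OF i])
      (auto simp: component_le_norm_cart simp flip: abs_le_square_iff)
qed

lemma smooth_derivative: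
  assumes f: "smooth f" and D: "\<And>x. (f has_real_derivative f' x) (at x)"
  shows "smooth f'"
  unfolding smooth_def
proof
  fix k
  have "class_C (Suc k) f" using f by (simp add: smooth_def)
  then obtain h where h: "\<And>x. (f has_real_derivative h x) (at x)" "class_C k h" by auto
  have "h = f'" using h(1) D DERIV_unique by blast
  with h show "class_C k f'" by simp
qed

lemma smooth_imp_derivative:
  assumes "smooth f" obtains f' where "\<And>x. (f has_real_derivative f' x) (at x)"
proof -
  have "class_C (Suc 0) f" using assms unfolding smooth_def by blast
  then show ?thesis using that by auto
qed

lemma norm_power2_vec2: "(norm (v :: real^2))\<^sup>2 = (v $ 1)\<^sup>2 + (v $ 2)\<^sup>2"
  by (simp add: norm_vec_def L2_set_def sum_2)

text \<open>Borel representatives of u and of the components of g are extended by zero to the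
  product space. This keeps the weak identity, because the test functions live inside the rectangle;
  the second coordinate is treated after a swap.\<close>

lemma Poincare_rect:
  assumes H: "has_H1_gradient (rect a b c d) u g" and ab: "a < b" "c < d"
  obtains \<kappa> where "(LINT x|lebesgue_on (rect a b c d). (u x - \<kappa>)\<^sup>2) \<le>
    6 * ((b - a)\<^sup>2 + (d - c)\<^sup>2) * (LINT x|lebesgue_on (rect a b c d). (norm (g x))\<^sup>2)"
proof -
  let ?R = "rect a b c d" and ?M = "lborel \<Otimes>\<^sub>M lborel :: (real \<times> real) measure"
  let ?I = "indicator ({a<..<b} \<times> {c<..<d}) :: real \<times> real \<Rightarrow> real"
  have RS: "?R \<in> sets lebesgue" using lmeasurable_rect by (rule fmeasurableD)
  interpret finite_measure "lebesgue_on ?R" by (rule finite_measure_lebesgue_on[OF lmeasurable_rect])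
  have um: "u \<in> borel_measurable (lebesgue_on ?R)" "integrable (lebesgue_on ?R) (\<lambda>x. (u x)\<^sup>2)"
    and gs: "square_integrable_on ?R g"
    and weak: "\<And>\<phi> i. test_function ?R \<phi> \<Longrightarrow> (LINT x|lebesgue_on ?R. u x * partial_deriv i \<phi> x) =
        - (LINT x|lebesgue_on ?R. g x $ i * \<phi> x)"
    using H by (auto simp: has_H1_gradient_def square_integrable_on_def)
  note gm = square_integrable_on_component[OF gs]
  have gi: "integrable (lebesgue_on ?R) (\<lambda>x. g x $ i)" for i
    by (rule square_integrable_imp_integrable[OF gm])
  have ui: "integrable (lebesgue_on ?R) u"
    by (rule square_integrable_imp_integrable[OF um])
  obtain u' where u' [measurable]: "u' \<in> borel_measurable borel" and uae: "AE x in lebesgue_on ?R. u x = u' x"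
    using lebesgue_on_ex_borel[OF um(1) RS] .
  obtain g1 where g1 [measurable]: "g1 \<in> borel_measurable borel" and g1ae: "AE x in lebesgue_on ?R. g x $ 1 = g1 x"
    using lebesgue_on_ex_borel[OF gm(1)[of 1] RS] .
  obtain g2 where g2 [measurable]: "g2 \<in> borel_measurable borel" and g2ae: "AE x in lebesgue_on ?R. g x $ 2 = g2 x"
    using lebesgue_on_ex_borel[OF gm(1)[of 2] RS] .
  have bm: "f \<in> borel_measurable (lebesgue_on ?R)" if "f \<in> borel_measurable borel" for f :: "real^2 \<Rightarrow> real"
    using that by (intro measurable_restrict_space1 measurable_completion) auto
  note bms = bm[OF u'] bm[OF g1] bm[OF g2]
  define U where "U p = ?I p * u' (pair_vec p)" for p
  define G1 where "G1 p = ?I p * g1 (pair_vec p)" for p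
  define G2 where "G2 p = ?I p * g2 (pair_vec p)" for p
  have I2: "(?I p * y)\<^sup>2 = ?I p * y\<^sup>2" for p y by (auto simp: indicator_def)
  have U: "integrable ?M U" unfolding U_def integrable_rect[OF u', symmetric]
    using integrable_cong_AE[THEN iffD1, OF um(1) bms(1) uae ui] .
  have G: "integrable ?M G1" "integrable ?M G2"
    unfolding G1_def G2_def integrable_rect[OF g1, symmetric] integrable_rect[OF g2, symmetric]
    using integrable_cong_AE[THEN iffD1, OF gm(1) bms(2) g1ae gi] integrable_cong_AE[THEN iffD1, OF gm(1) bms(3) g2ae gi] by auto
  have g1sq: "integrable (lebesgue_on ?R) (\<lambda>x. (g1 x)\<^sup>2)" "(LINT x|lebesgue_on ?R. (g1 x)\<^sup>2) = (LINT x|lebesgue_on ?R. (g x $ 1)\<^sup>2)"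
  proof -
    have ae: "AE x in lebesgue_on ?R. (g x $ 1)\<^sup>2 = (g1 x)\<^sup>2" using g1ae by eventually_elim simp
    have m: "(\<lambda>x. (g x $ 1)\<^sup>2) \<in> borel_measurable (lebesgue_on ?R)" "(\<lambda>x. (g1 x)\<^sup>2) \<in> borel_measurable (lebesgue_on ?R)"
      using gm(1)[of 1] bms(2) by (auto intro: borel_measurable_power)
    show "integrable (lebesgue_on ?R) (\<lambda>x. (g1 x)\<^sup>2)" using integrable_cong_AE[THEN iffD1, OF m ae gm(2)] .
    show "(LINT x|lebesgue_on ?R. (g1 x)\<^sup>2) = (LINT x|lebesgue_on ?R. (g x $ 1)\<^sup>2)"
      using integral_cong_AE[OF m ae] by simp
  qed
  have g2sq: "integrable (lebesgue_on ?R) (\<lambda>x. (g2 x)\<^sup>2)" "(LINT x|lebesgue_on ?R. (g2 x)\<^sup>2) = (LINT x|lebesgue_on ?R. (g x $ 2)\<^sup>2)"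
  proof -
    have ae: "AE x in lebesgue_on ?R. (g x $ 2)\<^sup>2 = (g2 x)\<^sup>2" using g2ae by eventually_elim simp
    have m: "(\<lambda>x. (g x $ 2)\<^sup>2) \<in> borel_measurable (lebesgue_on ?R)" "(\<lambda>x. (g2 x)\<^sup>2) \<in> borel_measurable (lebesgue_on ?R)"
      using gm(1)[of 2] bms(3) by (auto intro: borel_measurable_power)
    show "integrable (lebesgue_on ?R) (\<lambda>x. (g2 x)\<^sup>2)" using integrable_cong_AE[THEN iffD1, OF m ae gm(2)] .
    show "(LINT x|lebesgue_on ?R. (g2 x)\<^sup>2) = (LINT x|lebesgue_on ?R. (g x $ 2)\<^sup>2)"
      using integral_cong_AE[OF m ae] by simp
  qed
  have sq: "integrable ?M (\<lambda>z. (G1 z)\<^sup>2)" "integrable ?M (\<lambda>z. (G2 z)\<^sup>2)"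
    "(LINT z|?M. (G1 z)\<^sup>2) = (LINT x|lebesgue_on ?R. (g x $ 1)\<^sup>2)"
    "(LINT z|?M. (G2 z)\<^sup>2) = (LINT x|lebesgue_on ?R. (g x $ 2)\<^sup>2)"
    using g1sq g2sq unfolding G1_def G2_def I2 by (simp_all add: integrable_rect integral_rect)
  have tensor: "(LINT z|?M. U z * (A (fst z) * B (snd z))) = (LINT x|lebesgue_on ?R. u x * (A (x $ 1) * B (x $ 2)))"
    "(LINT z|?M. G1 z * (A (fst z) * B (snd z))) = (LINT x|lebesgue_on ?R. g x $ 1 * (A (x $ 1) * B (x $ 2)))"
    "(LINT z|?M. G2 z * (A (fst z) * B (snd z))) = (LINT x|lebesgue_on ?R. g x $ 2 * (A (x $ 1) * B (x $ 2)))"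
    if AB: "continuous_on UNIV A" "continuous_on UNIV B" for A B :: "real \<Rightarrow> real"
  proof -
    have AB' [measurable]: "(\<lambda>x::real^2. A (x $ 1) * B (x $ 2)) \<in> borel_measurable borel"
      by (intro borel_measurable_continuous_onI continuous_intros continuous_on_compose2[OF AB(1)] continuous_on_compose2[OF AB(2)]) auto
    have *: "(LINT z|?M. ?I z * f' (pair_vec z) * (A (fst z) * B (snd z))) = (LINT x|lebesgue_on ?R. f x * (A (x $ 1) * B (x $ 2)))"
      if f [measurable]: "f' \<in> borel_measurable borel" "f \<in> borel_measurable (lebesgue_on ?R)" and ae: "AE x in lebesgue_on ?R. f x = f' x"
      for f f' :: "real^2 \<Rightarrow> real"
    proof -
      have m: "(\<lambda>x. f' x * (A (x $ 1) * B (x $ 2))) \<in> borel_measurable borel" by measurable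
      note [measurable] = bm[OF AB'] bm[OF f(1)]
      have "(LINT x|lebesgue_on ?R. f x * (A (x $ 1) * B (x $ 2))) = (LINT x|lebesgue_on ?R. f' x * (A (x $ 1) * B (x $ 2)))"
        by (rule integral_cong_AE) (use ae in \<open>auto elim!: eventually_mono\<close>)
      also have "\<dots> = (LINT z|?M. ?I z * f' (pair_vec z) * (A (fst z) * B (snd z)))"
        using integral_rect[OF m] by (simp add: mult.assoc)
      finally show ?thesis by simp
    qed
    show "(LINT z|?M. U z * (A (fst z) * B (snd z))) = (LINT x|lebesgue_on ?R. u x * (A (x $ 1) * B (x $ 2)))"
      "(LINT z|?M. G1 z * (A (fst z) * B (snd z))) = (LINT x|lebesgue_on ?R. g x $ 1 * (A (x $ 1) * B (x $ 2)))"
      "(LINT z|?M. G2 z * (A (fst z) * B (snd z))) = (LINT x|lebesgue_on ?R. g x $ 2 * (A (x $ 1) * B (x $ 2)))"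
      unfolding U_def G1_def G2_def by (rule *; fact)+
  qed
  have test: "test_function ?R (\<lambda>x. \<alpha> (x $ 1) * \<beta> (x $ 2))"
    if "a < p" "q < b" "c < r" "s < d" "smooth \<alpha>" "smooth \<beta>"
      "\<forall>x. x \<notin> {p..q} \<longrightarrow> \<alpha> x = 0" "\<forall>x. x \<notin> {r..s} \<longrightarrow> \<beta> x = 0" for \<alpha> \<beta> p q r s
    by (rule test_function_tensor[where a = p and b = q and c = r and d = s]) (use that in \<open>auto simp: rect_def\<close>)
  have weak1: "weak_x_derivative a b c d U G1"
    unfolding weak_x_derivative_def
  proof (intro allI impI, elim conjE)
    fix \<alpha> \<alpha>' \<beta> p q r s
    assume h: "a < p" "q < b" "c < r" "s < d" "smooth \<alpha>" "smooth \<beta>"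
      "\<forall>x. x \<notin> {p..q} \<longrightarrow> \<alpha> x = 0" "\<forall>x. x \<notin> {r..s} \<longrightarrow> \<beta> x = 0"
      and D: "\<forall>x. (\<alpha> has_real_derivative \<alpha>' x) (at x)"
    obtain \<beta>' where D2: "\<forall>x. (\<beta> has_real_derivative \<beta>' x) (at x)"
      using smooth_imp_derivative[OF h(6)] by blast
    have c: "continuous_on UNIV \<alpha>" "continuous_on UNIV \<beta>" "continuous_on UNIV \<alpha>'"
      using smooth_continuous h smooth_derivative[of \<alpha> \<alpha>'] D by auto
    show "(LINT z|?M. U z * (\<alpha>' (fst z) * \<beta> (snd z))) = - (LINT z|?M. G1 z * (\<alpha> (fst z) * \<beta> (snd z)))"
      using weak[OF test[OF h], of 1] partial_deriv_tensor(1)[of \<alpha> \<alpha>' \<beta> \<beta>'] D D2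
      by (simp add: tensor c)
  qed
  have swl: "(LINT z|?M. f (snd z, fst z)) = (LINT z|?M. f z)" if "f \<in> borel_measurable ?M" for f :: "real \<times> real \<Rightarrow> real"
    using lborel_pair.integral_product_swap[of f] that by (simp add: case_prod_unfold)
  have [measurable]: "U \<in> borel_measurable ?M" "G2 \<in> borel_measurable ?M" using U G by auto
  have weak2: "weak_x_derivative c d a b (\<lambda>z. U (snd z, fst z)) (\<lambda>z. G2 (snd z, fst z))"
    unfolding weak_x_derivative_def
  proof (intro allI impI, elim conjE)
    fix \<alpha> \<alpha>' \<beta> p q r s
    assume h: "c < p" "q < d" "a < r" "s < b" "smooth \<alpha>" "smooth \<beta>"
      "\<forall>x. x \<notin> {p..q} \<longrightarrow> \<alpha> x = 0" "\<forall>x. x \<notin> {r..s} \<longrightarrow> \<beta> x = 0"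
      and D: "\<forall>x. (\<alpha> has_real_derivative \<alpha>' x) (at x)"
    obtain \<beta>' where D2: "\<forall>x. (\<beta> has_real_derivative \<beta>' x) (at x)"
      using smooth_imp_derivative[OF h(6)] by blast
    have c: "continuous_on UNIV \<alpha>" "continuous_on UNIV \<beta>" "continuous_on UNIV \<alpha>'"
      using smooth_continuous h smooth_derivative[of \<alpha> \<alpha>'] D by auto
    note [measurable] = c[THEN borel_measurable_continuous_onI]
    have "(LINT z|?M. U (snd z, fst z) * (\<alpha>' (fst z) * \<beta> (snd z))) = (LINT z|?M. U z * (\<beta> (fst z) * \<alpha>' (snd z)))"
      using swl[of "\<lambda>z. U z * (\<beta> (fst z) * \<alpha>' (snd z))"] by (simp add: mult.commute)
    moreover have "(LINT z|?M. G2 (snd z, fst z) * (\<alpha> (fst z) * \<beta> (snd z))) = (LINT z|?M. G2 z * (\<beta> (fst z) * \<alpha> (snd z)))"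
      using swl[of "\<lambda>z. G2 z * (\<beta> (fst z) * \<alpha> (snd z))"] by (simp add: mult.commute)
    ultimately show "(LINT z|?M. U (snd z, fst z) * (\<alpha>' (fst z) * \<beta> (snd z))) =
        - (LINT z|?M. G2 (snd z, fst z) * (\<alpha> (fst z) * \<beta> (snd z)))"
      using weak[OF test[of r s p q \<beta> \<alpha>], of 2] partial_deriv_tensor(2)[of \<beta> \<beta>' \<alpha> \<alpha>'] D D2 h
      by (simp add: tensor c)
  qed
  obtain \<kappa> where \<kappa>: "(LINT z|?M. ?I z * (U z - \<kappa>)\<^sup>2) \<le>
     6 * ((b - a)\<^sup>2 * (LINT z|?M. (G1 z)\<^sup>2) + (d - c)\<^sup>2 * (LINT z|?M. (G2 z)\<^sup>2))"
  proof (rule Poincare_product[OF U G sq(1,2) ab _ weak1 weak2])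
    show "G1 z = 0 \<and> G2 z = 0" if "\<not> (fst z \<in> {a<..<b} \<and> snd z \<in> {c<..<d})" for z
      using that by (auto simp: G1_def G2_def indicator_def mem_Times_iff)
  qed
  have "(LINT z|?M. ?I z * (U z - \<kappa>)\<^sup>2) = (LINT z|?M. ?I z * (u' (pair_vec z) - \<kappa>)\<^sup>2)"
    by (rule Bochner_Integration.integral_cong) (auto simp: U_def indicator_def)
  also have "\<dots> = (LINT x|lebesgue_on ?R. (u' x - \<kappa>)\<^sup>2)"
    by (subst integral_rect) auto
  also have "\<dots> = (LINT x|lebesgue_on ?R. (u x - \<kappa>)\<^sup>2)"
    by (rule integral_cong_AE) (use bms um(1) uae in \<open>auto elim!: eventually_mono\<close>)
  finally have "(LINT x|lebesgue_on ?R. (u x - \<kappa>)\<^sup>2) \<le>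
     6 * ((b - a)\<^sup>2 * (LINT x|lebesgue_on ?R. (g x $ 1)\<^sup>2) + (d - c)\<^sup>2 * (LINT x|lebesgue_on ?R. (g x $ 2)\<^sup>2))"
    using \<kappa> by (simp add: sq)
  also have "\<dots> \<le> 6 * ((b - a)\<^sup>2 + (d - c)\<^sup>2) * ((LINT x|lebesgue_on ?R. (g x $ 1)\<^sup>2) + (LINT x|lebesgue_on ?R. (g x $ 2)\<^sup>2))"
  proof -
    have "6 * (p * A + q * B) \<le> 6 * (p + q) * (A + B)" if "p \<ge> 0" "q \<ge> 0" "A \<ge> 0" "B \<ge> 0" for p q A B :: real
      using that by (simp add: algebra_simps)
    then show ?thesis by simp
  qed
  also have "(LINT x|lebesgue_on ?R. (g x $ 1)\<^sup>2) + (LINT x|lebesgue_on ?R. (g x $ 2)\<^sup>2) = (LINT x|lebesgue_on ?R. (norm (g x))\<^sup>2)"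
    using gm(2) by (simp add: norm_power2_vec2)
  finally show ?thesis using that by blast
qed

section \<open>The Sobolev space\<close>

lemma
  fixes f :: "'a::euclidean_space \<Rightarrow> real"
  assumes f: "integrable (lebesgue_on S) f" and S: "S \<in> sets lebesgue" and R: "R \<in> sets lebesgue" "R \<subseteq> S"
  shows integrable_lebesgue_on_subset: "integrable (lebesgue_on R) f"
    and integral_lebesgue_on_mono: "(\<And>x. 0 \<le> f x) \<Longrightarrow> (LINT x|lebesgue_on R. f x) \<le> (LINT x|lebesgue_on S. f x)"
proof -
  have f': "integrable lebesgue (\<lambda>x. indicator S x *\<^sub>R f x)"
    using f S by (subst (asm) integrable_restrict_space) (auto simp: set_integrable_def)
  have "integrable lebesgue (\<lambda>x. indicator R x *\<^sub>R (indicator S x *\<^sub>R f x))"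
    by (rule integrable_mult_indicator[OF R(1) f'])
  moreover have "(\<lambda>x. indicator R x *\<^sub>R (indicator S x *\<^sub>R f x)) = (\<lambda>x. indicator R x *\<^sub>R f x)"
    using R(2) by (auto simp: indicator_def fun_eq_iff)
  ultimately have fR: "integrable lebesgue (\<lambda>x. indicator R x *\<^sub>R f x)" by (simp only:)
  then show "integrable (lebesgue_on R) f"
    using R by (subst integrable_restrict_space) (auto simp: set_integrable_def)
  assume nn: "\<And>x. 0 \<le> f x"
  have "(LINT x|lebesgue_on R. f x) = (LINT x|lebesgue. indicator R x *\<^sub>R f x)"
    using R by (subst integral_restrict_space) auto
  also have "\<dots> \<le> (LINT x|lebesgue. indicator S x *\<^sub>R f x)"
    by (rule integral_mono[OF fR f']) (use R(2) nn in \<open>auto simp: indicator_def\<close>)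
  also have "\<dots> = (LINT x|lebesgue_on S. f x)"
    using S by (subst integral_restrict_space) auto
  finally show "(LINT x|lebesgue_on R. f x) \<le> (LINT x|lebesgue_on S. f x)" .
qed

text \<open>The null set N takes up the cutting line that is lost when an open rectangle is
  bisected.\<close>

lemma integral_lebesgue_on_cover:
  fixes f :: "'a::euclidean_space \<Rightarrow> real"
  assumes f: "integrable (lebesgue_on S) f" and S: "S \<in> sets lebesgue"
    and A: "A \<in> sets lebesgue" "A \<subseteq> S" and B: "B \<in> sets lebesgue" "B \<subseteq> S"
    and N: "negligible N" "S \<subseteq> A \<union> B \<union> N" and nn: "\<And>x. 0 \<le> f x"
  shows "(LINT x|lebesgue_on S. f x) \<le> (LINT x|lebesgue_on A. f x) + (LINT x|lebesgue_on B. f x)"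
proof -
  have i: "integrable lebesgue (\<lambda>x. indicator T x *\<^sub>R f x)" if "T \<in> sets lebesgue" "T \<subseteq> S" for T
    using integrable_lebesgue_on_subset[OF f S that] that
    by (subst (asm) integrable_restrict_space) (auto simp: set_integrable_def)
  have eq: "(LINT x|lebesgue_on T. f x) = (LINT x|lebesgue. indicator T x *\<^sub>R f x)" if "T \<in> sets lebesgue" for T
    using that by (subst integral_restrict_space) auto
  have ae: "AE x in lebesgue. x \<notin> N"
    using N(1) by (simp add: negligible_iff_null_sets AE_not_in)
  have "(LINT x|lebesgue. indicator S x *\<^sub>R f x) \<le> (LINT x|lebesgue. indicator A x *\<^sub>R f x + indicator B x *\<^sub>R f x)"
  proof (rule integral_mono_AE)
    show "AE x in lebesgue. indicat_real S x *\<^sub>R f x \<le> indicat_real A x *\<^sub>R f x + indicat_real B x *\<^sub>R f x"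
      using ae by eventually_elim (use N(2) nn in \<open>auto simp: indicator_def\<close>)
  qed (use i A B S in auto)
  then show ?thesis using i A B S by (simp add: eq)
qed

lemma integral_lebesgue_on_disjoint:
  fixes f :: "'a::euclidean_space \<Rightarrow> real"
  assumes f: "integrable (lebesgue_on S) f" and S: "S \<in> sets lebesgue"
    and A: "A \<in> sets lebesgue" "A \<subseteq> S" and B: "B \<in> sets lebesgue" "B \<subseteq> S"
    and AB: "A \<inter> B = {}" and nn: "\<And>x. 0 \<le> f x"
  shows "(LINT x|lebesgue_on A. f x) + (LINT x|lebesgue_on B. f x) \<le> (LINT x|lebesgue_on S. f x)"
proof -
  have i: "integrable lebesgue (\<lambda>x. indicator T x *\<^sub>R f x)" if "T \<in> sets lebesgue" "T \<subseteq> S" for T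
    using integrable_lebesgue_on_subset[OF f S that] that
    by (subst (asm) integrable_restrict_space) (auto simp: set_integrable_def)
  have eq: "(LINT x|lebesgue_on T. f x) = (LINT x|lebesgue. indicator T x *\<^sub>R f x)" if "T \<in> sets lebesgue" for T
    using that by (subst integral_restrict_space) auto
  have "(LINT x|lebesgue. indicator A x *\<^sub>R f x + indicator B x *\<^sub>R f x) \<le> (LINT x|lebesgue. indicator S x *\<^sub>R f x)"
    by (rule integral_mono) (use i A B S AB nn in \<open>auto simp: indicator_def\<close>)
  then show ?thesis using i A B S by (simp add: eq)
qed

section \<open>Test functions and the Hilbert space structure\<close>

lemma test_function_outside:
  assumes "test_function R \<phi>" "x \<notin> R"
  shows "\<phi> x = 0" "partial_deriv i \<phi> x = 0"
proof -
  let ?S = "closure (support_on UNIV \<phi>)"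
  have x: "x \<notin> ?S" using assms by (auto simp: test_function_def)
  then show "\<phi> x = 0" using closure_subset[of "support_on UNIV \<phi>"] by (auto simp: support_on_def)
  have "((\<lambda>x. 0) has_derivative (\<lambda>h. 0)) (at x)" by simp
  then have "(\<phi> has_derivative (\<lambda>h. 0)) (at x)"
  proof (rule has_derivative_transform_within_open[where s = "- ?S"])
    show "0 = \<phi> y" if "y \<in> - ?S" for y
      using that closure_subset[of "support_on UNIV \<phi>"] by (auto simp: support_on_def)
  qed (use x in auto)
  then show "partial_deriv i \<phi> x = 0" using partial_deriv_eqI by fastforce
qed

lemma test_function_mono: "test_function R \<phi> \<Longrightarrow> R \<subseteq> S \<Longrightarrow> test_function S \<phi>"
  by (auto simp: test_function_def)

lemma test_function_continuous:
  assumes "test_function R \<phi>"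
  shows "continuous_on UNIV \<phi>" "continuous_on UNIV (partial_deriv i \<phi>)"
proof -
  have "continuously_differentiable (Suc 0) \<phi>" using assms unfolding test_function_def by blast
  then show "continuous_on UNIV \<phi>" "continuous_on UNIV (partial_deriv i \<phi>)"
    using continuously_differentiable_continuous[of "Suc 0" \<phi>] by auto
qed

lemma test_function_bounded:
  assumes "test_function R \<phi>"
  obtains B where "\<And>x. \<bar>\<phi> x\<bar> \<le> B" "\<And>x. \<bar>partial_deriv i \<phi> x\<bar> \<le> B"
proof -
  let ?S = "closure (support_on UNIV \<phi>)"
  have T: "test_function ?S \<phi>" using assms by (auto simp: test_function_def)
  have S: "compact ?S" using assms by (auto simp: test_function_def)
  have *: "\<exists>B. \<forall>x. \<bar>f x\<bar> \<le> B" if "continuous_on UNIV f" "\<And>x. x \<notin> ?S \<Longrightarrow> f x = 0" for f :: "real^2 \<Rightarrow> real"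
  proof -
    have "bounded (f ` ?S)"
      by (rule compact_imp_bounded[OF compact_continuous_image[OF _ S]]) (use that in \<open>auto intro: continuous_on_subset\<close>)
    then obtain B where "\<forall>y \<in> f ` ?S. \<bar>y\<bar> \<le> B" unfolding bounded_real by blast
    then have "\<bar>f x\<bar> \<le> max B 0" for x using that(2)[of x] by (cases "x \<in> ?S") auto
    then show ?thesis by blast
  qed
  obtain B1 where "\<And>x. \<bar>\<phi> x\<bar> \<le> B1"
    using *[OF test_function_continuous(1)[OF T] test_function_outside(1)[OF T]] by blast
  moreover obtain B2 where "\<And>x. \<bar>partial_deriv i \<phi> x\<bar> \<le> B2"
    using *[OF test_function_continuous(2)[OF T] test_function_outside(2)[OF T]] by blast
  ultimately show ?thesis using that[of "max B1 B2"] by (meson le_max_iff_disj)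
qed

lemma square_integrable_onI_bounded:
  fixes f :: "real^2 \<Rightarrow> 'b::euclidean_space"
  assumes S: "S \<in> lmeasurable" and f: "f \<in> borel_measurable (lebesgue_on S)" and B: "\<And>x. x \<in> S \<Longrightarrow> norm (f x) \<le> B"
  shows "square_integrable_on S f"
proof -
  interpret finite_measure "lebesgue_on S" by (rule finite_measure_lebesgue_on[OF S])
  have "integrable (lebesgue_on S) (\<lambda>x. (norm (f x))\<^sup>2)"
  proof (rule integrable_const_bound[where B = "B\<^sup>2"])
    show "AE x in lebesgue_on S. norm ((norm (f x))\<^sup>2) \<le> B\<^sup>2"
      by (rule AE_I2) (use B in \<open>auto simp: power_mono space_restrict_space\<close>)
  qed (use f in auto)
  with f show ?thesis by (simp add: square_integrable_on_def)
qed

lemma continuous_lebesgue_measurable: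
  fixes f :: "real^2 \<Rightarrow> 'b::euclidean_space"
  assumes "continuous_on UNIV f" shows "f \<in> borel_measurable (lebesgue_on S)"
  using borel_measurable_continuous_onI[OF assms]
  by (intro measurable_restrict_space1 measurable_completion) auto

lemma test_function_square_integrable:
  assumes "test_function R \<phi>" "S \<in> lmeasurable"
  shows "square_integrable_on S \<phi>" "square_integrable_on S (partial_deriv i \<phi>)"
proof -
  obtain B where B: "\<And>x. \<bar>\<phi> x\<bar> \<le> B" "\<And>x. \<bar>partial_deriv i \<phi> x\<bar> \<le> B"
    using test_function_bounded[OF assms(1)] by blast
  show "square_integrable_on S \<phi>" "square_integrable_on S (partial_deriv i \<phi>)"
    using B test_function_continuous[OF assms(1)]
    by (auto intro!: square_integrable_onI_bounded[OF assms(2), where B = B] continuous_lebesgue_measurable)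
qed

lemma square_integrable_on_inner:
  fixes f g :: "real^2 \<Rightarrow> 'b::euclidean_space"
  assumes "square_integrable_on S f" "square_integrable_on S g"
  shows "integrable (lebesgue_on S) (\<lambda>x. f x \<bullet> g x)"
    and square_integrable_on_Cauchy_Schwarz: "(LINT x|lebesgue_on S. f x \<bullet> g x)\<^sup>2 \<le>
      (LINT x|lebesgue_on S. (norm (f x))\<^sup>2) * (LINT x|lebesgue_on S. (norm (g x))\<^sup>2)"
proof -
  have [measurable]: "f \<in> borel_measurable (lebesgue_on S)" "g \<in> borel_measurable (lebesgue_on S)"
    and i: "integrable (lebesgue_on S) (\<lambda>x. (norm (f x))\<^sup>2)" "integrable (lebesgue_on S) (\<lambda>x. (norm (g x))\<^sup>2)"
    using assms by (auto simp: square_integrable_on_def)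
  have n: "integrable (lebesgue_on S) (\<lambda>x. norm (f x) * norm (g x))"
    by (rule square_integrable_mult) (use i in auto)
  show fg: "integrable (lebesgue_on S) (\<lambda>x. f x \<bullet> g x)"
    by (rule Bochner_Integration.integrable_bound[OF n]) (auto simp: Cauchy_Schwarz_ineq2)
  have "\<bar>LINT x|lebesgue_on S. f x \<bullet> g x\<bar> \<le> (LINT x|lebesgue_on S. norm (f x) * norm (g x))"
  proof -
    have "norm (LINT x|lebesgue_on S. f x \<bullet> g x) \<le> (LINT x|lebesgue_on S. norm (f x \<bullet> g x))"
      by (rule integral_norm_bound)
    also have "\<dots> \<le> (LINT x|lebesgue_on S. norm (f x) * norm (g x))"
      by (rule integral_mono[OF integrable_norm[OF fg] n]) (simp add: Cauchy_Schwarz_ineq2)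
    finally show ?thesis by simp
  qed
  from power_mono[OF this abs_ge_zero, of 2]
  have "(LINT x|lebesgue_on S. f x \<bullet> g x)\<^sup>2 \<le> (LINT x|lebesgue_on S. norm (f x) * norm (g x))\<^sup>2"
    unfolding power2_abs .
  also have "\<dots> \<le> (LINT x|lebesgue_on S. (norm (f x))\<^sup>2) * (LINT x|lebesgue_on S. (norm (g x))\<^sup>2)"
    by (rule Cauchy_Schwarz_integral) (use i in auto)
  finally show "(LINT x|lebesgue_on S. f x \<bullet> g x)\<^sup>2 \<le>
      (LINT x|lebesgue_on S. (norm (f x))\<^sup>2) * (LINT x|lebesgue_on S. (norm (g x))\<^sup>2)" .
qed

lemma norm_lincomb_power2:
  fixes u v :: "'b::real_inner"
  shows "(norm (a *\<^sub>R u + b *\<^sub>R v))\<^sup>2 = a\<^sup>2 * (norm u)\<^sup>2 + 2 * a * b * (u \<bullet> v) + b\<^sup>2 * (norm v)\<^sup>2"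
  unfolding power2_norm_eq_inner
  by (simp add: inner_add_left inner_add_right inner_commute power2_eq_square algebra_simps)

lemma square_integrable_on_lincomb:
  fixes f g :: "real^2 \<Rightarrow> 'b::euclidean_space"
  assumes "square_integrable_on S f" "square_integrable_on S g"
  shows "square_integrable_on S (\<lambda>x. a *\<^sub>R f x + b *\<^sub>R g x)"
proof -
  have [measurable]: "f \<in> borel_measurable (lebesgue_on S)" "g \<in> borel_measurable (lebesgue_on S)"
    and i: "integrable (lebesgue_on S) (\<lambda>x. (norm (f x))\<^sup>2)" "integrable (lebesgue_on S) (\<lambda>x. (norm (g x))\<^sup>2)"
    using assms by (auto simp: square_integrable_on_def)
  show ?thesis
    unfolding square_integrable_on_def norm_lincomb_power2
    using square_integrable_on_inner(1)[OF assms] i by auto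
qed

lemma integral_norm_lincomb:
  fixes f g :: "real^2 \<Rightarrow> 'b::euclidean_space"
  assumes "square_integrable_on S f" "square_integrable_on S g"
  shows "(LINT x|lebesgue_on S. (norm (a *\<^sub>R f x + b *\<^sub>R g x))\<^sup>2) =
    a\<^sup>2 * (LINT x|lebesgue_on S. (norm (f x))\<^sup>2) + 2 * a * b * (LINT x|lebesgue_on S. f x \<bullet> g x) +
    b\<^sup>2 * (LINT x|lebesgue_on S. (norm (g x))\<^sup>2)"
proof -
  have i: "integrable (lebesgue_on S) (\<lambda>x. (norm (f x))\<^sup>2)" "integrable (lebesgue_on S) (\<lambda>x. (norm (g x))\<^sup>2)"
    using assms by (auto simp: square_integrable_on_def)
  show ?thesis unfolding norm_lincomb_power2 using square_integrable_on_inner(1)[OF assms] i by simp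
qed

lemma square_integrable_on_subset:
  assumes "square_integrable_on S f" "S \<in> sets lebesgue" "R \<in> sets lebesgue" "R \<subseteq> S"
  shows "square_integrable_on R f"
proof -
  have "(\<lambda>x. indicator S x *\<^sub>R f x) \<in> borel_measurable lebesgue"
    using assms by (subst (asm) square_integrable_on_def, subst (asm) borel_measurable_restrict_space_iff) auto
  then have "(\<lambda>x. indicator R x *\<^sub>R (indicator S x *\<^sub>R f x)) \<in> borel_measurable lebesgue"
    by (rule borel_measurable_scaleR[rotated]) (use assms(3) in simp)
  moreover have "(\<lambda>x. indicator R x *\<^sub>R (indicator S x *\<^sub>R f x)) = (\<lambda>x. indicator R x *\<^sub>R f x)"
    using assms(4) by (auto simp: indicator_def fun_eq_iff)
  ultimately have "f \<in> borel_measurable (lebesgue_on R)"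
    using assms(3) by (subst borel_measurable_restrict_space_iff) auto
  then show ?thesis
    using assms integrable_lebesgue_on_subset unfolding square_integrable_on_def by blast
qed

lemma has_H1_gradientD:
  assumes "has_H1_gradient S u g"
  shows "square_integrable_on S u" "square_integrable_on S g"
    "test_function S \<phi> \<Longrightarrow> (LINT x|lebesgue_on S. u x * partial_deriv i \<phi> x) = - (LINT x|lebesgue_on S. g x $ i * \<phi> x)"
  using assms by (auto simp: has_H1_gradient_def)

text \<open>A test function of R is one of S, and outside R it vanishes together with its partial
  derivatives, so the integrals over R and S agree.\<close>

lemma has_H1_gradient_subset:
  assumes H: "has_H1_gradient S u g" and S: "S \<in> sets lebesgue" and R: "R \<in> sets lebesgue" "R \<subseteq> S"
  shows "has_H1_gradient R u g"
  unfolding has_H1_gradient_def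
proof (intro conjI allI impI)
  show "square_integrable_on R u" "square_integrable_on R g"
    using square_integrable_on_subset[OF _ S R] has_H1_gradientD[OF H] by auto
  fix \<phi> i assume T: "test_function R \<phi>"
  have eq: "(LINT x|lebesgue_on R. f x) = (LINT x|lebesgue_on S. f x)" if "\<And>x. x \<notin> R \<Longrightarrow> f x = 0" for f :: "real^2 \<Rightarrow> real"
  proof -
    have "(LINT x|lebesgue_on R. f x) = (LINT x|lebesgue. indicator R x *\<^sub>R f x)"
      using R by (subst integral_restrict_space) auto
    also have "\<dots> = (LINT x|lebesgue. indicator S x *\<^sub>R f x)"
      by (rule Bochner_Integration.integral_cong) (use R(2) that in \<open>auto simp: indicator_def\<close>)
    also have "\<dots> = (LINT x|lebesgue_on S. f x)"
      using S by (subst integral_restrict_space) auto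
    finally show ?thesis .
  qed
  show "(LINT x|lebesgue_on R. u x * partial_deriv i \<phi> x) = - (LINT x|lebesgue_on R. g x $ i * \<phi> x)"
    using has_H1_gradientD(3)[OF H test_function_mono[OF T R(2)]] test_function_outside[OF T]
    by (simp add: eq)
qed

lemma square_integrable_on_component':
  fixes g :: "real^2 \<Rightarrow> real^2"
  assumes "square_integrable_on S g"
  shows "square_integrable_on S (\<lambda>x. g x $ i)"
  using square_integrable_on_component[OF assms] by (auto simp: square_integrable_on_def)

lemma has_H1_gradient_lincomb:
  assumes H: "has_H1_gradient S u g" "has_H1_gradient S v h" and S: "S \<in> lmeasurable"
  shows "has_H1_gradient S (\<lambda>x. a * u x + b * v x) (\<lambda>x. a *\<^sub>R g x + b *\<^sub>R h x)"
  unfolding has_H1_gradient_def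
proof (intro conjI allI impI)
  note D = has_H1_gradientD[OF H(1)] has_H1_gradientD[OF H(2)]
  show "square_integrable_on S (\<lambda>x. a * u x + b * v x)"
    using square_integrable_on_lincomb[OF D(1,4), of a b] by simp
  show "square_integrable_on S (\<lambda>x. a *\<^sub>R g x + b *\<^sub>R h x)"
    by (rule square_integrable_on_lincomb[OF D(2,5)])
  fix \<phi> i assume T: "test_function S \<phi>"
  note t = test_function_square_integrable[OF T S]
  have "integrable (lebesgue_on S) (\<lambda>x. f x * k x)" if "square_integrable_on S f" "square_integrable_on S k" for f k :: "real^2 \<Rightarrow> real"
    using square_integrable_on_inner(1)[OF that] by simp
  note i = this[OF D(1) t(2)] this[OF D(4) t(2)]
    this[OF square_integrable_on_component'[OF D(2)] t(1)] this[OF square_integrable_on_component'[OF D(5)] t(1)]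
  have "(LINT x|lebesgue_on S. (a * u x + b * v x) * partial_deriv i \<phi> x) =
    a * (LINT x|lebesgue_on S. u x * partial_deriv i \<phi> x) + b * (LINT x|lebesgue_on S. v x * partial_deriv i \<phi> x)"
    using i by (simp add: distrib_right mult.assoc)
  also have "\<dots> = - (LINT x|lebesgue_on S. (a *\<^sub>R g x + b *\<^sub>R h x) $ i * \<phi> x)"
    using i by (simp add: distrib_right mult.assoc D(3)[OF T] D(6)[OF T])
  finally show "(LINT x|lebesgue_on S. (a * u x + b * v x) * partial_deriv i \<phi> x) =
    - (LINT x|lebesgue_on S. (a *\<^sub>R g x + b *\<^sub>R h x) $ i * \<phi> x)" .
qed

lemma L2_limit_inner:
  fixes f :: "nat \<Rightarrow> real^2 \<Rightarrow> 'b::euclidean_space"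
  assumes f: "\<And>n. square_integrable_on S (f n)" "square_integrable_on S f'" and k: "square_integrable_on S k"
    and lim: "(\<lambda>n. LINT x|lebesgue_on S. (norm (f n x - f' x))\<^sup>2) \<longlonglongrightarrow> 0"
  shows "(\<lambda>n. LINT x|lebesgue_on S. f n x \<bullet> k x) \<longlonglongrightarrow> (LINT x|lebesgue_on S. f' x \<bullet> k x)"
proof -
  have d: "square_integrable_on S (\<lambda>x. f n x - f' x)" for n
    using square_integrable_on_lincomb[OF f(1)[of n] f(2), of 1 "-1"] by simp
  let ?K = "LINT x|lebesgue_on S. (norm (k x))\<^sup>2"
  have fk: "integrable (lebesgue_on S) (\<lambda>x. f n x \<bullet> k x)" "integrable (lebesgue_on S) (\<lambda>x. f' x \<bullet> k x)" for n
    by (rule square_integrable_on_inner(1)[OF f(1)[of n] k], rule square_integrable_on_inner(1)[OF f(2) k])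
  have "(LINT x|lebesgue_on S. f n x \<bullet> k x) - (LINT x|lebesgue_on S. f' x \<bullet> k x) = (LINT x|lebesgue_on S. (f n x - f' x) \<bullet> k x)" for n
    using Bochner_Integration.integral_diff[OF fk(1)[of n] fk(2)] by (simp only: inner_diff_left)
  then have le: "((LINT x|lebesgue_on S. f n x \<bullet> k x) - (LINT x|lebesgue_on S. f' x \<bullet> k x))\<^sup>2 \<le>
      (LINT x|lebesgue_on S. (norm (f n x - f' x))\<^sup>2) * ?K" for n
    using square_integrable_on_Cauchy_Schwarz[OF d[of n] k] by (simp only:)
  have "(\<lambda>n. (LINT x|lebesgue_on S. (norm (f n x - f' x))\<^sup>2) * ?K) \<longlonglongrightarrow> 0 * ?K"
    by (intro tendsto_intros lim)
  then have l0: "(\<lambda>n. (LINT x|lebesgue_on S. (norm (f n x - f' x))\<^sup>2) * ?K) \<longlonglongrightarrow> 0"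
    by simp
  have "(\<lambda>n. ((LINT x|lebesgue_on S. f n x \<bullet> k x) - (LINT x|lebesgue_on S. f' x \<bullet> k x))\<^sup>2) \<longlonglongrightarrow> 0"
    by (rule Lim_null_comparison[OF always_eventually l0]) (use le in simp)
  then have "(\<lambda>n. sqrt (((LINT x|lebesgue_on S. f n x \<bullet> k x) - (LINT x|lebesgue_on S. f' x \<bullet> k x))\<^sup>2)) \<longlonglongrightarrow> sqrt 0"
    by (rule tendsto_real_sqrt)
  then have "(\<lambda>n. (LINT x|lebesgue_on S. f n x \<bullet> k x) - (LINT x|lebesgue_on S. f' x \<bullet> k x)) \<longlonglongrightarrow> 0"
    unfolding real_sqrt_abs real_sqrt_zero by (rule tendsto_rabs_zero_cancel)
  then show ?thesis by (rule LIM_zero_cancel)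
qed

text \<open>For a fixed test function both sides of the weak identity are inner products with fixed
  L2 functions, hence continuous in u and g: the weak gradient is a closed operator.\<close>

lemma has_H1_gradient_L2_limit:
  assumes H: "\<And>n. has_H1_gradient S (u n) (g n)" and S: "S \<in> lmeasurable"
    and v: "square_integrable_on S v" and h: "square_integrable_on S h"
    and lim: "(\<lambda>n. LINT x|lebesgue_on S. (u n x - v x)\<^sup>2) \<longlonglongrightarrow> 0" "(\<lambda>n. LINT x|lebesgue_on S. (norm (g n x - h x))\<^sup>2) \<longlonglongrightarrow> 0"
  shows "has_H1_gradient S v h"
  unfolding has_H1_gradient_def
proof (intro conjI allI impI v h)
  fix \<phi> i assume T: "test_function S \<phi>"
  note D = has_H1_gradientD[OF H]
  note t = test_function_square_integrable[OF T S]
  have "(\<lambda>n. LINT x|lebesgue_on S. u n x * partial_deriv i \<phi> x) \<longlonglongrightarrow> (LINT x|lebesgue_on S. v x * partial_deriv i \<phi> x)"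
    using L2_limit_inner[OF D(1) v t(2)] lim(1) by simp
  moreover have "(\<lambda>n. LINT x|lebesgue_on S. g n x $ i * \<phi> x) \<longlonglongrightarrow> (LINT x|lebesgue_on S. h x $ i * \<phi> x)"
  proof (rule L2_limit_inner[OF square_integrable_on_component'[OF D(2)] square_integrable_on_component'[OF h] t(1),
        unfolded inner_real_def real_norm_def power2_abs])
    have d: "square_integrable_on S (\<lambda>x. g n x - h x)" for n
      using square_integrable_on_lincomb[OF D(2)[of n] h, of 1 "-1"] by simp
    have "(LINT x|lebesgue_on S. (g n x $ i - h x $ i)\<^sup>2) \<le> (LINT x|lebesgue_on S. (norm (g n x - h x))\<^sup>2)" for n
    proof (rule integral_mono)
      show "integrable (lebesgue_on S) (\<lambda>x. (g n x $ i - h x $ i)\<^sup>2)"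
        using square_integrable_on_component(2)[OF d[of n], of i] by simp
      show "integrable (lebesgue_on S) (\<lambda>x. (norm (g n x - h x))\<^sup>2)" using d by (simp add: square_integrable_on_def)
      show "(g n x $ i - h x $ i)\<^sup>2 \<le> (norm (g n x - h x))\<^sup>2" for x
        using component_le_norm_cart[of "g n x - h x" i] by (simp flip: abs_le_square_iff)
    qed
    then show "(\<lambda>n. LINT x|lebesgue_on S. (g n x $ i - h x $ i)\<^sup>2) \<longlonglongrightarrow> 0"
      by (intro Lim_null_comparison[OF always_eventually lim(2)]) auto
  qed
  then have "(\<lambda>n. - (LINT x|lebesgue_on S. g n x $ i * \<phi> x)) \<longlonglongrightarrow> - (LINT x|lebesgue_on S. h x $ i * \<phi> x)"
    by (rule tendsto_minus)
  then have "(\<lambda>n. LINT x|lebesgue_on S. u n x * partial_deriv i \<phi> x) \<longlonglongrightarrow> - (LINT x|lebesgue_on S. h x $ i * \<phi> x)"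
    by (simp add: D(3)[OF T])
  ultimately show "(LINT x|lebesgue_on S. v x * partial_deriv i \<phi> x) = - (LINT x|lebesgue_on S. h x $ i * \<phi> x)"
    by (rule LIMSEQ_unique)
qed

section \<open>Compactness and the second eigenvalue\<close>

text \<open>This is the form in which the Rellich compactness theorem is proved and used.\<close>

definition finite_rank_gap :: "(real^2) set \<Rightarrow> real \<Rightarrow> bool" where
  "finite_rank_gap S \<epsilon> \<longleftrightarrow> (\<exists>F C. finite F \<and> 0 \<le> C \<and> (\<forall>Q\<in>F. Q \<in> sets lebesgue \<and> Q \<subseteq> S) \<and>
     (\<forall>u g. has_H1_gradient S u g \<longrightarrow>
        (LINT x|lebesgue_on S. (u x)\<^sup>2) \<le>
        \<epsilon> * (LINT x|lebesgue_on S. (norm (g x))\<^sup>2) + C * (\<Sum>Q\<in>F. (LINT x|lebesgue_on Q. u x)\<^sup>2)))"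

lemma square_integrable_on_real:
  fixes u :: "real^2 \<Rightarrow> real"
  assumes "square_integrable_on S u"
  shows "integrable (lebesgue_on S) (\<lambda>x. (u x)\<^sup>2)" "u \<in> borel_measurable (lebesgue_on S)"
    "S \<in> lmeasurable \<Longrightarrow> integrable (lebesgue_on S) u"
proof -
  show i: "integrable (lebesgue_on S) (\<lambda>x. (u x)\<^sup>2)" and m: "u \<in> borel_measurable (lebesgue_on S)"
    using assms by (auto simp: square_integrable_on_def)
  show "integrable (lebesgue_on S) u" if "S \<in> lmeasurable"
    by (rule finite_measure.square_integrable_imp_integrable[OF finite_measure_lebesgue_on[OF that] m i])
qed

lemma measure_lebesgue_on_space: "S \<in> sets lebesgue \<Longrightarrow> measure (lebesgue_on S) S = measure lebesgue S"
  by (simp add: measure_restrict_space)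

lemma integral_shift_square:
  fixes u :: "real^2 \<Rightarrow> real"
  assumes "square_integrable_on S u" and S: "S \<in> lmeasurable"
  shows "(LINT x|lebesgue_on S. (u x - \<kappa>)\<^sup>2) =
    (LINT x|lebesgue_on S. (u x)\<^sup>2) - 2 * \<kappa> * (LINT x|lebesgue_on S. u x) + \<kappa>\<^sup>2 * measure lebesgue S"
proof -
  interpret finite_measure "lebesgue_on S" by (rule finite_measure_lebesgue_on[OF S])
  note i = square_integrable_on_real(1,3)[OF assms(1)] 
  have "(LINT x|lebesgue_on S. (u x - \<kappa>)\<^sup>2) = (LINT x|lebesgue_on S. (u x)\<^sup>2 - 2 * \<kappa> * u x + \<kappa>\<^sup>2)"
    by (simp add: power2_diff algebra_simps)
  also have "\<dots> = (LINT x|lebesgue_on S. (u x)\<^sup>2) - 2 * \<kappa> * (LINT x|lebesgue_on S. u x) + \<kappa>\<^sup>2 * measure lebesgue S"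
    using i S by (simp add: measure_lebesgue_on_space fmeasurableD)
  finally show ?thesis .
qed

text \<open>The mean value is the best constant: with m the integral of u and A the area, the
  integral of (u - \<kappa>)^2 is at least that of u^2 minus m^2 / A for every \<kappa>, by
  completing the square.\<close>

lemma variance_le:
  assumes H: "has_H1_gradient (rect a b c d) u g" and ab: "a < b" "c < d"
  shows "(LINT x|lebesgue_on (rect a b c d). (u x)\<^sup>2) \<le>
    6 * ((b - a)\<^sup>2 + (d - c)\<^sup>2) * (LINT x|lebesgue_on (rect a b c d). (norm (g x))\<^sup>2) +
    (LINT x|lebesgue_on (rect a b c d). u x)\<^sup>2 / ((b - a) * (d - c))"
proof -
  obtain \<kappa> where \<kappa>: "(LINT x|lebesgue_on (rect a b c d). (u x - \<kappa>)\<^sup>2) \<le>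
    6 * ((b - a)\<^sup>2 + (d - c)\<^sup>2) * (LINT x|lebesgue_on (rect a b c d). (norm (g x))\<^sup>2)"
    using Poincare_rect[OF H ab] .
  have eq: "(LINT x|lebesgue_on (rect a b c d). (u x - \<kappa>)\<^sup>2) =
    (LINT x|lebesgue_on (rect a b c d). (u x)\<^sup>2) - 2 * \<kappa> * (LINT x|lebesgue_on (rect a b c d). u x) + \<kappa>\<^sup>2 * ((b - a) * (d - c))"
    using integral_shift_square[OF has_H1_gradientD(1)[OF H] lmeasurable_rect] ab by (simp add: measure_rect)
  have "2 * \<kappa> * m - \<kappa>\<^sup>2 * A \<le> m\<^sup>2 / A" if "A > 0" for m A :: real
  proof -
    have "0 \<le> (m - \<kappa> * A)\<^sup>2" by simp
    then have "(2 * \<kappa> * m - \<kappa>\<^sup>2 * A) * A \<le> m\<^sup>2" by (simp add: power2_eq_square algebra_simps)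
    then show ?thesis using that by (simp add: pos_le_divide_eq)
  qed
  note this[of "(b - a) * (d - c)" "LINT x|lebesgue_on (rect a b c d). u x"]
  moreover have "(b - a) * (d - c) > 0" using ab by simp
  ultimately show ?thesis using \<kappa> unfolding eq by linarith
qed

text \<open>Overlapping pieces count the gradient twice and so double \<epsilon>; disjoint pieces
  keep it, which is what allows a rectangle to be bisected again and again without loss.\<close>

lemma finite_rank_gap_cover:
  assumes S: "S \<in> lmeasurable" and A: "A \<in> sets lebesgue" "A \<subseteq> S" and B: "B \<in> sets lebesgue" "B \<subseteq> S"
    and N: "negligible N" "S \<subseteq> A \<union> B \<union> N"
    and gap: "finite_rank_gap A \<epsilon>" "finite_rank_gap B \<epsilon>" and \<delta>: "0 \<le> \<epsilon>" "\<delta> = (if A \<inter> B = {} then \<epsilon> else 2 * \<epsilon>)"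
  shows "finite_rank_gap S \<delta>"
proof -
  have SS: "S \<in> sets lebesgue" using S by (rule fmeasurableD)
  obtain F C where F: "finite F" "0 \<le> C" "\<And>Q. Q \<in> F \<Longrightarrow> Q \<in> sets lebesgue \<and> Q \<subseteq> A"
    and FA: "\<And>u g. has_H1_gradient A u g \<Longrightarrow> (LINT x|lebesgue_on A. (u x)\<^sup>2) \<le>
        \<epsilon> * (LINT x|lebesgue_on A. (norm (g x))\<^sup>2) + C * (\<Sum>Q\<in>F. (LINT x|lebesgue_on Q. u x)\<^sup>2)"
    using gap(1) unfolding finite_rank_gap_def by blast
  obtain G D where G: "finite G" "0 \<le> D" "\<And>Q. Q \<in> G \<Longrightarrow> Q \<in> sets lebesgue \<and> Q \<subseteq> B"
    and GB: "\<And>u g. has_H1_gradient B u g \<Longrightarrow> (LINT x|lebesgue_on B. (u x)\<^sup>2) \<le>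
        \<epsilon> * (LINT x|lebesgue_on B. (norm (g x))\<^sup>2) + D * (\<Sum>Q\<in>G. (LINT x|lebesgue_on Q. u x)\<^sup>2)"
    using gap(2) unfolding finite_rank_gap_def by blast
  show ?thesis
    unfolding finite_rank_gap_def
  proof (intro exI[of _ "F \<union> G"] exI[of _ "C + D"] conjI ballI allI impI)
    fix u g assume H: "has_H1_gradient S u g"
    let ?s = "\<lambda>F. \<Sum>Q\<in>F. (LINT x|lebesgue_on Q. u x)\<^sup>2"
    have iu: "integrable (lebesgue_on S) (\<lambda>x. (u x)\<^sup>2)" and ig: "integrable (lebesgue_on S) (\<lambda>x. (norm (g x))\<^sup>2)"
      using has_H1_gradientD(1,2)[OF H] by (auto simp: square_integrable_on_def)
    have "(LINT x|lebesgue_on S. (u x)\<^sup>2) \<le> (LINT x|lebesgue_on A. (u x)\<^sup>2) + (LINT x|lebesgue_on B. (u x)\<^sup>2)"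
      by (rule integral_lebesgue_on_cover[OF iu SS A B N]) simp
    also have "\<dots> \<le> (\<epsilon> * (LINT x|lebesgue_on A. (norm (g x))\<^sup>2) + C * ?s F) + (\<epsilon> * (LINT x|lebesgue_on B. (norm (g x))\<^sup>2) + D * ?s G)"
      by (rule add_mono[OF FA GB]) (use has_H1_gradient_subset[OF H SS] A B in auto)
    also have "\<dots> = \<epsilon> * ((LINT x|lebesgue_on A. (norm (g x))\<^sup>2) + (LINT x|lebesgue_on B. (norm (g x))\<^sup>2)) + (C * ?s F + D * ?s G)"
      by (simp add: algebra_simps)
    also have "\<epsilon> * ((LINT x|lebesgue_on A. (norm (g x))\<^sup>2) + (LINT x|lebesgue_on B. (norm (g x))\<^sup>2)) \<le> \<delta> * (LINT x|lebesgue_on S. (norm (g x))\<^sup>2)"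
    proof (cases "A \<inter> B = {}")
      case True
      have "(LINT x|lebesgue_on A. (norm (g x))\<^sup>2) + (LINT x|lebesgue_on B. (norm (g x))\<^sup>2) \<le> (LINT x|lebesgue_on S. (norm (g x))\<^sup>2)"
        by (rule integral_lebesgue_on_disjoint[OF ig SS A B True]) simp
      then show ?thesis using \<delta> True by (simp add: mult_left_mono)
    next
      case False
      have "(LINT x|lebesgue_on A. (norm (g x))\<^sup>2) \<le> (LINT x|lebesgue_on S. (norm (g x))\<^sup>2)"
        "(LINT x|lebesgue_on B. (norm (g x))\<^sup>2) \<le> (LINT x|lebesgue_on S. (norm (g x))\<^sup>2)"
        by (rule integral_lebesgue_on_mono[OF ig SS]; use A B in simp)+
      then have "(LINT x|lebesgue_on A. (norm (g x))\<^sup>2) + (LINT x|lebesgue_on B. (norm (g x))\<^sup>2) \<le> 2 * (LINT x|lebesgue_on S. (norm (g x))\<^sup>2)"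
        by linarith
      from mult_left_mono[OF this \<delta>(1)] show ?thesis using \<delta> False by (simp add: mult_ac)
    qed
    also have "C * ?s F + D * ?s G \<le> C * ?s (F \<union> G) + D * ?s (F \<union> G)"
      using F G by (intro add_mono mult_left_mono sum_mono2) auto
    finally show "(LINT x|lebesgue_on S. (u x)\<^sup>2) \<le> \<delta> * (LINT x|lebesgue_on S. (norm (g x))\<^sup>2) + (C + D) * ?s (F \<union> G)"
      by (simp add: algebra_simps)
  next
    fix Q assume "Q \<in> F \<union> G"
    then show "Q \<in> sets lebesgue" "Q \<subseteq> S" using F(3) G(3) A(2) B(2) by blast+
  qed (use F G in auto)
qed

lemma rect_split:
  assumes "a < m" "m < b"
  shows "rect a m c d \<inter> rect m b c d = {}" "rect a b c d \<subseteq> rect a m c d \<union> rect m b c d \<union> {x. x $ 1 = m}"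
    "rect a m c d \<subseteq> rect a b c d" "rect m b c d \<subseteq> rect a b c d"
    "rect c d a m \<inter> rect c d m b = {}" "rect c d a b \<subseteq> rect c d a m \<union> rect c d m b \<union> {x. x $ 2 = m}"
    "rect c d a m \<subseteq> rect c d a b" "rect c d m b \<subseteq> rect c d a b"
  using assms by (auto simp: rect_def)

lemma negligible_line: "negligible {x :: real^2. x $ i = m}"
  using negligible_standard_hyperplane[of "axis i (1::real)" m] by (simp add: cart_eq_inner_axis)

text \<open>Halving both sides divides the squared diagonal by 4. After n rounds the Poincare
  constant of the small rectangles is at most \<epsilon>, and the integrals over them are the
  finitely many functionals.\<close>

lemma finite_rank_gap_rect:
  assumes "a < b" "c < d" "\<epsilon> > 0"
  shows "finite_rank_gap (rect a b c d) \<epsilon>"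
proof -
  have rs: "rect a b c d \<in> sets lebesgue" for a b c d using lmeasurable_rect by (rule fmeasurableD)
  have "finite_rank_gap (rect a b c d) \<epsilon>" if "a < b" "c < d" "6 * ((b - a)\<^sup>2 + (d - c)\<^sup>2) \<le> 4 ^ n * \<epsilon>" for n a b c d
    using that
  proof (induction n arbitrary: a b c d)
    case 0
    show ?case
      unfolding finite_rank_gap_def
    proof (intro exI[of _ "{rect a b c d}"] exI[of _ "1 / ((b - a) * (d - c))"] conjI ballI allI impI)
      fix u g assume H: "has_H1_gradient (rect a b c d) u g"
      have "6 * ((b - a)\<^sup>2 + (d - c)\<^sup>2) * (LINT x|lebesgue_on (rect a b c d). (norm (g x))\<^sup>2) \<le> \<epsilon> * (LINT x|lebesgue_on (rect a b c d). (norm (g x))\<^sup>2)"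
        using 0 by (intro mult_right_mono) auto
      with variance_le[OF H 0(1,2)] show "(LINT x|lebesgue_on (rect a b c d). (u x)\<^sup>2) \<le>
        \<epsilon> * (LINT x|lebesgue_on (rect a b c d). (norm (g x))\<^sup>2) +
        1 / ((b - a) * (d - c)) * (\<Sum>Q\<in>{rect a b c d}. (LINT x|lebesgue_on Q. u x)\<^sup>2)"
        by simp
    qed (use 0 rs in auto)
  next
    case (Suc n)
    define m where "m = (a + b) / 2"
    define k where "k = (c + d) / 2"
    have m: "a < m" "m < b" "m - a = (b - a) / 2" "b - m = (b - a) / 2"
      and k: "c < k" "k < d" "k - c = (d - c) / 2" "d - k = (d - c) / 2"
      using Suc.prems by (auto simp: m_def k_def field_simps)
    have small: "6 * (((b - a) / 2)\<^sup>2 + ((d - c) / 2)\<^sup>2) \<le> 4 ^ n * \<epsilon>"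
      using Suc.prems(3) by (simp add: power_divide)
    have col: "finite_rank_gap (rect a' b' c d) \<epsilon>" if "a' < b'" "b' - a' = (b - a) / 2" for a' b'
    proof (rule finite_rank_gap_cover[OF lmeasurable_rect rs rect_split(7)[OF k(1,2)] rs rect_split(8)[OF k(1,2)]
          negligible_line rect_split(6)[OF k(1,2)], where \<epsilon> = \<epsilon>])
      show "finite_rank_gap (rect a' b' c k) \<epsilon>" "finite_rank_gap (rect a' b' k d) \<epsilon>"
        by (rule Suc.IH; use that k small in \<open>simp only: that(2) k(3,4)\<close>)+
    qed (use rect_split(5)[OF k(1,2)] assms in auto)
    show ?case
      by (rule finite_rank_gap_cover[OF lmeasurable_rect rs rect_split(3)[OF m(1,2)] rs rect_split(4)[OF m(1,2)]
          negligible_line rect_split(2)[OF m(1,2)], where \<epsilon> = \<epsilon>])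
        (use rect_split(1)[OF m(1,2)] col m assms in auto)
  qed
  moreover obtain n where "6 * ((b - a)\<^sup>2 + (d - c)\<^sup>2) / \<epsilon> < 4 ^ n"
    using real_arch_pow[of 4 "6 * ((b - a)\<^sup>2 + (d - c)\<^sup>2) / \<epsilon>"] by auto
  then have "6 * ((b - a)\<^sup>2 + (d - c)\<^sup>2) \<le> 4 ^ n * \<epsilon>" using assms(3) by (simp add: field_simps)
  ultimately show ?thesis using assms by blast
qed

lemma finite_rank_gap_Un:
  assumes "\<And>\<epsilon>. \<epsilon> > 0 \<Longrightarrow> finite_rank_gap A \<epsilon>" "\<And>\<epsilon>. \<epsilon> > 0 \<Longrightarrow> finite_rank_gap B \<epsilon>"
    and "A \<in> lmeasurable" "B \<in> lmeasurable" "\<epsilon> > 0"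
  shows "finite_rank_gap (A \<union> B) \<epsilon>"
proof (cases "A \<inter> B = {}")
  case True
  show ?thesis
    by (rule finite_rank_gap_cover[of _ A B "{}" \<epsilon>]) (use assms True fmeasurableD in auto)
next
  case False
  show ?thesis
    by (rule finite_rank_gap_cover[of _ A B "{}" "\<epsilon> / 2"]) (use assms False fmeasurableD in auto)
qed

text \<open>The gaps for 1 / (k + 1), over all k, involve countably many integrals, so along a
  suitable subsequence all of them converge. The gap for k then bounds the squared L2 distance of
  two members by 4 K / (k + 1) plus squared differences of integrals.\<close>

lemma L2_Cauchy_subsequence:
  assumes gap: "\<And>\<epsilon>. \<epsilon> > 0 \<Longrightarrow> finite_rank_gap S \<epsilon>" and S: "S \<in> lmeasurable"
    and H: "\<And>n. has_H1_gradient S (u n) (g n)"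
    and bd: "\<And>n. (LINT x|lebesgue_on S. (u n x)\<^sup>2) \<le> K" "\<And>n. (LINT x|lebesgue_on S. (norm (g n x))\<^sup>2) \<le> K"
  obtains r :: "nat \<Rightarrow> nat" where "strict_mono r"
    "\<And>e. e > 0 \<Longrightarrow> \<exists>N. \<forall>m\<ge>N. \<forall>n\<ge>N. (LINT x|lebesgue_on S. (u (r m) x - u (r n) x)\<^sup>2) < e"
proof -
  have SS: "S \<in> sets lebesgue" using S by (rule fmeasurableD)
  define gap_by where "gap_by k F C \<longleftrightarrow> finite F \<and> 0 \<le> C \<and> (\<forall>Q\<in>F. Q \<in> sets lebesgue \<and> Q \<subseteq> S) \<and>
     (\<forall>u g. has_H1_gradient S u g \<longrightarrow> (LINT x|lebesgue_on S. (u x)\<^sup>2) \<le>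
        1 / real (Suc k) * (LINT x|lebesgue_on S. (norm (g x))\<^sup>2) + C * (\<Sum>Q\<in>F. (LINT x|lebesgue_on Q. u x)\<^sup>2))"
    for k F and C :: real
  have "\<exists>F C. gap_by k F C" for k
    using gap[of "1 / real (Suc k)"] unfolding finite_rank_gap_def gap_by_def by simp
  then obtain F C where gb: "\<And>k. gap_by k (F k) (C k)" by metis
  have F: "\<And>k. finite (F k)" "\<And>k. 0 \<le> C k" "\<And>k Q. Q \<in> F k \<Longrightarrow> Q \<in> sets lebesgue \<and> Q \<subseteq> S"
    and FC: "\<And>k u g. has_H1_gradient S u g \<Longrightarrow> (LINT x|lebesgue_on S. (u x)\<^sup>2) \<le>
        1 / real (Suc k) * (LINT x|lebesgue_on S. (norm (g x))\<^sup>2) + C k * (\<Sum>Q\<in>F k. (LINT x|lebesgue_on Q. u x)\<^sup>2)"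
    using gb unfolding gap_by_def by blast+
  have "0 \<le> (LINT x|lebesgue_on S. (u 0 x)\<^sup>2)" by simp
  with bd(1)[of 0] have K: "0 \<le> K" by linarith
  let ?A = "measure lebesgue S"
  have bounded: "norm (LINT x|lebesgue_on Q. u n x) \<le> ?A * K + 1" if "Q \<in> (\<Union>k. F k)" for n Q
  proof -
    have Q: "Q \<in> sets lebesgue" "Q \<subseteq> S" using that F(3) by blast+
    then have Ql: "Q \<in> lmeasurable" using S by (meson fmeasurableI2)
    note HQ = has_H1_gradient_subset[OF H[of n] SS Q]
    have 1: "square_integrable_on Q (\<lambda>x. 1 :: real)"
      by (rule square_integrable_onI_bounded[OF Ql, where B = 1]) auto
    have "(LINT x|lebesgue_on Q. u n x)\<^sup>2 \<le> (LINT x|lebesgue_on Q. (u n x)\<^sup>2) * measure lebesgue Q"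
      using square_integrable_on_Cauchy_Schwarz[OF has_H1_gradientD(1)[OF HQ] 1] Q(1)
      by (simp add: measure_lebesgue_on_space)
    also have "\<dots> \<le> K * ?A"
    proof (rule mult_mono)
      show "(LINT x|lebesgue_on Q. (u n x)\<^sup>2) \<le> K"
        using integral_lebesgue_on_mono[OF _ SS Q, of "\<lambda>x. (u n x)\<^sup>2"] bd(1)[of n]
          square_integrable_on_real(1)[OF has_H1_gradientD(1)[OF H[of n]]] by simp
      show "measure lebesgue Q \<le> ?A" using Q S by (intro measure_mono_fmeasurable) auto
    qed (use K in auto)
    finally have "(LINT x|lebesgue_on Q. u n x)\<^sup>2 \<le> ?A * K" by (simp add: mult.commute)
    moreover have "\<bar>y\<bar> \<le> y\<^sup>2 + 1" for y :: real
    proof -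
      have "0 \<le> (\<bar>y\<bar> - 1)\<^sup>2" by simp
      then have "2 * \<bar>y\<bar> \<le> y\<^sup>2 + 1" by (simp add: power2_diff)
      then show ?thesis using abs_ge_zero[of y] by linarith
    qed
    note this[of "LINT x|lebesgue_on Q. u n x"]
    ultimately show ?thesis unfolding real_norm_def by linarith
  qed
  obtain r where r: "strict_mono (r :: nat \<Rightarrow> nat)"
    and conv: "\<And>Q. Q \<in> (\<Union>k. F k) \<Longrightarrow> \<exists>l. (\<lambda>n. LINT x|lebesgue_on Q. u (r n) x) \<longlonglongrightarrow> l"
  proof (rule function_convergent_subsequence[of "\<Union>k. F k" "\<lambda>n Q. LINT x|lebesgue_on Q. u n x" "?A * K + 1"])
    show "countable (\<Union>k. F k)" using F(1) by (auto intro: countable_finite)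
  qed (use bounded in blast)+
  have "\<exists>N. \<forall>m\<ge>N. \<forall>n\<ge>N. (LINT x|lebesgue_on S. (u (r m) x - u (r n) x)\<^sup>2) < e" if e: "e > 0" for e
  proof -
    \<comment> \<open>The parallelogram law bounds the Dirichlet integral of a difference by 4 K;
      the added 1 covers K = 0.\<close>
    obtain k where k: "1 / real (Suc k) < e / (2 * (4 * K + 1))"
      using nat_approx_posE[of "e / (2 * (4 * K + 1))"] e K by auto
    have k': "1 / real (Suc k) * (4 * K) < e / 2"
    proof -
      have "1 / real (Suc k) * (4 * K) \<le> 1 / real (Suc k) * (4 * K + 1)" by (intro mult_left_mono) auto
      also have "\<dots> < e / (2 * (4 * K + 1)) * (4 * K + 1)" using k K by (intro mult_strict_right_mono) auto
      also have "\<dots> = e / 2" using K by (simp add: field_simps)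
      finally show ?thesis .
    qed
    \<comment> \<open>The allowance for each integral: all of them together, weighted with C k, use
      up the other e / 2. The added ones prevent division by zero when the denominator would
      otherwise vanish.\<close>
    define d where "d = e / (2 * (C k + 1) * (real (card (F k)) + 1))"
    have d: "d > 0" using e F(2)[of k] by (simp add: d_def add_nonneg_pos)
    have "\<exists>N. \<forall>m\<ge>N. \<forall>n\<ge>N. ((LINT x|lebesgue_on Q. u (r m) x) - (LINT x|lebesgue_on Q. u (r n) x))\<^sup>2 < d" if "Q \<in> F k" for Q
    proof -
      have "Cauchy (\<lambda>n. LINT x|lebesgue_on Q. u (r n) x)"
        using conv[of Q] that by (auto intro: LIMSEQ_imp_Cauchy)
      then obtain N where N: "\<And>m n. m \<ge> N \<Longrightarrow> n \<ge> N \<Longrightarrow> \<bar>(LINT x|lebesgue_on Q. u (r m) x) - (LINT x|lebesgue_on Q. u (r n) x)\<bar> < sqrt d"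
        using d metric_CauchyD[of "\<lambda>n. LINT x|lebesgue_on Q. u (r n) x" "sqrt d"] unfolding dist_real_def by auto
      have "((LINT x|lebesgue_on Q. u (r m) x) - (LINT x|lebesgue_on Q. u (r n) x))\<^sup>2 < d" if "m \<ge> N" "n \<ge> N" for m n
        using power_strict_mono[OF N[OF that] abs_ge_zero, of 2] d by simp
      then show ?thesis by blast
    qed
    then have "\<forall>Q\<in>F k. \<exists>N. \<forall>m\<ge>N. \<forall>n\<ge>N. ((LINT x|lebesgue_on Q. u (r m) x) - (LINT x|lebesgue_on Q. u (r n) x))\<^sup>2 < d"
      by blast
    from bchoice[OF this] obtain N where N: "\<And>Q m n. Q \<in> F k \<Longrightarrow> m \<ge> N Q \<Longrightarrow> n \<ge> N Q \<Longrightarrow> ((LINT x|lebesgue_on Q. u (r m) x) - (LINT x|lebesgue_on Q. u (r n) x))\<^sup>2 < d"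
      by blast
    \<comment> \<open>A sum of natural numbers bounds each of them, also over an empty
      family.\<close>
    define N' where "N' = (\<Sum>Q\<in>F k. N Q)"
    have N': "N Q \<le> N'" if "Q \<in> F k" for Q using that F(1) by (auto simp: N'_def intro: member_le_sum)
    have "(LINT x|lebesgue_on S. (u (r m) x - u (r n) x)\<^sup>2) < e" if mn: "m \<ge> N'" "n \<ge> N'" for m n
    proof -
      have Hd: "has_H1_gradient S (\<lambda>x. u (r m) x - u (r n) x) (\<lambda>x. g (r m) x - g (r n) x)"
        using has_H1_gradient_lincomb[OF H[of "r m"] H[of "r n"] S, of 1 "-1"] by simp
      have gs: "square_integrable_on S (g n)" for n using has_H1_gradientD(2)[OF H] .
      have "(LINT x|lebesgue_on S. (norm (g (r m) x - g (r n) x))\<^sup>2) \<le> 4 * K"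
      proof -
        have "(LINT x|lebesgue_on S. (norm (g (r m) x - g (r n) x))\<^sup>2) + (LINT x|lebesgue_on S. (norm (g (r m) x + g (r n) x))\<^sup>2) =
          2 * (LINT x|lebesgue_on S. (norm (g (r m) x))\<^sup>2) + 2 * (LINT x|lebesgue_on S. (norm (g (r n) x))\<^sup>2)"
          using integral_norm_lincomb[OF gs[of "r m"] gs[of "r n"], of 1 1] integral_norm_lincomb[OF gs[of "r m"] gs[of "r n"], of 1 "-1"]
          by simp
        moreover have "0 \<le> (LINT x|lebesgue_on S. (norm (g (r m) x + g (r n) x))\<^sup>2)" by simp
        ultimately show ?thesis using bd(2)[of "r m"] bd(2)[of "r n"] by linarith
      qed
      then have "1 / real (Suc k) * (LINT x|lebesgue_on S. (norm (g (r m) x - g (r n) x))\<^sup>2) \<le> 1 / real (Suc k) * (4 * K)"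
        by (rule mult_left_mono) simp
      with k' have g4: "1 / real (Suc k) * (LINT x|lebesgue_on S. (norm (g (r m) x - g (r n) x))\<^sup>2) < e / 2"
        by linarith
      have "(\<Sum>Q\<in>F k. (LINT x|lebesgue_on Q. u (r m) x - u (r n) x)\<^sup>2) \<le> (\<Sum>Q\<in>F k. d)"
      proof (rule sum_mono)
        fix Q assume Q: "Q \<in> F k"
        have Q': "Q \<in> sets lebesgue" "Q \<subseteq> S" using Q F by auto
        have i: "integrable (lebesgue_on Q) (u n)" for n
          using integrable_lebesgue_on_subset[OF square_integrable_on_real(3)[OF has_H1_gradientD(1)[OF H] S] SS Q'] .
        show "(LINT x|lebesgue_on Q. u (r m) x - u (r n) x)\<^sup>2 \<le> d"
          using N[OF Q, of m n] N'[OF Q] mn Bochner_Integration.integral_diff[OF i i, of "r m" "r n"] by simp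
      qed
      then have "C k * (\<Sum>Q\<in>F k. (LINT x|lebesgue_on Q. u (r m) x - u (r n) x)\<^sup>2) \<le> C k * (real (card (F k)) * d)"
        using F(2)[of k] by (intro mult_left_mono) auto
      also have "\<dots> \<le> (C k + 1) * ((real (card (F k)) + 1) * d)"
        using F(2)[of k] d by (intro mult_mono) auto
      also have "\<dots> = e / 2"
      proof -
        have cancel: "c * (t * (e / (2 * c * t))) = e / 2" if "c > 0" "t > 0" for c t :: real using that by simp
        show ?thesis unfolding d_def by (rule cancel) (use F(2)[of k] in auto)
      qed
      finally have c4: "C k * (\<Sum>Q\<in>F k. (LINT x|lebesgue_on Q. u (r m) x - u (r n) x)\<^sup>2) \<le> e / 2" .
      show ?thesis using FC[OF Hd, of k] g4 c4 by linarith
    qed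
    then show ?thesis by blast
  qed
  with r show ?thesis using that by blast
qed

text \<open>Riesz-Fischer. On a finite measure space an L2 Cauchy sequence is L1 Cauchy, so a
  subsequence converges almost everywhere; Fatou's lemma then bounds the L2 distance of every late
  member to the limit.\<close>

lemma L2_complete:
  fixes f :: "nat \<Rightarrow> real^2 \<Rightarrow> 'b::euclidean_space"
  assumes S: "S \<in> lmeasurable" and f: "\<And>n. square_integrable_on S (f n)"
    and cauchy: "\<And>e. e > 0 \<Longrightarrow> \<exists>N. \<forall>m\<ge>N. \<forall>n\<ge>N. (LINT x|lebesgue_on S. (norm (f m x - f n x))\<^sup>2) < e"
  obtains h where "square_integrable_on S h" "(\<lambda>n. LINT x|lebesgue_on S. (norm (f n x - h x))\<^sup>2) \<longlonglongrightarrow> 0"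
proof -
  let ?M = "lebesgue_on S"
  interpret finite_measure ?M by (rule finite_measure_lebesgue_on[OF S])
  have [measurable]: "f n \<in> borel_measurable ?M" for n using f by (simp add: square_integrable_on_def)
  have d: "square_integrable_on S (\<lambda>x. f m x - f n x)" for m n
    using square_integrable_on_lincomb[OF f[of m] f[of n], of 1 "-1"] by simp
  have di: "integrable ?M (\<lambda>x. (norm (f m x - f n x))\<^sup>2)" for m n using d by (simp add: square_integrable_on_def)
  have fi: "integrable ?M (f n)" for n
  proof -
    have "integrable ?M (\<lambda>x. norm (f n x))"
      by (rule square_integrable_imp_integrable) (use f in \<open>auto simp: square_integrable_on_def\<close>)
    then show ?thesis by (simp add: integrable_norm_iff)
  qed
  obtain r where r: "strict_mono r" and ae: "AE x in ?M. Cauchy (\<lambda>i. f (r i) x)"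
  proof (rule cauchy_L1_AE_cauchy_subseq[of ?M f, OF fi])
    fix e :: real assume e: "e > 0"
    define A where "A = measure ?M (space ?M)"
    have A: "A \<ge> 0" by (simp add: A_def)
    obtain N where N: "\<And>m n. m \<ge> N \<Longrightarrow> n \<ge> N \<Longrightarrow> (LINT x|?M. (norm (f m x - f n x))\<^sup>2) < e\<^sup>2 / (A + 1)"
      using cauchy[of "e\<^sup>2 / (A + 1)"] e A by (auto simp: add_nonneg_pos)
    have "(LINT x|?M. norm (f m x - f n x)) < e" if "m \<ge> N" "n \<ge> N" for m n
    proof -
      have "(LINT x|?M. norm (f m x - f n x) * 1)\<^sup>2 \<le> (LINT x|?M. (norm (f m x - f n x))\<^sup>2) * (LINT x|?M. 1\<^sup>2)"
        by (rule Cauchy_Schwarz_integral) (use di in auto)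
      also have "\<dots> = (LINT x|?M. (norm (f m x - f n x))\<^sup>2) * A" by (simp add: A_def)
      also have "\<dots> \<le> e\<^sup>2 / (A + 1) * A" using N[OF that] A by (intro mult_right_mono) auto
      also have "\<dots> < e\<^sup>2"
      proof -
        have "e\<^sup>2 * (A / (A + 1)) < e\<^sup>2 * 1" by (rule mult_strict_left_mono) (use e A in auto)
        then show ?thesis by simp
      qed
      finally have "(LINT x|?M. norm (f m x - f n x))\<^sup>2 < e\<^sup>2" by (simp only: mult_1_right)
      then show ?thesis using e by (rule power2_less_imp_less[OF _ less_imp_le])
    qed
    then show "\<exists>N. \<forall>i\<ge>N. \<forall>j\<ge>N. (LINT x|?M. norm (f i x - f j x)) < e" by blast
  qed blast
  define h where "h x = lim (\<lambda>i. f (r i) x)" for x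
  have [measurable]: "h \<in> borel_measurable ?M" unfolding h_def by measurable
  have lim: "AE x in ?M. (\<lambda>i. f (r i) x) \<longlonglongrightarrow> h x"
    using ae by eventually_elim (simp add: h_def Cauchy_convergent_iff convergent_LIMSEQ_iff)
  have key: "\<exists>N. \<forall>n\<ge>N. integrable ?M (\<lambda>x. (norm (f n x - h x))\<^sup>2) \<and> (LINT x|?M. (norm (f n x - h x))\<^sup>2) \<le> e" if e: "e > 0" for e
  proof -
    obtain N where N: "\<And>m n. m \<ge> N \<Longrightarrow> n \<ge> N \<Longrightarrow> (LINT x|?M. (norm (f m x - f n x))\<^sup>2) < e"
      using cauchy[OF e] by blast
    have "integrable ?M (\<lambda>x. (norm (f n x - h x))\<^sup>2) \<and> (LINT x|?M. (norm (f n x - h x))\<^sup>2) \<le> e" if n: "n \<ge> N" for n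
    proof -
      have "(\<integral>\<^sup>+x. ennreal ((norm (f n x - h x))\<^sup>2) \<partial>?M) = (\<integral>\<^sup>+x. liminf (\<lambda>i. ennreal ((norm (f n x - f (r i) x))\<^sup>2)) \<partial>?M)"
      proof (rule nn_integral_cong_AE)
        show "AE x in ?M. ennreal ((norm (f n x - h x))\<^sup>2) = liminf (\<lambda>i. ennreal ((norm (f n x - f (r i) x))\<^sup>2))"
          using lim
        proof eventually_elim
          case (elim x)
          have "(\<lambda>i. ennreal ((norm (f n x - f (r i) x))\<^sup>2)) \<longlonglongrightarrow> ennreal ((norm (f n x - h x))\<^sup>2)"
            by (intro tendsto_ennrealI tendsto_intros elim)
          then show ?case by (intro lim_imp_Liminf[symmetric]) auto
        qed
      qed
      also have "\<dots> \<le> liminf (\<lambda>i. \<integral>\<^sup>+x. ennreal ((norm (f n x - f (r i) x))\<^sup>2) \<partial>?M)"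
        by (rule nn_integral_liminf) measurable
      also have "\<dots> \<le> limsup (\<lambda>i. \<integral>\<^sup>+x. ennreal ((norm (f n x - f (r i) x))\<^sup>2) \<partial>?M)"
        by (rule Liminf_le_Limsup) simp
      also have "\<dots> \<le> ennreal e"
      proof (rule Limsup_bounded)
        show "\<forall>\<^sub>F i in sequentially. (\<integral>\<^sup>+x. ennreal ((norm (f n x - f (r i) x))\<^sup>2) \<partial>?M) \<le> ennreal e"
          using eventually_ge_at_top[of N]
        proof eventually_elim
          case (elim i)
          have "r i \<ge> N" using elim seq_suble[OF r, of i] by linarith
          then have "(LINT x|?M. (norm (f n x - f (r i) x))\<^sup>2) \<le> e" using N[OF n, of "r i"] by simp
          then show ?case by (subst nn_integral_eq_integral[OF di]) (auto intro: ennreal_leI)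
        qed
      qed
      finally have le: "(\<integral>\<^sup>+x. ennreal ((norm (f n x - h x))\<^sup>2) \<partial>?M) \<le> ennreal e" .
      then have i: "integrable ?M (\<lambda>x. (norm (f n x - h x))\<^sup>2)"
        by (intro integrableI_bounded) (auto simp: le_less_trans)
      have "ennreal (LINT x|?M. (norm (f n x - h x))\<^sup>2) \<le> ennreal e"
        using le by (subst (asm) nn_integral_eq_integral[OF i]) auto
      then show ?thesis using i e by (simp add: ennreal_le_iff)
    qed
    then show ?thesis by blast
  qed
  \<comment> \<open>Square integrability of h is read off from that of a single difference.\<close>
  obtain N1 where "integrable ?M (\<lambda>x. (norm (f N1 x - h x))\<^sup>2)" using key[of 1] by auto
  then have "square_integrable_on S (\<lambda>x. f N1 x - h x)" by (simp add: square_integrable_on_def)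
  from square_integrable_on_lincomb[OF f[of N1] this, of 1 "-1"] have h: "square_integrable_on S h" by simp
  have "(\<lambda>n. LINT x|?M. (norm (f n x - h x))\<^sup>2) \<longlonglongrightarrow> 0"
  proof (rule LIMSEQ_I)
    fix e :: real assume "e > 0"
    then obtain N where N: "\<forall>n\<ge>N. (LINT x|?M. (norm (f n x - h x))\<^sup>2) \<le> e / 2" using key[of "e / 2"] by auto
    have "norm ((LINT x|?M. (norm (f n x - h x))\<^sup>2) - 0) < e" if "n \<ge> N" for n
    proof -
      have "(LINT x|?M. (norm (f n x - h x))\<^sup>2) \<le> e / 2" using N that by blast
      moreover have "0 \<le> (LINT x|?M. (norm (f n x - h x))\<^sup>2)" by simp
      ultimately show ?thesis using \<open>e > 0\<close> by simp
    qed
    then show "\<exists>N. \<forall>n\<ge>N. norm ((LINT x|?M. (norm (f n x - h x))\<^sup>2) - 0) < e" by blast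
  qed
  with h that show ?thesis by blast
qed

lemma L2_limit_norm:
  fixes f :: "nat \<Rightarrow> real^2 \<Rightarrow> 'b::euclidean_space"
  assumes f: "\<And>n. square_integrable_on S (f n)" "square_integrable_on S h"
    and lim: "(\<lambda>n. LINT x|lebesgue_on S. (norm (f n x - h x))\<^sup>2) \<longlonglongrightarrow> 0"
  shows "(\<lambda>n. LINT x|lebesgue_on S. (norm (f n x))\<^sup>2) \<longlonglongrightarrow> (LINT x|lebesgue_on S. (norm (h x))\<^sup>2)"
proof -
  have "(LINT x|lebesgue_on S. (norm (f n x))\<^sup>2) =
    (LINT x|lebesgue_on S. (norm (f n x - h x))\<^sup>2) + 2 * (LINT x|lebesgue_on S. f n x \<bullet> h x) - (LINT x|lebesgue_on S. (norm (h x))\<^sup>2)" for n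
    using integral_norm_lincomb[OF f(1)[of n] f(2), of 1 "-1"] by simp
  moreover have "(\<lambda>n. (LINT x|lebesgue_on S. (norm (f n x - h x))\<^sup>2) + 2 * (LINT x|lebesgue_on S. f n x \<bullet> h x) - (LINT x|lebesgue_on S. (norm (h x))\<^sup>2))
    \<longlonglongrightarrow> 0 + 2 * (LINT x|lebesgue_on S. h x \<bullet> h x) - (LINT x|lebesgue_on S. (norm (h x))\<^sup>2)"
    by (intro tendsto_intros lim L2_limit_inner[OF f f(2) lim])
  ultimately show ?thesis by (simp add: power2_norm_eq_inner)
qed

text \<open>The direct method. A minimising sequence has an L2 Cauchy subsequence by the gap
  property, and the parallelogram law makes its gradients Cauchy as well, so that the limit lies in
  the Sobolev space and attains the infimum. The given u0 makes the set of competitors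
  nonempty.\<close>

lemma exists_Rayleigh_minimizer:
  assumes S: "S \<in> lmeasurable" and gap: "\<And>\<epsilon>. \<epsilon> > 0 \<Longrightarrow> finite_rank_gap S \<epsilon>"
    and H0: "has_H1_gradient S u0 g0" "(LINT x|lebesgue_on S. u0 x) = 0" "(LINT x|lebesgue_on S. (u0 x)\<^sup>2) > 0"
  obtains v h \<mu> where "has_H1_gradient S v h" "(LINT x|lebesgue_on S. v x) = 0" "(LINT x|lebesgue_on S. (v x)\<^sup>2) = 1"
    "\<mu> = (LINT x|lebesgue_on S. (norm (h x))\<^sup>2)"
    "\<And>u g. has_H1_gradient S u g \<Longrightarrow> (LINT x|lebesgue_on S. u x) = 0 \<Longrightarrow>
       \<mu> * (LINT x|lebesgue_on S. (u x)\<^sup>2) \<le> (LINT x|lebesgue_on S. (norm (g x))\<^sup>2)"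
proof -
  let ?M = "lebesgue_on S"
  define D where "D g = (LINT x|?M. (norm (g x))\<^sup>2)" for g :: "real^2 \<Rightarrow> real^2"
  define A where "A u = (LINT x|?M. (u x)\<^sup>2)" for u :: "real^2 \<Rightarrow> real"
  define I where "I u = (LINT x|?M. u x)" for u :: "real^2 \<Rightarrow> real"
  have Dn: "0 \<le> D g" for g by (simp add: D_def)
  have An: "0 \<le> A u" for u by (simp add: A_def)
  have scale: "has_H1_gradient S (\<lambda>x. c * u x) (\<lambda>x. c *\<^sub>R g x)" "D (\<lambda>x. c *\<^sub>R g x) = c\<^sup>2 * D g"
    "A (\<lambda>x. c * u x) = c\<^sup>2 * A u" "I (\<lambda>x. c * u x) = c * I u"
    if "has_H1_gradient S u g" for c u g
  proof -
    show "has_H1_gradient S (\<lambda>x. c * u x) (\<lambda>x. c *\<^sub>R g x)"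
      using has_H1_gradient_lincomb[OF that that S, of c 0] by simp
  qed (simp_all add: D_def A_def I_def power_mult_distrib)
  define E where "E = {D g | u g. has_H1_gradient S u g \<and> I u = 0 \<and> A u = 1}"
  define \<mu> where "\<mu> = Inf E"
  have E0: "D (\<lambda>x. (1 / sqrt (A u)) *\<^sub>R g x) \<in> E" if "has_H1_gradient S u g" "I u = 0" "A u > 0" for u g
  proof -
    let ?c = "1 / sqrt (A u)"
    have "I (\<lambda>x. ?c * u x) = 0" "A (\<lambda>x. ?c * u x) = 1"
      using scale(3,4)[OF that(1), of ?c] that(2,3) by (simp_all add: power_divide)
    with scale(1)[OF that(1), of ?c] show ?thesis unfolding E_def by blast
  qed
  have Ene: "E \<noteq> {}" using E0[OF H0(1)] H0 by (auto simp: A_def I_def)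
  have Ebd: "bdd_below E" using Dn by (auto simp: E_def bdd_below_def)
  have \<mu>0: "0 \<le> \<mu>" unfolding \<mu>_def using Dn by (intro cInf_greatest[OF Ene]) (auto simp: E_def)
  have low: "\<mu> * A u \<le> D g" if "has_H1_gradient S u g" "I u = 0" for u g
  proof (cases "A u = 0")
    case False
    then have pos: "A u > 0" using An[of u] by linarith
    have "\<mu> \<le> D (\<lambda>x. (1 / sqrt (A u)) *\<^sub>R g x)" unfolding \<mu>_def by (rule cInf_lower[OF E0[OF that pos] Ebd])
    also have "\<dots> = D g / A u" using scale(2)[OF that(1), of "1 / sqrt (A u)"] pos by (simp add: power_divide)
    finally show ?thesis using pos by (simp add: pos_le_divide_eq)
  qed (use Dn in simp)
  have "\<exists>p. has_H1_gradient S (fst p) (snd p) \<and> I (fst p) = 0 \<and> A (fst p) = 1 \<and> D (snd p) < \<mu> + 1 / real (Suc n)" for n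
  proof -
    have "\<exists>e\<in>E. e < \<mu> + 1 / real (Suc n)" unfolding \<mu>_def using Ene Ebd by (subst cInf_less_iff[symmetric]) auto
    then show ?thesis unfolding E_def by auto
  qed
  then have "\<forall>n. \<exists>p. has_H1_gradient S (fst p) (snd p) \<and> I (fst p) = 0 \<and> A (fst p) = 1 \<and> D (snd p) < \<mu> + 1 / real (Suc n)"
    by blast
  from choice[OF this] obtain p where p: "\<And>n. has_H1_gradient S (fst (p n)) (snd (p n)) \<and> I (fst (p n)) = 0 \<and> A (fst (p n)) = 1 \<and> D (snd (p n)) < \<mu> + 1 / real (Suc n)"
    by blast
  define u where "u n = fst (p n)" for n
  define g where "g n = snd (p n)" for n
  have ug: "\<And>n. has_H1_gradient S (u n) (g n)" "\<And>n. I (u n) = 0" "\<And>n. A (u n) = 1"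
    "\<And>n. D (g n) < \<mu> + 1 / real (Suc n)" using p by (simp_all add: u_def g_def)
  have bd: "A (u n) \<le> \<mu> + 1" "D (g n) \<le> \<mu> + 1" for n
  proof -
    have "1 / real (Suc n) \<le> 1" by simp
    then show "D (g n) \<le> \<mu> + 1" using ug(4)[of n] by linarith
    show "A (u n) \<le> \<mu> + 1" using ug(3)[of n] \<mu>0 by simp
  qed
  obtain r :: "nat \<Rightarrow> nat" where r: "strict_mono r"
    and rC: "\<And>e. e > 0 \<Longrightarrow> \<exists>N. \<forall>m\<ge>N. \<forall>n\<ge>N. (LINT x|?M. (u (r m) x - u (r n) x)\<^sup>2) < e"
    by (rule L2_Cauchy_subsequence[where u = u and g = g and K = "\<mu> + 1",
        OF gap S ug(1) bd(1)[unfolded A_def] bd(2)[unfolded D_def]]) blast+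
  define U where "U n = u (r n)" for n
  define G where "G n = g (r n)" for n
  have UG: "has_H1_gradient S (U n) (G n)" "I (U n) = 0" "A (U n) = 1" "D (G n) < \<mu> + 1 / real (Suc n)" for n
  proof -
    have "1 / real (Suc (r n)) \<le> 1 / real (Suc n)" using seq_suble[OF r, of n] by (simp add: frac_le)
    then show "D (G n) < \<mu> + 1 / real (Suc n)" using ug(4)[of "r n"] by (simp add: G_def)
  qed (use ug in \<open>auto simp: U_def G_def\<close>)
  note Us = has_H1_gradientD(1)[OF UG(1)] and Gs = has_H1_gradientD(2)[OF UG(1)]
  have UC: "\<exists>N. \<forall>m\<ge>N. \<forall>n\<ge>N. (LINT x|?M. (norm (U m x - U n x))\<^sup>2) < e" if "e > 0" for e
    using rC[OF that] by (simp add: U_def)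
  \<comment> \<open>The sum of two members again has mean zero, so its Dirichlet integral is at
    least \<mu> (4 - A), where A is the squared norm of the difference. The parallelogram law
    subtracts this from 2 D(G m) + 2 D(G n), which is below 4 \<mu> plus the two small fractions,
    and the terms 4 \<mu> cancel.\<close>
  have par: "D (\<lambda>x. G m x - G n x) \<le> 2 / real (Suc m) + 2 / real (Suc n) + \<mu> * A (\<lambda>x. U m x - U n x)" for m n
  proof -
    have Hs: "has_H1_gradient S (\<lambda>x. U m x + U n x) (\<lambda>x. G m x + G n x)"
      using has_H1_gradient_lincomb[OF UG(1)[of m] UG(1)[of n] S, of 1 1] by simp
    have "I (\<lambda>x. U m x + U n x) = 0"
      using UG(2)[of m] UG(2)[of n] square_integrable_on_real(3)[OF Us S] by (simp add: I_def)
    from low[OF Hs this] have 1: "\<mu> * A (\<lambda>x. U m x + U n x) \<le> D (\<lambda>x. G m x + G n x)" .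
    have 2: "D (\<lambda>x. G m x - G n x) + D (\<lambda>x. G m x + G n x) = 2 * D (G m) + 2 * D (G n)"
      using integral_norm_lincomb[OF Gs[of m] Gs[of n], of 1 1] integral_norm_lincomb[OF Gs[of m] Gs[of n], of 1 "-1"]
      by (simp add: D_def)
    have 3: "A (\<lambda>x. U m x - U n x) + A (\<lambda>x. U m x + U n x) = 4"
      using integral_norm_lincomb[OF Us[of m] Us[of n], of 1 1] integral_norm_lincomb[OF Us[of m] Us[of n], of 1 "-1"]
        UG(3)[of m] UG(3)[of n] by (simp add: A_def)
    have "\<mu> * A (\<lambda>x. U m x + U n x) = 4 * \<mu> - \<mu> * A (\<lambda>x. U m x - U n x)"
      using arg_cong[OF 3, of "\<lambda>t. \<mu> * t"] by (simp add: algebra_simps)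
    then show ?thesis using 1 2 UG(4)[of m] UG(4)[of n] by linarith
  qed
  have GC: "\<exists>N. \<forall>m\<ge>N. \<forall>n\<ge>N. (LINT x|?M. (norm (G m x - G n x))\<^sup>2) < e" if e: "e > 0" for e
  proof -
    obtain N1 where N1: "\<And>m n. m \<ge> N1 \<Longrightarrow> n \<ge> N1 \<Longrightarrow> A (\<lambda>x. U m x - U n x) < e / (2 * (\<mu> + 1))"
      using UC[of "e / (2 * (\<mu> + 1))"] e \<mu>0 by (auto simp: A_def)
    obtain N2 where N2: "1 / real (Suc N2) < e / 8" using nat_approx_posE[of "e / 8"] e by auto
    have "D (\<lambda>x. G m x - G n x) < e" if "m \<ge> max N1 N2" "n \<ge> max N1 N2" for m n
    proof -
      have "1 / real (Suc m) \<le> 1 / real (Suc N2)" "1 / real (Suc n) \<le> 1 / real (Suc N2)"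
        using that by (auto simp: frac_le)
      moreover have "\<mu> * A (\<lambda>x. U m x - U n x) \<le> e / 2"
      proof -
        have "\<mu> * A (\<lambda>x. U m x - U n x) \<le> (\<mu> + 1) * (e / (2 * (\<mu> + 1)))"
          using N1[of m n] that \<mu>0 An by (intro mult_mono) auto
        also have "\<dots> = e / 2" using \<mu>0 by (simp add: field_simps)
        finally show ?thesis .
      qed
      moreover have "2 / real (Suc k) = 2 * (1 / real (Suc k))" for k by simp
      ultimately show ?thesis using par[of m n] N2 by linarith
    qed
    then show ?thesis unfolding D_def by blast
  qed
  obtain v where v: "square_integrable_on S v" and vl: "(\<lambda>n. LINT x|?M. (norm (U n x - v x))\<^sup>2) \<longlonglongrightarrow> 0"
    by (rule L2_complete[where f = U, OF S Us UC])
  obtain h where h: "square_integrable_on S h" and hl: "(\<lambda>n. LINT x|?M. (norm (G n x - h x))\<^sup>2) \<longlonglongrightarrow> 0"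
    by (rule L2_complete[where f = G, OF S Gs GC])
  have Hv: "has_H1_gradient S v h"
    by (rule has_H1_gradient_L2_limit[OF UG(1) S v h _ hl]) (use vl in simp)
  have one: "square_integrable_on S (\<lambda>x. 1 :: real)"
    by (rule square_integrable_onI_bounded[OF S, where B = 1]) auto
  have "(\<lambda>n. I (U n)) \<longlonglongrightarrow> I v"
    using L2_limit_inner[OF Us v one vl] by (simp add: I_def)
  then have Iv: "I v = 0" using UG(2) by (simp add: LIMSEQ_const_iff)
  have "(\<lambda>n. A (U n)) \<longlonglongrightarrow> A v"
    using L2_limit_norm[OF Us v vl] by (simp add: A_def)
  then have Av: "A v = 1" using UG(3) by (simp add: LIMSEQ_const_iff)
  have Dl: "(\<lambda>n. D (G n)) \<longlonglongrightarrow> D h"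
    using L2_limit_norm[OF Gs h hl] by (simp add: D_def)
  have "(\<lambda>n. \<mu> + inverse (real (Suc n))) \<longlonglongrightarrow> \<mu> + 0"
    by (intro tendsto_intros LIMSEQ_inverse_real_of_nat)
  then have "D h \<le> \<mu>"
    by (intro LIMSEQ_le[OF Dl]) (use UG(4) in \<open>auto simp: inverse_eq_divide intro!: exI[of _ 0] less_imp_le\<close>)
  moreover have "\<mu> \<le> D h" using low[OF Hv Iv] Av by simp
  ultimately have "\<mu> = D h" by simp
  then show ?thesis
    by (intro that[OF Hv Iv[unfolded I_def] Av[unfolded A_def] _ low[unfolded I_def A_def D_def]])
      (auto simp: D_def)
qed

section \<open>Functions of class C^1 as elements of the Sobolev space\<close>

lemma has_derivative_pair_vec:
  "((\<lambda>t. pair_vec (t, y)) has_derivative (\<lambda>h. h *\<^sub>R axis 1 1)) (at t)"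
  "((\<lambda>t. pair_vec (x, t)) has_derivative (\<lambda>h. h *\<^sub>R axis 2 1)) (at t)"
proof -
  have 1: "(\<lambda>t. pair_vec (t, y)) = (\<lambda>t. t *\<^sub>R axis 1 1 + pair_vec (0, y))"
    "(\<lambda>t. pair_vec (x, t)) = (\<lambda>t. t *\<^sub>R axis 2 1 + pair_vec (x, 0))"
    by (auto simp: fun_eq_iff vec_eq_iff forall_2 axis_def)
  show "((\<lambda>t. pair_vec (t, y)) has_derivative (\<lambda>h. h *\<^sub>R axis 1 1)) (at t)"
    "((\<lambda>t. pair_vec (x, t)) has_derivative (\<lambda>h. h *\<^sub>R axis 2 1)) (at t)"
    unfolding 1 by (auto intro!: derivative_eq_intros)
qed

lemma integral_derivative_compact_support:
  fixes f :: "real \<Rightarrow> real"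
  assumes D: "\<And>t. (f has_real_derivative f' t) (at t)" and cont: "continuous_on UNIV f'"
    and zero: "\<And>t. \<bar>t\<bar> > B \<Longrightarrow> f t = 0" "\<And>t. \<bar>t\<bar> > B \<Longrightarrow> f' t = 0" and B: "B \<ge> 0"
  shows "(LINT t|lborel. f' t) = 0"
proof -
  have "(LINT t|lborel. f' t) = (LINT t|lborel. f' t * indicator {- (B + 1)..B + 1} t)"
  proof (rule Bochner_Integration.integral_cong)
    fix t show "f' t = f' t * indicator {- (B + 1)..B + 1} t"
      using zero(2)[of t] by (cases "t \<in> {- (B + 1)..B + 1}") auto
  qed simp
  also have "\<dots> = f (B + 1) - f (- (B + 1))"
    by (rule integral_FTC_Icc_real) (use D cont B in \<open>auto simp: continuous_on_eq_continuous_at\<close>)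
  also have "\<dots> = 0" using zero(1)[of "B + 1"] zero(1)[of "- (B + 1)"] B by simp
  finally show ?thesis .
qed

text \<open>Fubini with the inner integral in the direction of differentiation, where the
  fundamental theorem of calculus gives zero.\<close>

lemma integral_partial_derivative_compact_support:
  fixes f :: "real^2 \<Rightarrow> real" and i :: 2
  assumes D: "\<And>x. (f has_derivative f' x) (at x)" and cont: "continuous_on UNIV (\<lambda>x. f' x (axis i 1))"
    and zero: "\<And>x j. \<bar>x $ j\<bar> > B \<Longrightarrow> f x = 0" "\<And>x j. \<bar>x $ j\<bar> > B \<Longrightarrow> f' x (axis i 1) = 0" and B: "B \<ge> 0"
  shows "(LINT x|lborel. f' x (axis i 1)) = 0"
proof -
  let ?F = "\<lambda>x. f' x (axis i 1)"
  have [measurable]: "?F \<in> borel_measurable borel" using cont by (rule borel_measurable_continuous_onI)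
  have cpv: "continuous_on UNIV pair_vec"
    using continuous_on_pair_vec[OF continuous_on_fst continuous_on_snd, OF continuous_on_id continuous_on_id] by simp
  have cF: "continuous_on UNIV (\<lambda>z. ?F (pair_vec z))"
    by (rule continuous_on_compose2[OF cont cpv]) auto
  have "integrable lborel (\<lambda>z. indicator (cbox (-B, -B) (B, B)) z *\<^sub>R ?F (pair_vec z))"
    by (rule borel_integrable_compact) (use cF in \<open>auto intro: continuous_on_subset\<close>)
  moreover have "(\<lambda>z. indicator (cbox (-B, -B) (B, B)) z *\<^sub>R ?F (pair_vec z)) = (\<lambda>z. ?F (pair_vec z))"
  proof
    fix z :: "real \<times> real"
    show "indicator (cbox (-B, -B) (B, B)) z *\<^sub>R ?F (pair_vec z) = ?F (pair_vec z)"
    proof (cases "z \<in> cbox (-B, -B) (B, B)")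
      case False
      then have "\<bar>fst z\<bar> > B \<or> \<bar>snd z\<bar> > B"
        by (cases z) (auto simp: cbox_Pair_eq abs_le_iff not_le)
      then show ?thesis using zero(2)[of "pair_vec z" 1] zero(2)[of "pair_vec z" 2] by auto
    qed simp
  qed
  ultimately have int: "integrable (lborel \<Otimes>\<^sub>M lborel) (\<lambda>(x, y). ?F (pair_vec (x, y)))"
    by (simp add: lborel_prod case_prod_unfold)
  have "(LINT x|lborel. ?F x) = (LINT z|(lborel \<Otimes>\<^sub>M lborel). ?F (pair_vec z))"
    by (rule integral_pair_vec) measurable
  also have "\<dots> = 0"
  proof (cases "i = 1")
    case True
    have "(LINT x|lborel. ?F (pair_vec (x, y))) = 0" for y
    proof (rule integral_derivative_compact_support[OF _ _ _ _ B])
      show "((\<lambda>t. f (pair_vec (t, y))) has_real_derivative ?F (pair_vec (t, y))) (at t)" for t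
        using has_derivative_compose[OF has_derivative_pair_vec(1) D, of y t] linear_simps(5)[OF has_derivative_bounded_linear[OF D]] True
        by (simp add: has_field_derivative_def mult_commute_abs)
      show "continuous_on UNIV (\<lambda>t. ?F (pair_vec (t, y)))"
        by (rule continuous_on_compose2[OF cF]) (auto intro!: continuous_intros)
    qed (use zero[of _ 1] in auto)
    then show ?thesis using lborel_pair.integral_snd[OF int] by (simp add: case_prod_unfold)
  next
    case False
    then have i: "i = 2" using exhaust_2 by blast
    have "(LINT y|lborel. ?F (pair_vec (x, y))) = 0" for x
    proof (rule integral_derivative_compact_support[OF _ _ _ _ B])
      show "((\<lambda>t. f (pair_vec (x, t))) has_real_derivative ?F (pair_vec (x, t))) (at t)" for t
        using has_derivative_compose[OF has_derivative_pair_vec(2) D, of x t] linear_simps(5)[OF has_derivative_bounded_linear[OF D]] i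
        by (simp add: has_field_derivative_def mult_commute_abs)
      show "continuous_on UNIV (\<lambda>t. ?F (pair_vec (x, t)))"
        by (rule continuous_on_compose2[OF cF]) (auto intro!: continuous_intros)
    qed (use zero[of _ 2] in auto)
    then show ?thesis using lborel_pair.integral_fst[OF int] by (simp add: case_prod_unfold)
  qed
  finally show ?thesis .
qed

lemma continuous_bounded_on_bounded:
  fixes f :: "real^2 \<Rightarrow> 'b::euclidean_space"
  assumes "continuous_on UNIV f" "bounded S"
  obtains B where "\<And>x. x \<in> S \<Longrightarrow> norm (f x) \<le> B"
proof -
  have "compact (f ` closure S)"
    using assms by (intro compact_continuous_image) (auto intro: continuous_on_subset)
  then obtain B where "\<forall>y \<in> f ` closure S. norm y \<le> B"
    using compact_imp_bounded bounded_iff by metis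
  then show ?thesis using that[of B] closure_subset[of S] by blast
qed

text \<open>The product of v with a test function has compact support, so its partial derivatives
  integrate to zero over the plane; the product rule turns this into the weak identity.\<close>

lemma has_H1_gradient_C1:
  fixes v :: "real^2 \<Rightarrow> real"
  assumes D: "\<And>x. (v has_derivative (\<lambda>h. G x \<bullet> h)) (at x)" and G: "continuous_on UNIV G"
    and S: "S \<in> lmeasurable" "bounded S"
  shows "has_H1_gradient S v G"
  unfolding has_H1_gradient_def
proof (intro conjI allI impI)
  have v: "continuous_on UNIV v"
    using D by (auto intro!: continuous_at_imp_continuous_on has_derivative_continuous)
  obtain B1 where "\<And>x. x \<in> S \<Longrightarrow> norm (v x) \<le> B1" by (rule continuous_bounded_on_bounded[OF v S(2)]) blast
  then show vs: "square_integrable_on S v"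
    by (rule square_integrable_onI_bounded[OF S(1) continuous_lebesgue_measurable[OF v]])
  obtain B2 where "\<And>x. x \<in> S \<Longrightarrow> norm (G x) \<le> B2" by (rule continuous_bounded_on_bounded[OF G S(2)]) blast
  then show Gs: "square_integrable_on S G"
    by (rule square_integrable_onI_bounded[OF S(1) continuous_lebesgue_measurable[OF G]])
  fix \<phi> i assume T: "test_function S \<phi>"
  note t = test_function_square_integrable[OF T S(1)]
  let ?f = "\<lambda>x. v x * \<phi> x"
  let ?F = "\<lambda>x. v x * partial_deriv i \<phi> x + G x $ i * \<phi> x"
  have d: "\<phi> differentiable (at x)" for x
  proof -
    have "continuously_differentiable (Suc 0) \<phi>" using T unfolding test_function_def by blast
    then show ?thesis by (auto simp: differentiable_on_def)
  qed
  have D': "(?f has_derivative (\<lambda>h. v x * frechet_derivative \<phi> (at x) h + (G x \<bullet> h) * \<phi> x)) (at x)" for x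
    by (rule has_derivative_mult[OF D has_derivative_partial[OF d]])
  have eq: "v x * frechet_derivative \<phi> (at x) (axis i 1) + (G x \<bullet> axis i 1) * \<phi> x = ?F x" for x
    by (simp add: partial_deriv_def inner_axis)
  have cont: "continuous_on UNIV ?F"
    using v G test_function_continuous[OF T] by (intro continuous_intros) auto
  obtain B where B: "B > 0" "\<And>x. x \<in> S \<Longrightarrow> norm x \<le> B" using S(2) by (auto simp: bounded_pos)
  have out: "\<phi> x = 0" "partial_deriv i \<phi> x = 0" if "\<bar>x $ j\<bar> > B" for x j
  proof -
    have "x \<notin> S" using B(2)[of x] component_le_norm_cart[of x j] that by force
    then show "\<phi> x = 0" "partial_deriv i \<phi> x = 0" using test_function_outside[OF T] by auto
  qed
  have "(LINT x|lborel. ?F x) = 0"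
    using integral_partial_derivative_compact_support[OF D', of i B] cont out B(1) unfolding eq by auto
  moreover have "(LINT x|lborel. ?F x) = (LINT x|lebesgue_on S. ?F x)"
  proof -
    have SS: "S \<in> sets lebesgue" using S by (simp add: fmeasurableD)
    have "(LINT x|lborel. ?F x) = (LINT x|lebesgue. ?F x)"
      using borel_measurable_continuous_onI[OF cont] by (subst integral_completion) auto
    also have "\<dots> = (LINT x|lebesgue. indicator S x *\<^sub>R ?F x)"
    proof (rule Bochner_Integration.integral_cong)
      fix x show "?F x = indicator S x *\<^sub>R ?F x"
        using test_function_outside[OF T, of x] by (cases "x \<in> S") auto
    qed simp
    also have "\<dots> = (LINT x|lebesgue_on S. ?F x)" using SS by (subst integral_restrict_space) auto
    finally show ?thesis .
  qed
  moreover have "(LINT x|lebesgue_on S. ?F x) = (LINT x|lebesgue_on S. v x * partial_deriv i \<phi> x) + (LINT x|lebesgue_on S. G x $ i * \<phi> x)"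
    by (rule Bochner_Integration.integral_add[OF square_integrable_on_inner(1)[OF vs t(2), unfolded inner_real_def]
          square_integrable_on_inner(1)[OF square_integrable_on_component'[OF Gs] t(1), unfolded inner_real_def]])
  ultimately show "(LINT x|lebesgue_on S. v x * partial_deriv i \<phi> x) = - (LINT x|lebesgue_on S. G x $ i * \<phi> x)"
    by linarith
qed

lemma has_H1_gradient_const: "S \<in> lmeasurable \<Longrightarrow> bounded S \<Longrightarrow> has_H1_gradient S (\<lambda>x. c) (\<lambda>x. 0)"
  by (rule has_H1_gradient_C1) auto

section \<open>The Euler-Lagrange equation of the minimiser\<close>

lemma linear_term_zero:
  fixes X Y :: real
  assumes "\<And>t. 0 \<le> 2 * t * X + t\<^sup>2 * Y"
  shows "X = 0"
proof (rule ccontr)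
  assume "X \<noteq> 0"
  \<comment> \<open>For this t the quadratic term is at most - t X, so the whole expression is at
    most t X, which is negative.\<close>
  define t where "t = - X / (\<bar>Y\<bar> + 1)"
  have "t\<^sup>2 * Y \<le> t\<^sup>2 * (\<bar>Y\<bar> + 1)" by (intro mult_left_mono) auto
  also have "\<dots> = t * (t * (\<bar>Y\<bar> + 1))" by (simp add: power2_eq_square mult.assoc)
  also have "t * (\<bar>Y\<bar> + 1) = - X" by (simp add: t_def)
  also have "t * - X = - t * X" by simp
  finally have "2 * t * X + t\<^sup>2 * Y \<le> t * X" by linarith
  moreover have "t * X < 0"
    unfolding t_def using \<open>X \<noteq> 0\<close> by (simp add: power2_eq_square[symmetric] divide_neg_pos)
  ultimately show False using assms[of t] by linarith
qed

text \<open>v is perturbed by t (w - c), where c is the mean of w, so that the competitor keeps mean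
  zero. Minimality yields a nonnegative quadratic in t without constant term, so its linear
  coefficient vanishes. Subtracting c changes neither the gradient of w nor, since v has mean zero,
  the integral of v w.\<close>

lemma Rayleigh_minimizer_eigenfunction:
  assumes S: "S \<in> lmeasurable" "bounded S" "measure lebesgue S > 0"
    and v: "has_H1_gradient S v h" "(LINT x|lebesgue_on S. v x) = 0" "(LINT x|lebesgue_on S. (v x)\<^sup>2) = 1"
    and \<mu>: "\<mu> = (LINT x|lebesgue_on S. (norm (h x))\<^sup>2)"
    and low: "\<And>u g. has_H1_gradient S u g \<Longrightarrow> (LINT x|lebesgue_on S. u x) = 0 \<Longrightarrow>
       \<mu> * (LINT x|lebesgue_on S. (u x)\<^sup>2) \<le> (LINT x|lebesgue_on S. (norm (g x))\<^sup>2)"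
  shows "v \<in> neumann_eigenspace S \<mu>"
  unfolding neumann_eigenspace_def
proof (intro CollectI exI[of _ h] conjI allI impI v(1))
  fix w k assume w: "has_H1_gradient S w k"
  define c where "c = (LINT x|lebesgue_on S. w x) / measure lebesgue S"
  have w0: "has_H1_gradient S (\<lambda>x. w x - c) k"
    using has_H1_gradient_lincomb[OF w has_H1_gradient_const[OF S(1,2), of c] S(1), of 1 "-1"] by simp
  note vs = has_H1_gradientD(1)[OF v(1)] and hs = has_H1_gradientD(2)[OF v(1)]
    and ws = has_H1_gradientD(1)[OF w0] and ks = has_H1_gradientD(2)[OF w0]
  have wi: "integrable (lebesgue_on S) w" and vi: "integrable (lebesgue_on S) v" 
    and w0i: "integrable (lebesgue_on S) (\<lambda>x. w x - c)"
    using square_integrable_on_real(3) has_H1_gradientD(1) w v w0 S(1) by blast+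
  have one: "square_integrable_on S (\<lambda>x. 1 :: real)"
    by (rule square_integrable_onI_bounded[OF S(1), where B = 1]) auto
  interpret finite_measure "lebesgue_on S" by (rule finite_measure_lebesgue_on[OF S(1)])
  have w0m: "(LINT x|lebesgue_on S. w x - c) = 0"
    using wi S by (simp add: c_def measure_lebesgue_on_space fmeasurableD)
  let ?Y = "LINT x|lebesgue_on S. (norm (k x))\<^sup>2" and ?Z = "LINT x|lebesgue_on S. (w x - c)\<^sup>2"
  let ?hk = "LINT x|lebesgue_on S. h x \<bullet> k x" and ?vw = "LINT x|lebesgue_on S. v x * (w x - c)"
  have "?hk - \<mu> * ?vw = 0"
  proof (rule linear_term_zero)
    fix t :: real
    have "has_H1_gradient S (\<lambda>x. 1 * v x + t * (w x - c)) (\<lambda>x. 1 *\<^sub>R h x + t *\<^sub>R k x)"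
      by (rule has_H1_gradient_lincomb[OF v(1) w0 S(1)])
    moreover have "(LINT x|lebesgue_on S. 1 * v x + t * (w x - c)) = 0"
      using vi w0i v(2) w0m by (simp only: Bochner_Integration.integral_add integrable_mult_right integral_mult_right_zero)
    ultimately have "\<mu> * (LINT x|lebesgue_on S. (1 * v x + t * (w x - c))\<^sup>2) \<le> (LINT x|lebesgue_on S. (norm (1 *\<^sub>R h x + t *\<^sub>R k x))\<^sup>2)"
      by (rule low)
    moreover have "(LINT x|lebesgue_on S. (1 * v x + t * (w x - c))\<^sup>2) = 1 + 2 * t * ?vw + t\<^sup>2 * ?Z"
      using integral_norm_lincomb[OF vs ws, of 1 t] v(3) by simp
    moreover have "(LINT x|lebesgue_on S. (norm (1 *\<^sub>R h x + t *\<^sub>R k x))\<^sup>2) = \<mu> + 2 * t * ?hk + t\<^sup>2 * ?Y"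
      using integral_norm_lincomb[OF hs ks, of 1 t] \<mu> by simp
    ultimately have "\<mu> * (1 + 2 * t * ?vw + t\<^sup>2 * ?Z) \<le> \<mu> + 2 * t * ?hk + t\<^sup>2 * ?Y" by simp
    then show "0 \<le> 2 * t * (?hk - \<mu> * ?vw) + t\<^sup>2 * (?Y - \<mu> * ?Z)" by (simp add: algebra_simps)
  qed
  moreover have "?vw = (LINT x|lebesgue_on S. v x * w x)"
  proof -
    have "integrable (lebesgue_on S) (\<lambda>x. v x * w x)"
      using square_integrable_on_inner(1)[OF vs has_H1_gradientD(1)[OF w]] by simp
    then have "?vw = (LINT x|lebesgue_on S. v x * w x) - c * (LINT x|lebesgue_on S. v x)"
      using vi by (simp add: right_diff_distrib mult.commute[of _ c])
    then show ?thesis using v(2) by simp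
  qed
  ultimately show "(LINT x|lebesgue_on S. h x \<bullet> k x) = \<mu> * (LINT x|lebesgue_on S. v x * w x)" by simp
qed

section \<open>Counting eigenvalues with multiplicity\<close>

lemma AE_lebesgue_on_zero_iff:
  fixes f :: "real^2 \<Rightarrow> real"
  assumes "square_integrable_on S f"
  shows "(AE x in lebesgue_on S. f x = 0) \<longleftrightarrow> (LINT x|lebesgue_on S. (f x)\<^sup>2) = 0"
  using integral_nonneg_eq_0_iff_AE[OF square_integrable_on_real(1)[OF assms]] by simp

lemma not_AE_lebesgue_on_False:
  assumes "S \<in> lmeasurable" "measure lebesgue S > 0" "AE x in lebesgue_on S. False"
  shows False
proof -
  interpret finite_measure "lebesgue_on S" by (rule finite_measure_lebesgue_on[OF assms(1)])
  have "(LINT x|lebesgue_on S. 1 :: real) = 0"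
    by (rule integral_eq_zero_AE) (use assms(3) in eventually_elim, simp)
  then show False using assms(1,2) by (simp add: measure_lebesgue_on_space fmeasurableD)
qed

lemma neumann_multiplicity_ge:
  assumes "\<forall>i<n. \<phi> i \<in> neumann_eigenspace S \<mu>" "independent_ae S n \<phi>"
  shows "enat n \<le> neumann_multiplicity S \<mu>"
  unfolding neumann_multiplicity_def using assms by (intro SUP_upper) auto

lemma neumann_multiplicity_le_counting:
  assumes "finite M" "M \<subseteq> {..a}"
  shows "(\<Sum>\<mu>\<in>M. neumann_multiplicity S \<mu>) \<le> neumann_counting S a"
  unfolding neumann_counting_def using assms by (intro SUP_upper) auto

lemma neumann_eigenspace_square_integrable:
  "\<psi> \<in> neumann_eigenspace S \<mu> \<Longrightarrow> square_integrable_on S \<psi>"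
  by (auto simp: neumann_eigenspace_def dest: has_H1_gradientD(1))

text \<open>An eigenfunction tested against itself has a Dirichlet integral equal to \<mu> times its
  squared norm, so there is none for \<mu> < 0. This bounds from below the set whose infimum is the
  second eigenvalue.\<close>

lemma neumann_counting_negative:
  assumes "a < 0" shows "neumann_counting S a = 0"
proof -
  have "neumann_multiplicity S \<mu> = 0" if "\<mu> < 0" for \<mu>
  proof -
    have "n = 0" if \<phi>: "\<forall>i<n. \<phi> i \<in> neumann_eigenspace S \<mu>" "independent_ae S n \<phi>" for n \<phi>
    proof (rule ccontr)
      assume n: "n \<noteq> 0"
      then have "\<phi> 0 \<in> neumann_eigenspace S \<mu>" using \<phi> by auto
      then obtain g where g: "has_H1_gradient S (\<phi> 0) g"
        "(LINT x|lebesgue_on S. g x \<bullet> g x) = \<mu> * (LINT x|lebesgue_on S. \<phi> 0 x * \<phi> 0 x)"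
        unfolding neumann_eigenspace_def by blast
      have "0 \<le> (LINT x|lebesgue_on S. g x \<bullet> g x)" by simp
      moreover have "0 \<le> (LINT x|lebesgue_on S. (\<phi> 0 x)\<^sup>2)" by simp
      ultimately have "(LINT x|lebesgue_on S. (\<phi> 0 x)\<^sup>2) = 0"
        using g(2) \<open>\<mu> < 0\<close> unfolding power2_eq_square by (metis antisym mult_neg_pos not_less_iff_gr_or_eq not_le)
      then have ae: "AE x in lebesgue_on S. \<phi> 0 x = 0"
        using AE_lebesgue_on_zero_iff[OF has_H1_gradientD(1)[OF g(1)]] by blast
      let ?c = "\<lambda>i. if i = 0 then 1 else 0 :: real"
      have "(\<Sum>i<n. ?c i * \<phi> i x) = \<phi> 0 x" for x
      proof -
        have "(\<Sum>i<n. ?c i * \<phi> i x) = (\<Sum>i<n. if i = 0 then \<phi> 0 x else 0)" by (rule sum.cong) auto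
        also have "\<dots> = \<phi> 0 x" using n by (simp add: sum.delta)
        finally show ?thesis .
      qed
      then have "AE x in lebesgue_on S. (\<Sum>i<n. ?c i * \<phi> i x) = 0" using ae by simp
      with \<phi>(2)[unfolded independent_ae_def, rule_format, of ?c 0] n show False by simp
    qed
    then have "neumann_multiplicity S \<mu> \<le> 0"
      unfolding neumann_multiplicity_def by (intro SUP_least) (auto simp: zero_enat_def)
    then show ?thesis by simp
  qed
  then have "(\<Sum>\<mu>\<in>M. neumann_multiplicity S \<mu>) = 0" if "M \<subseteq> {..a}" for M
    using that assms by (intro sum.neutral) (auto simp: subset_iff)
  then have "neumann_counting S a \<le> 0"
    unfolding neumann_counting_def by (intro SUP_least) auto
  then show ?thesis by simp
qed

text \<open>The constants contribute one at 0, and v contributes one at \<mu>. If \<mu> = 0, both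
  lie in the same eigenspace, and there they are independent because v has mean zero without
  vanishing.\<close>

lemma neumann_counting_ge_2:
  assumes S: "S \<in> lmeasurable" "bounded S" "measure lebesgue S > 0"
    and v: "v \<in> neumann_eigenspace S \<mu>" "(LINT x|lebesgue_on S. v x) = 0" "(LINT x|lebesgue_on S. (v x)\<^sup>2) = 1"
    and \<mu>: "0 \<le> \<mu>"
  shows "enat 2 \<le> neumann_counting S \<mu>"
proof -
  interpret finite_measure "lebesgue_on S" by (rule finite_measure_lebesgue_on[OF S(1)])
  have const: "(\<lambda>x. 1) \<in> neumann_eigenspace S 0"
    unfolding neumann_eigenspace_def using has_H1_gradient_const[OF S(1,2), of 1]
    by (auto intro!: exI[of _ "\<lambda>x. 0"])
  have vs: "square_integrable_on S v" using v(1) by (rule neumann_eigenspace_square_integrable)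
  have vi: "integrable (lebesgue_on S) v" using square_integrable_on_real(3)[OF vs S(1)] .
  have v0: "\<not> (AE x in lebesgue_on S. v x = 0)" using AE_lebesgue_on_zero_iff[OF vs] v(3) by simp
  have ind1: "independent_ae S 1 (\<lambda>i. f)" if "\<not> (AE x in lebesgue_on S. f x = 0)" for f
    unfolding independent_ae_def
  proof (intro allI impI)
    fix c :: "nat \<Rightarrow> real" and i :: nat
    assume ae: "AE x in lebesgue_on S. (\<Sum>i<1. c i * f x) = 0" and i: "i < 1"
    show "c i = 0"
    proof (rule ccontr)
      assume "c i \<noteq> 0"
      with ae i have "AE x in lebesgue_on S. f x = 0" by simp
      with that show False by blast
    qed
  qed
  have one: "\<not> (AE x in lebesgue_on S. (1::real) = 0)"
    using not_AE_lebesgue_on_False[OF S(1,3)] by auto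
  show ?thesis
  proof (cases "\<mu> = 0")
    case True
    let ?\<phi> = "\<lambda>i::nat. if i = 0 then \<lambda>x. 1 else v"
    have "enat 2 \<le> neumann_multiplicity S \<mu>"
    proof (rule neumann_multiplicity_ge)
      show "\<forall>i<2. ?\<phi> i \<in> neumann_eigenspace S \<mu>" using const v True by auto
      show "independent_ae S 2 ?\<phi>"
        unfolding independent_ae_def
      proof (intro allI impI)
        fix c :: "nat \<Rightarrow> real" and i :: nat
        assume "AE x in lebesgue_on S. (\<Sum>i<2. c i * ?\<phi> i x) = 0" and i: "i < 2"
        then have ae: "AE x in lebesgue_on S. c 0 + c 1 * v x = 0" by (simp add: numeral_2_eq_2)
        have "(LINT x|lebesgue_on S. c 0 + c 1 * v x) = 0" by (rule integral_eq_zero_AE[OF ae])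
        moreover have "(LINT x|lebesgue_on S. c 0 + c 1 * v x) = c 0 * measure lebesgue S"
          using vi v(2) S(1) by (simp add: measure_lebesgue_on_space fmeasurableD)
        ultimately have c0: "c 0 = 0" using S(3) by simp
        have "c 1 = 0"
        proof (rule ccontr)
          assume "c 1 \<noteq> 0"
          with ae c0 have "AE x in lebesgue_on S. v x = 0" by simp
          with v0 show False by blast
        qed
        with c0 i show "c i = 0" by (auto simp: less_2_cases_iff)
      qed
    qed
    also have "\<dots> \<le> neumann_counting S \<mu>"
      using neumann_multiplicity_le_counting[of "{\<mu>}" \<mu> S] by simp
    finally show ?thesis .
  next
    case False
    have "enat 1 \<le> neumann_multiplicity S 0"
      by (rule neumann_multiplicity_ge[OF _ ind1[OF one]]) (use const in auto)
    moreover have "enat 1 \<le> neumann_multiplicity S \<mu>"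
      by (rule neumann_multiplicity_ge[OF _ ind1[OF v0]]) (use v in auto)
    ultimately have "enat 1 + enat 1 \<le> neumann_multiplicity S 0 + neumann_multiplicity S \<mu>"
      by (rule add_mono)
    also have "\<dots> = (\<Sum>\<mu>\<in>{0, \<mu>}. neumann_multiplicity S \<mu>)"
      using False by simp
    also have "\<dots> \<le> neumann_counting S \<mu>"
      by (rule neumann_multiplicity_le_counting) (use \<mu> in auto)
    finally show ?thesis by (simp add: one_enat_def numeral_2_eq_2)
  qed
qed

text \<open>The Rayleigh minimiser is an eigenfunction, so its \<mu> belongs to the set whose
  infimum defines the second eigenvalue. That set is bounded below by 0, hence the infimum is at
  most \<mu>, which in turn is at most the quotient of u.\<close>

lemma neumann_eigenvalue_2_le:
  assumes S: "S \<in> lmeasurable" "bounded S" "measure lebesgue S > 0"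
    and gap: "\<And>\<epsilon>. \<epsilon> > 0 \<Longrightarrow> finite_rank_gap S \<epsilon>"
    and u: "has_H1_gradient S u g" "(LINT x|lebesgue_on S. u x) = 0"
  shows "neumann_eigenvalue S 2 * (LINT x|lebesgue_on S. (u x)\<^sup>2) \<le> (LINT x|lebesgue_on S. (norm (g x))\<^sup>2)"
proof (cases "(LINT x|lebesgue_on S. (u x)\<^sup>2) > 0")
  case False
  moreover have "0 \<le> (LINT x|lebesgue_on S. (u x)\<^sup>2)" by simp
  ultimately have "(LINT x|lebesgue_on S. (u x)\<^sup>2) = 0" by linarith
  then show ?thesis by simp
next
  case True
  obtain v h \<mu> where v: "has_H1_gradient S v h" "(LINT x|lebesgue_on S. v x) = 0" "(LINT x|lebesgue_on S. (v x)\<^sup>2) = 1"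
    and \<mu>: "\<mu> = (LINT x|lebesgue_on S. (norm (h x))\<^sup>2)"
    and low: "\<And>u g. has_H1_gradient S u g \<Longrightarrow> (LINT x|lebesgue_on S. u x) = 0 \<Longrightarrow>
       \<mu> * (LINT x|lebesgue_on S. (u x)\<^sup>2) \<le> (LINT x|lebesgue_on S. (norm (g x))\<^sup>2)"
    by (rule exists_Rayleigh_minimizer[OF S(1) gap u True]) blast+
  have "0 \<le> (LINT x|lebesgue_on S. (norm (h x))\<^sup>2)" by simp
  then have "enat 2 \<le> neumann_counting S \<mu>"
    using neumann_counting_ge_2[OF S Rayleigh_minimizer_eigenfunction[OF S v \<mu> low] v(2,3)] \<mu> by simp
  moreover have "bdd_below {a. enat 2 \<le> neumann_counting S a}"
  proof (rule bdd_belowI)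
    fix a assume "a \<in> {a. enat 2 \<le> neumann_counting S a}"
    then show "0 \<le> a" using neumann_counting_negative[of a S] by (cases "a < 0") (auto simp: zero_enat_def)
  qed
  ultimately have "neumann_eigenvalue S 2 \<le> \<mu>"
    unfolding neumann_eigenvalue_def by (intro cInf_lower) auto
  then have "neumann_eigenvalue S 2 * (LINT x|lebesgue_on S. (u x)\<^sup>2) \<le> \<mu> * (LINT x|lebesgue_on S. (u x)\<^sup>2)"
    by (rule mult_right_mono) simp
  with low[OF u] show ?thesis by linarith
qed

section \<open>Reflection\<close>

lemma has_derivative_reflect:
  fixes f :: "real^2 \<Rightarrow> real"
  assumes "f differentiable (at (- x))"
  shows "((\<lambda>x. f (- x)) has_derivative (\<lambda>h. frechet_derivative f (at (- x)) (- h))) (at x)"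
  by (rule has_derivative_compose[where f = uminus and f' = uminus, OF _ has_derivative_partial[OF assms]])
    (auto intro!: derivative_eq_intros)

lemma partial_deriv_reflect:
  assumes "f differentiable (at (- x))"
  shows "partial_deriv i (\<lambda>x. f (- x)) x = - partial_deriv i f (- x)"
proof -
  have "frechet_derivative f (at (- x)) (- axis i 1) = - frechet_derivative f (at (- x)) (axis i 1)"
    by (rule linear_neg[OF bounded_linear.linear[OF has_derivative_bounded_linear[OF has_derivative_partial[OF assms]]]])
  then show ?thesis using partial_deriv_eqI[OF has_derivative_reflect[OF assms]] by (simp add: partial_deriv_def)
qed

lemma continuously_differentiable_reflect:
  "continuously_differentiable k f \<Longrightarrow> continuously_differentiable k (\<lambda>x. f (- x))"
proof (induction k arbitrary: f)
  case 0
  then show ?case by (auto intro!: continuous_on_compose2[of UNIV f] continuous_intros)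
next
  case (Suc k)
  have d: "f differentiable (at x)" for x using Suc.prems by (auto simp: differentiable_on_UNIV_at)
  have "partial_deriv i (\<lambda>x. f (- x)) = (\<lambda>x. - 1 * partial_deriv i f (- x))" for i
    using partial_deriv_reflect[OF d] by auto
  then show ?case
    using Suc has_derivative_reflect[OF d] continuously_differentiable_mult[OF continuously_differentiable_const[of k "-1"]]
    by (auto simp: differentiable_on_UNIV_at differentiable_def)
qed

lemma test_function_reflect:
  assumes T: "test_function S \<phi>" and sym: "uminus ` S = S"
  shows "test_function S (\<lambda>x. \<phi> (- x))"
proof -
  have "support_on UNIV (\<lambda>x. \<phi> (- x)) = uminus ` support_on UNIV \<phi>"
    by (auto simp: support_on_def image_iff) (metis minus_minus)
  then have c: "closure (support_on UNIV (\<lambda>x. \<phi> (- x))) = uminus ` closure (support_on UNIV \<phi>)"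
    using closure_injective_linear_image[OF linear_uminus, of "support_on UNIV \<phi>"] by simp
  have "compact (uminus ` closure (support_on UNIV \<phi>))"
    using T by (intro compact_negations) (simp add: test_function_def)
  moreover have "uminus ` closure (support_on UNIV \<phi>) \<subseteq> S"
    using T sym by (auto simp: test_function_def)
  ultimately show ?thesis
    using T continuously_differentiable_reflect unfolding test_function_def c by blast
qed

lemma uminus_image_mem: "uminus ` S = S \<Longrightarrow> - x \<in> S \<longleftrightarrow> x \<in> (S :: 'a::group_add set)"
  by (metis image_eqI minus_minus)

lemma square_integrable_on_reflect:
  fixes f :: "real^2 \<Rightarrow> 'b::euclidean_space"
  assumes f: "square_integrable_on S f" and S: "S \<in> sets lebesgue" "uminus ` S = S"
  shows "square_integrable_on S (\<lambda>x. f (- x))"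
proof -
  have m: "f \<in> borel_measurable (lebesgue_on (uminus ` S))" "integrable (lebesgue_on (uminus ` S)) (\<lambda>x. (norm (f x))\<^sup>2)"
    using f S(2) by (auto simp: square_integrable_on_def)
  then have m2: "(\<lambda>x. (norm (f x))\<^sup>2) \<in> borel_measurable (lebesgue_on (uminus ` S))" by auto
  show ?thesis
    unfolding square_integrable_on_def
    using integral_reflect_vec(3)[OF S(1) m(1)] integral_reflect_vec(2)[OF S(1) m2] m(2) by simp
qed

lemma integral_reflect_symmetric:
  fixes f :: "real^2 \<Rightarrow> real"
  assumes "f \<in> borel_measurable (lebesgue_on S)" "S \<in> sets lebesgue" "uminus ` S = S"
  shows "(LINT x|lebesgue_on S. f (- x)) = (LINT x|lebesgue_on S. f x)"
  using integral_reflect_vec(1)[of S f] assms by simp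

text \<open>The reflection is moved onto the test function, whose partial derivatives change sign by
  the chain rule; hence the sign of the gradient.\<close>

lemma has_H1_gradient_reflect:
  assumes H: "has_H1_gradient S u g" and S: "S \<in> lmeasurable" "uminus ` S = S"
  shows "has_H1_gradient S (\<lambda>x. u (- x)) (\<lambda>x. - g (- x))"
  unfolding has_H1_gradient_def
proof (intro conjI allI impI)
  have SS: "S \<in> sets lebesgue" using S by (simp add: fmeasurableD)
  note D = has_H1_gradientD[OF H]
  show "square_integrable_on S (\<lambda>x. u (- x))" by (rule square_integrable_on_reflect[OF D(1) SS S(2)])
  show "square_integrable_on S (\<lambda>x. - g (- x))"
    using square_integrable_on_lincomb[OF square_integrable_on_reflect[OF D(2) SS S(2)] square_integrable_on_reflect[OF D(2) SS S(2)], of "-1" 0]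
    by simp
  fix \<phi> i assume T: "test_function S \<phi>"
  note T' = test_function_reflect[OF T S(2)]
  note t = test_function_square_integrable[OF T' S(1)]
  have d: "\<phi> differentiable (at x)" for x
  proof -
    have "continuously_differentiable (Suc 0) \<phi>" using T unfolding test_function_def by blast
    then show ?thesis by (auto simp: differentiable_on_def)
  qed
  have m: "(\<lambda>x. u x * partial_deriv i (\<lambda>x. \<phi> (- x)) x) \<in> borel_measurable (lebesgue_on S)"
    "(\<lambda>x. g x $ i * \<phi> (- x)) \<in> borel_measurable (lebesgue_on S)"
    by (intro borel_measurable_times square_integrable_on_real(2) D(1) t square_integrable_on_component'[OF D(2)])+
  have "(LINT x|lebesgue_on S. u (- x) * partial_deriv i \<phi> x) = - (LINT x|lebesgue_on S. u (- x) * partial_deriv i (\<lambda>x. \<phi> (- x)) (- x))"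
    using partial_deriv_reflect[of \<phi> "- _" i] d by simp
  also have "(LINT x|lebesgue_on S. u (- x) * partial_deriv i (\<lambda>x. \<phi> (- x)) (- x)) = (LINT x|lebesgue_on S. u x * partial_deriv i (\<lambda>x. \<phi> (- x)) x)"
    by (rule integral_reflect_symmetric[OF m(1) SS S(2)])
  also have "\<dots> = - (LINT x|lebesgue_on S. g x $ i * \<phi> (- x))" by (rule D(3)[OF T'])
  also have "(LINT x|lebesgue_on S. g x $ i * \<phi> (- x)) = (LINT x|lebesgue_on S. g (- x) $ i * \<phi> x)"
    using integral_reflect_symmetric[OF m(2) SS S(2)] by simp
  finally show "(LINT x|lebesgue_on S. u (- x) * partial_deriv i \<phi> x) = - (LINT x|lebesgue_on S. (- g (- x)) $ i * \<phi> x)"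
    by simp
qed

text \<open>The points of S where a continuous representative is not symmetric form an open null
  set, which is empty; continuity extends the symmetry to the closure.\<close>

lemma symmetric_on_closureI:
  assumes S: "open S" "S \<in> lmeasurable" "uminus ` S = S" and ae: "AE x in lebesgue_on S. \<psi> x = \<psi> (- x)"
  shows "symmetric_on_closure S \<psi>"
  unfolding symmetric_on_closure_def
proof (intro conjI allI impI ballI ae)
  fix \<phi> x assume \<phi>: "continuous_on (closure S) \<phi> \<and> (AE x in lebesgue_on S. \<phi> x = \<psi> x)" and x: "x \<in> closure S"
  have SS: "S \<in> sets lebesgue" using S by (simp add: fmeasurableD)
  have clo: "- y \<in> closure S \<longleftrightarrow> y \<in> closure S" for y
    using uminus_image_mem[of "closure S" y] closure_injective_linear_image[OF linear_uminus, of S] S(3) by simp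
  let ?f = "\<lambda>y. \<phi> y - \<phi> (- y)"
  have cf: "continuous_on (closure S) ?f"
    using \<phi> clo by (intro continuous_intros continuous_on_compose2[of "closure S" \<phi> "closure S" uminus]) auto
  have "AE y in lebesgue_on S. \<phi> y = \<psi> y" using \<phi> by blast
  moreover from AE_reflect_vec[OF SS S(3) this] have "AE y in lebesgue_on S. \<phi> (- y) = \<psi> (- y)" .
  ultimately have "AE y in lebesgue_on S. ?f y = 0" using ae by eventually_elim simp
  then have "AE y in lebesgue. y \<in> S \<longrightarrow> ?f y = 0"
    using SS by (subst (asm) AE_restrict_space_iff) auto
  then have "AE y in lebesgue. y \<notin> {y \<in> S. ?f y \<noteq> 0}" by eventually_elim auto
  moreover have o: "open {y \<in> S. ?f y \<noteq> 0}"
  proof -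
    have "open (S \<inter> ?f -` (- {0}))"
      by (rule continuous_open_preimage[OF continuous_on_subset[OF cf closure_subset] S(1)]) auto
    moreover have "S \<inter> ?f -` (- {0}) = {y \<in> S. ?f y \<noteq> 0}" by auto
    ultimately show ?thesis by simp
  qed
  ultimately have "negligible {y \<in> S. ?f y \<noteq> 0}"
    unfolding negligible_iff_null_sets by (subst AE_iff_null_sets) (auto intro: borel_open simp: lborelD)
  then have "{y \<in> S. ?f y \<noteq> 0} = {}" using open_not_negligible[OF o] by blast
  then have "?f y = 0" if "y \<in> S" for y using that by blast
  from continuous_constant_on_closure[OF cf this x] show "\<phi> x = \<phi> (- x)" by simp
qed

text \<open>The odd part of an eigenfunction has the Rayleigh quotient \<open>\<mu>\<close>, which is too small
  for an odd function.\<close>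

lemma neumann_eigenspace_symmetric:
  assumes S: "open S" "S \<in> lmeasurable" "uminus ` S = S"
    and odd: "\<And>u g. has_H1_gradient S u g \<Longrightarrow> (\<And>x. u (- x) = - u x) \<Longrightarrow>
      (LINT x|lebesgue_on S. (u x)\<^sup>2) \<le> C * (LINT x|lebesgue_on S. (norm (g x))\<^sup>2)"
    and \<mu>: "C * \<mu> < 1" and \<psi>: "\<psi> \<in> neumann_eigenspace S \<mu>"
  shows "symmetric_on_closure S \<psi>"
proof (rule symmetric_on_closureI[OF S])
  have SS: "S \<in> sets lebesgue" using S by (simp add: fmeasurableD)
  obtain g where g: "has_H1_gradient S \<psi> g"
    and eig: "\<And>v h. has_H1_gradient S v h \<Longrightarrow>
           (LINT x|lebesgue_on S. g x \<bullet> h x) = \<mu> * (LINT x|lebesgue_on S. \<psi> x * v x)"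
    using \<psi> unfolding neumann_eigenspace_def by blast
  \<comment> \<open>The odd part of the eigenfunction; its gradient k is the even part of g. Both
    are written as linear combinations so that they inherit membership in the Sobolev space.\<close>
  define p where "p x = (1 / 2) * \<psi> x + (- 1 / 2) * \<psi> (- x)" for x
  define k where "k x = (1 / 2) *\<^sub>R g x + (- 1 / 2) *\<^sub>R (- g (- x))" for x
  have pk: "has_H1_gradient S p k"
    unfolding p_def [abs_def] k_def [abs_def]
    by (rule has_H1_gradient_lincomb[OF g has_H1_gradient_reflect[OF g S(2,3)] S(2)])
  have p: "p (- x) = - p x" and k: "k (- x) = k x" for x by (auto simp: p_def k_def algebra_simps)
  \<comment> \<open>The integral is invariant under reflection, so the pairing of f with q may be
    averaged over x and -x. This leaves the part of f with the parity of q, which is q itself in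
    both uses: g with the even k, and \<psi> with the odd p.\<close>
  have half: "(LINT x|lebesgue_on S. f x \<bullet> q x) = (LINT x|lebesgue_on S. (norm (q x))\<^sup>2)"
    if f: "square_integrable_on S f" "square_integrable_on S q" and q: "\<And>x. f x \<bullet> q x + f (- x) \<bullet> q (- x) = 2 * (norm (q x))\<^sup>2"
    for f q :: "real^2 \<Rightarrow> 'b::euclidean_space"
  proof -
    have i: "integrable (lebesgue_on S) (\<lambda>x. f x \<bullet> q x)" "integrable (lebesgue_on S) (\<lambda>x. f (- x) \<bullet> q (- x))"
      using square_integrable_on_inner(1)[OF f]
        square_integrable_on_inner(1)[OF square_integrable_on_reflect[OF f(1) SS S(3)] square_integrable_on_reflect[OF f(2) SS S(3)]] by auto
    have "(LINT x|lebesgue_on S. f (- x) \<bullet> q (- x)) = (LINT x|lebesgue_on S. f x \<bullet> q x)"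
      by (rule integral_reflect_symmetric[OF borel_measurable_integrable[OF i(1)] SS S(3)])
    moreover have "(LINT x|lebesgue_on S. f x \<bullet> q x + f (- x) \<bullet> q (- x)) =
      (LINT x|lebesgue_on S. f x \<bullet> q x) + (LINT x|lebesgue_on S. f (- x) \<bullet> q (- x))"
      by (rule Bochner_Integration.integral_add[OF i])
    ultimately have "2 * (LINT x|lebesgue_on S. f x \<bullet> q x) = (LINT x|lebesgue_on S. 2 * (norm (q x))\<^sup>2)"
      unfolding q by linarith
    then show ?thesis by simp
  qed
  note D = has_H1_gradientD(1,2)[OF g] has_H1_gradientD(1,2)[OF pk]
  have "(LINT x|lebesgue_on S. g x \<bullet> k x) = (LINT x|lebesgue_on S. (norm (k x))\<^sup>2)"
  proof (rule half[OF D(2,4)])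
    fix x
    have "g x + g (- x) = 2 *\<^sub>R k x" by (simp add: k_def algebra_simps)
    then have "(g x + g (- x)) \<bullet> k x = 2 * (norm (k x))\<^sup>2" by (simp add: power2_norm_eq_inner)
    then show "g x \<bullet> k x + g (- x) \<bullet> k (- x) = 2 * (norm (k x))\<^sup>2" by (simp add: k inner_add_left)
  qed
  moreover have "(LINT x|lebesgue_on S. \<psi> x \<bullet> p x) = (LINT x|lebesgue_on S. (norm (p x))\<^sup>2)"
  proof (rule half[OF D(1,3)])
    fix x
    have "\<psi> x - \<psi> (- x) = 2 * p x" by (simp add: p_def)
    then have "(\<psi> x - \<psi> (- x)) * p x = 2 * (norm (p x))\<^sup>2" by (simp add: power2_eq_square)
    then show "\<psi> x \<bullet> p x + \<psi> (- x) \<bullet> p (- x) = 2 * (norm (p x))\<^sup>2" by (simp add: p left_diff_distrib)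
  qed
  ultimately have "(LINT x|lebesgue_on S. (norm (k x))\<^sup>2) = \<mu> * (LINT x|lebesgue_on S. (p x)\<^sup>2)"
    using eig[OF pk] by simp
  then have "(LINT x|lebesgue_on S. (p x)\<^sup>2) \<le> C * \<mu> * (LINT x|lebesgue_on S. (p x)\<^sup>2)"
    using odd[OF pk p] by simp
  then have "(1 - C * \<mu>) * (LINT x|lebesgue_on S. (p x)\<^sup>2) \<le> 0" by (simp add: left_diff_distrib)
  then have "(LINT x|lebesgue_on S. (p x)\<^sup>2) \<le> 0" using \<mu> by (simp add: mult_le_0_iff)
  moreover have "0 \<le> (LINT x|lebesgue_on S. (p x)\<^sup>2)" by simp
  ultimately have "(LINT x|lebesgue_on S. (p x)\<^sup>2) = 0" by linarith
  then have "AE x in lebesgue_on S. p x = 0" using AE_lebesgue_on_zero_iff[OF D(3)] by blast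
  then show "AE x in lebesgue_on S. \<psi> x = \<psi> (- x)" by eventually_elim (simp add: p_def)
qed

section \<open>The domain and its Rayleigh quotients\<close>

text \<open>The rectangles are the square, a strip that contains both channels, and the four sides of the ring.\<close>

definition ring_domain :: "real \<Rightarrow> (real^2) set" where
  "ring_domain w = rect (-1) 1 (-1) 1 \<union> (rect (-w) w (-3) 3 \<union> (rect (-3) 3 2 3 \<union>
     (rect (-3) 3 (-3) (-2) \<union> (rect 2 3 (-3) 3 \<union> rect (-3) (-2) (-3) 3))))"

lemma ring_domain_iff:
  assumes "0 < w" "w < 1"
  shows "x \<in> ring_domain w \<longleftrightarrow> \<bar>x $ 1\<bar> < 3 \<and> \<bar>x $ 2\<bar> < 3 \<and>
    (\<bar>x $ 1\<bar> > 2 \<or> \<bar>x $ 2\<bar> > 2 \<or> \<bar>x $ 1\<bar> < w \<or> \<bar>x $ 1\<bar> < 1 \<and> \<bar>x $ 2\<bar> < 1)"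
  using assms unfolding ring_domain_def rect_def Un_iff mem_Collect_eq abs_less_iff by argo

lemma open_ring_domain: "open (ring_domain w)"
  unfolding ring_domain_def by (intro open_Un open_rect)

lemma bounded_ring_domain: "bounded (ring_domain w)"
  unfolding ring_domain_def by (intro bounded_Un[THEN iffD2] conjI bounded_rect)

lemma lmeasurable_ring_domain: "ring_domain w \<in> lmeasurable"
  by (simp add: open_ring_domain bounded_ring_domain lmeasurable_open)

lemma uminus_rect: "uminus ` rect a b c d = rect (- b) (- a) (- d) (- c)"
proof -
  have "x \<in> uminus ` rect a b c d" if "x \<in> rect (- b) (- a) (- d) (- c)" for x
    by (rule image_eqI[of _ _ "- x"]) (use that in \<open>auto simp: rect_def\<close>)
  then show ?thesis by (auto simp: rect_def)
qed

lemma uminus_ring_domain: "uminus ` ring_domain w = ring_domain w"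
  unfolding ring_domain_def image_Un uminus_rect by (simp add: Un_ac)

lemma finite_rank_gap_ring_domain:
  assumes "0 < w" "\<epsilon> > 0" shows "finite_rank_gap (ring_domain w) \<epsilon>"
proof -
  have m: "A \<in> lmeasurable \<Longrightarrow> B \<in> lmeasurable \<Longrightarrow> A \<union> B \<in> lmeasurable" for A B :: "(real^2) set"
    by (rule fmeasurable.Un)
  show ?thesis
    unfolding ring_domain_def
    by (intro finite_rank_gap_Un finite_rank_gap_rect m lmeasurable_rect; use assms in simp)
qed

lemma integral_lebesgue_on_Un_le:
  fixes f :: "'a::euclidean_space \<Rightarrow> real"
  assumes "integrable (lebesgue_on (A \<union> B)) f" "A \<in> sets lebesgue" "B \<in> sets lebesgue" "\<And>x. 0 \<le> f x"
  shows "(LINT x|lebesgue_on (A \<union> B). f x) \<le> (LINT x|lebesgue_on A. f x) + (LINT x|lebesgue_on B. f x)"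
  by (rule integral_lebesgue_on_cover[where N = "{}"]) (use assms in auto)

text \<open>On the overlap Q both constants approximate the same u, and (\<alpha> - \<beta>)^2 <= 2
  (u - \<alpha>)^2 + 2 (u - \<beta>)^2. This ties the values on adjacent sides of the ring to each
  other.\<close>

lemma two_point_overlap:
  fixes u :: "real^2 \<Rightarrow> real"
  assumes u: "square_integrable_on A u" "square_integrable_on B u" and A: "A \<in> lmeasurable" and B: "B \<in> lmeasurable"
    and Q: "Q \<in> lmeasurable" "Q \<subseteq> A" "Q \<subseteq> B"
    and V: "(LINT x|lebesgue_on A. (u x - \<alpha>)\<^sup>2) \<le> V" "(LINT x|lebesgue_on B. (u x - \<beta>)\<^sup>2) \<le> V"
  shows "(\<alpha> - \<beta>)\<^sup>2 * measure lebesgue Q \<le> 4 * V"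
proof -
  have one: "square_integrable_on S (\<lambda>x. 1 :: real)" if "S \<in> lmeasurable" for S
    by (rule square_integrable_onI_bounded[OF that, where B = 1]) auto
  have sq: "square_integrable_on S (\<lambda>x. u x - c)" if "square_integrable_on S u" "S \<in> lmeasurable" for S c
    using square_integrable_on_lincomb[OF that(1) one[OF that(2)], of 1 "- c"] by simp
  note i = square_integrable_on_real(1)[OF sq[OF u(1) A, of \<alpha>]] square_integrable_on_real(1)[OF sq[OF u(2) B, of \<beta>]]
  note S = A[THEN fmeasurableD] B[THEN fmeasurableD] Q(1)[THEN fmeasurableD]
  interpret finite_measure "lebesgue_on Q" by (rule finite_measure_lebesgue_on[OF Q(1)])
  have q: "integrable (lebesgue_on Q) (\<lambda>x. (u x - \<alpha>)\<^sup>2)" "integrable (lebesgue_on Q) (\<lambda>x. (u x - \<beta>)\<^sup>2)"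
    by (rule integrable_lebesgue_on_subset[OF i(1) S(1,3) Q(2)], rule integrable_lebesgue_on_subset[OF i(2) S(2,3) Q(3)])
  have "(\<alpha> - \<beta>)\<^sup>2 * measure lebesgue Q = (LINT x|lebesgue_on Q. (\<alpha> - \<beta>)\<^sup>2)"
    using S by (simp add: measure_lebesgue_on_space)
  also have "\<dots> \<le> (LINT x|lebesgue_on Q. 2 * (u x - \<alpha>)\<^sup>2 + 2 * (u x - \<beta>)\<^sup>2)"
  proof (rule integral_mono)
    show "(\<alpha> - \<beta>)\<^sup>2 \<le> 2 * (u x - \<alpha>)\<^sup>2 + 2 * (u x - \<beta>)\<^sup>2" for x
      using zero_le_power2[of "(u x - \<alpha>) + (u x - \<beta>)"] by (simp add: power2_eq_square algebra_simps)
  qed (use q in auto)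
  also have "\<dots> = 2 * (LINT x|lebesgue_on Q. (u x - \<alpha>)\<^sup>2) + 2 * (LINT x|lebesgue_on Q. (u x - \<beta>)\<^sup>2)"
    using q by simp
  also have "\<dots> \<le> 4 * V"
  proof -
    have "(LINT x|lebesgue_on Q. (u x - \<alpha>)\<^sup>2) \<le> (LINT x|lebesgue_on A. (u x - \<alpha>)\<^sup>2)"
      by (rule integral_lebesgue_on_mono[OF i(1) S(1,3) Q(2)]) simp
    moreover have "(LINT x|lebesgue_on Q. (u x - \<beta>)\<^sup>2) \<le> (LINT x|lebesgue_on B. (u x - \<beta>)\<^sup>2)"
      by (rule integral_lebesgue_on_mono[OF i(2) S(2,3) Q(3)]) simp
    ultimately show ?thesis using V by linarith
  qed
  finally show ?thesis .
qed

lemma integral_square_le_shift: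
  fixes u :: "real^2 \<Rightarrow> real"
  assumes u: "square_integrable_on S u" and S: "S \<in> lmeasurable" and V: "(LINT x|lebesgue_on S. (u x - \<kappa>)\<^sup>2) \<le> V"
  shows "(LINT x|lebesgue_on S. (u x)\<^sup>2) \<le> 2 * V + 2 * \<kappa>\<^sup>2 * measure lebesgue S"
proof -
  interpret finite_measure "lebesgue_on S" by (rule finite_measure_lebesgue_on[OF S])
  have one: "square_integrable_on S (\<lambda>x. 1 :: real)"
    by (rule square_integrable_onI_bounded[OF S, where B = 1]) auto
  have "square_integrable_on S (\<lambda>x. u x - \<kappa>)"
    using square_integrable_on_lincomb[OF u one, of 1 "- \<kappa>"] by simp
  note i = square_integrable_on_real(1)[OF this]
  have "(LINT x|lebesgue_on S. (u x)\<^sup>2) \<le> (LINT x|lebesgue_on S. 2 * (u x - \<kappa>)\<^sup>2 + 2 * \<kappa>\<^sup>2)"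
  proof (rule integral_mono)
    show "(u x)\<^sup>2 \<le> 2 * (u x - \<kappa>)\<^sup>2 + 2 * \<kappa>\<^sup>2" for x
      using zero_le_power2[of "(u x - \<kappa>) - \<kappa>"] by (simp add: power2_eq_square algebra_simps)
  qed (use i square_integrable_on_real(1)[OF u] in auto)
  also have "\<dots> = 2 * (LINT x|lebesgue_on S. (u x - \<kappa>)\<^sup>2) + 2 * \<kappa>\<^sup>2 * measure lebesgue S"
    using i S by (simp add: measure_lebesgue_on_space fmeasurableD)
  finally show ?thesis using V by linarith
qed

text \<open>Square and strip are centrally symmetric, so that an odd function has mean zero on them.
  For the ring, \<open>\<alpha>\<close> and \<open>\<beta>\<close> are approximate values on the top and right sides; by oddness the value
  on the bottom side is \<open>- \<alpha>\<close>, and the two overlaps bound \<open>\<alpha> - \<beta>\<close> and \<open>\<beta> + \<alpha>\<close>.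
  The constant does not depend on \<open>w\<close>.\<close>

lemma ring_domain_odd_Poincare:
  assumes w: "0 < w" "w < 1" and H: "has_H1_gradient (ring_domain w) u g" and odd: "\<And>x. u (- x) = - u x"
  shows "(LINT x|lebesgue_on (ring_domain w). (u x)\<^sup>2) \<le> 45000 * (LINT x|lebesgue_on (ring_domain w). (norm (g x))\<^sup>2)"
proof -
  let ?S = "ring_domain w"
  have SS: "?S \<in> sets lebesgue" using lmeasurable_ring_domain by (rule fmeasurableD)
  have rs: "rect a b c d \<in> sets lebesgue" for a b c d using lmeasurable_rect by (rule fmeasurableD)
  define D where "D = (LINT x|lebesgue_on ?S. (norm (g x))\<^sup>2)"
  have ig: "integrable (lebesgue_on ?S) (\<lambda>x. (norm (g x))\<^sup>2)"
    using has_H1_gradientD(2)[OF H] by (simp add: square_integrable_on_def)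
  have D0: "0 \<le> D" by (simp add: D_def)
  have D: "(LINT x|lebesgue_on (rect a b c d). (norm (g x))\<^sup>2) \<le> D" if "rect a b c d \<subseteq> ?S" for a b c d
    unfolding D_def by (rule integral_lebesgue_on_mono[OF ig SS rs that]) simp
  have sub: "rect (-1) 1 (-1) 1 \<subseteq> ?S" "rect (-w) w (-3) 3 \<subseteq> ?S" "rect (-3) 3 2 3 \<subseteq> ?S"
    "rect (-3) 3 (-3) (-2) \<subseteq> ?S" "rect 2 3 (-3) 3 \<subseteq> ?S" "rect (-3) (-2) (-3) 3 \<subseteq> ?S"
    unfolding ring_domain_def by auto
  note Hr = has_H1_gradient_subset[OF H SS rs]
  have us: "square_integrable_on (rect a b c d) u" if "rect a b c d \<subseteq> ?S" for a b c d
    using has_H1_gradientD(1)[OF Hr[OF that]] .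
  have um: "u \<in> borel_measurable (lebesgue_on (rect a b c d))" if "rect a b c d \<subseteq> ?S" for a b c d
    using us[OF that] by (simp add: square_integrable_on_def)
  have sym0: "(LINT x|lebesgue_on (rect (- b) b (- d) d). (u x)\<^sup>2) \<le> 6 * ((2 * b)\<^sup>2 + (2 * d)\<^sup>2) * D"
    if s: "rect (- b) b (- d) d \<subseteq> ?S" and bd: "0 < b" "0 < d" for b d
  proof -
    have "uminus ` rect (- b) b (- d) d = rect (- b) b (- d) d" by (simp add: uminus_rect)
    from integral_reflect_symmetric[OF um[OF s] rs this]
    have "(LINT x|lebesgue_on (rect (- b) b (- d) d). u x) = 0" by (simp add: odd)
    moreover have "6 * ((2 * b)\<^sup>2 + (2 * d)\<^sup>2) * (LINT x|lebesgue_on (rect (- b) b (- d) d). (norm (g x))\<^sup>2) \<le> 6 * ((2 * b)\<^sup>2 + (2 * d)\<^sup>2) * D"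
      by (rule mult_left_mono[OF D[OF s]]) simp
    ultimately show ?thesis using variance_le[OF Hr[OF s]] bd by simp
  qed
  have X: "(LINT x|lebesgue_on (rect (-1) 1 (-1) 1). (u x)\<^sup>2) \<le> 48 * D"
    using sym0[of 1 1] sub(1) by simp
  \<comment> \<open>The strip has length 6 and width 2 w <= 2, and 6 (2^2 + 6^2) = 240: this is
    where the bound becomes independent of w.\<close>
  have Ch: "(LINT x|lebesgue_on (rect (-w) w (-3) 3). (u x)\<^sup>2) \<le> 240 * D"
  proof -
    have "w\<^sup>2 \<le> 1" using w by (simp add: power_le_one)
    then have "6 * ((2 * w)\<^sup>2 + (2 * 3)\<^sup>2) * D \<le> 240 * D"
      by (intro mult_right_mono[OF _ D0]) (simp add: power_mult_distrib)
    with sym0[of w 3] sub(2) w show ?thesis by simp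
  qed
  \<comment> \<open>A side of the ring is 6 by 1, so the squared diagonal is 37 and the Poincare
    constant 6 * 37 = 222.\<close>
  have long: "\<exists>\<kappa>. (LINT x|lebesgue_on (rect a b c d). (u x - \<kappa>)\<^sup>2) \<le> 222 * D"
    if s: "rect a b c d \<subseteq> ?S" and ab: "a < b" "c < d" "(b - a)\<^sup>2 + (d - c)\<^sup>2 = 37" for a b c d
  proof -
    obtain \<kappa> where "(LINT x|lebesgue_on (rect a b c d). (u x - \<kappa>)\<^sup>2) \<le>
      6 * ((b - a)\<^sup>2 + (d - c)\<^sup>2) * (LINT x|lebesgue_on (rect a b c d). (norm (g x))\<^sup>2)"
      using Poincare_rect[OF Hr[OF s] ab(1,2)] .
    also have "\<dots> \<le> 222 * D" using D[OF s] ab(3) by simp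
    finally show ?thesis by blast
  qed
  obtain \<alpha> where \<alpha>: "(LINT x|lebesgue_on (rect (-3) 3 2 3). (u x - \<alpha>)\<^sup>2) \<le> 222 * D"
    using long[OF sub(3)] by auto
  obtain \<beta> where \<beta>: "(LINT x|lebesgue_on (rect 2 3 (-3) 3). (u x - \<beta>)\<^sup>2) \<le> 222 * D"
    using long[OF sub(5)] by auto
  have refl: "(LINT x|lebesgue_on (rect (- b) (- a) (- d) (- c)). (u x - (- \<kappa>))\<^sup>2) = (LINT x|lebesgue_on (rect a b c d). (u x - \<kappa>)\<^sup>2)"
    if s: "rect (- b) (- a) (- d) (- c) \<subseteq> ?S" for a b c d \<kappa>
  proof -
    have "(\<lambda>x. (u x - (- \<kappa>))\<^sup>2) \<in> borel_measurable (lebesgue_on (uminus ` rect a b c d))"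
      unfolding uminus_rect using um[OF s] by auto
    from integral_reflect_vec(1)[OF rs this] show ?thesis
      unfolding uminus_rect odd by (simp add: power2_commute)
  qed
  have \<alpha>': "(LINT x|lebesgue_on (rect (-3) 3 (-3) (-2)). (u x - (- \<alpha>))\<^sup>2) \<le> 222 * D"
    using refl[of 3 "-3" 3 2 \<alpha>] sub(4) \<alpha> by simp
  have \<beta>': "(LINT x|lebesgue_on (rect (-3) (-2) (-3) 3). (u x - (- \<beta>))\<^sup>2) \<le> 222 * D"
    using refl[of 3 2 3 "-3" \<beta>] sub(6) \<beta> by simp
  have "(\<alpha> - \<beta>)\<^sup>2 * measure lebesgue (rect 2 3 2 3) \<le> 4 * (222 * D)"
    by (rule two_point_overlap[OF us[OF sub(3)] us[OF sub(5)] lmeasurable_rect lmeasurable_rect lmeasurable_rect _ _ \<alpha> \<beta>])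
      (auto simp: rect_def)
  moreover have "(\<beta> - (- \<alpha>))\<^sup>2 * measure lebesgue (rect 2 3 (-3) (-2)) \<le> 4 * (222 * D)"
    by (rule two_point_overlap[OF us[OF sub(5)] us[OF sub(4)] lmeasurable_rect lmeasurable_rect lmeasurable_rect _ _ \<beta> \<alpha>'])
      (auto simp: rect_def)
  \<comment> \<open>The overlaps are corner squares of area 1; adding (\<alpha> - \<beta>)^2 and
    (\<alpha> + \<beta>)^2 removes the mixed term.\<close>
  ultimately have "2 * \<alpha>\<^sup>2 + 2 * \<beta>\<^sup>2 \<le> 8 * (222 * D)"
    by (simp add: measure_rect power2_eq_square algebra_simps)
  then have ab: "\<alpha>\<^sup>2 \<le> 888 * D" "\<beta>\<^sup>2 \<le> 888 * D"
    using zero_le_power2[of \<alpha>] zero_le_power2[of \<beta>] by linarith+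
  \<comment> \<open>11100 = 2 * 222 + 2 * 888 * 6, where 6 is the area of a side.\<close>
  have side: "(LINT x|lebesgue_on (rect a b c d). (u x)\<^sup>2) \<le> 11100 * D"
    if s: "rect a b c d \<subseteq> ?S" and V: "(LINT x|lebesgue_on (rect a b c d). (u x - \<kappa>)\<^sup>2) \<le> 222 * D"
      and k: "\<kappa>\<^sup>2 \<le> 888 * D" and m: "measure lebesgue (rect a b c d) = 6" for a b c d \<kappa>
    using integral_square_le_shift[OF us[OF s] lmeasurable_rect V] k unfolding m by linarith
  have sides: "(LINT x|lebesgue_on (rect (-3) 3 2 3). (u x)\<^sup>2) \<le> 11100 * D"
    "(LINT x|lebesgue_on (rect (-3) 3 (-3) (-2)). (u x)\<^sup>2) \<le> 11100 * D"
    "(LINT x|lebesgue_on (rect 2 3 (-3) 3). (u x)\<^sup>2) \<le> 11100 * D"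
    "(LINT x|lebesgue_on (rect (-3) (-2) (-3) 3). (u x)\<^sup>2) \<le> 11100 * D"
    by (rule side[OF sub(3) \<alpha>] side[OF sub(4) \<alpha>'] side[OF sub(5) \<beta>] side[OF sub(6) \<beta>']; use ab in \<open>simp add: measure_rect\<close>)+
  have iu: "integrable (lebesgue_on ?S) (\<lambda>x. (u x)\<^sup>2)" by (rule square_integrable_on_real(1)[OF has_H1_gradientD(1)[OF H]])
  have un: "(LINT x|lebesgue_on (A \<union> B). (u x)\<^sup>2) \<le> (LINT x|lebesgue_on A. (u x)\<^sup>2) + (LINT x|lebesgue_on B. (u x)\<^sup>2)"
    if "A \<in> sets lebesgue" "B \<in> sets lebesgue" "A \<union> B \<subseteq> ?S" for A B
    by (rule integral_lebesgue_on_Un_le[OF integrable_lebesgue_on_subset[OF iu SS _ that(3)]]) (use that in auto)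
  let ?X = "rect (-1) 1 (-1) 1" and ?C = "rect (-w) w (-3) 3" and ?T = "rect (-3) 3 2 3"
    and ?B = "rect (-3) 3 (-3) (-2)" and ?R = "rect 2 3 (-3) 3" and ?L = "rect (-3) (-2) (-3) 3"
  have "(LINT x|lebesgue_on ?S. (u x)\<^sup>2) \<le> (LINT x|lebesgue_on ?X. (u x)\<^sup>2) + (LINT x|lebesgue_on (?C \<union> (?T \<union> (?B \<union> (?R \<union> ?L)))). (u x)\<^sup>2)"
    using un[of ?X "?C \<union> (?T \<union> (?B \<union> (?R \<union> ?L)))"] sub rs by (simp add: ring_domain_def)
  moreover have "(LINT x|lebesgue_on (?C \<union> (?T \<union> (?B \<union> (?R \<union> ?L)))). (u x)\<^sup>2) \<le> (LINT x|lebesgue_on ?C. (u x)\<^sup>2) + (LINT x|lebesgue_on (?T \<union> (?B \<union> (?R \<union> ?L))). (u x)\<^sup>2)"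
    by (rule un) (use sub rs in auto)
  moreover have "(LINT x|lebesgue_on (?T \<union> (?B \<union> (?R \<union> ?L))). (u x)\<^sup>2) \<le> (LINT x|lebesgue_on ?T. (u x)\<^sup>2) + (LINT x|lebesgue_on (?B \<union> (?R \<union> ?L)). (u x)\<^sup>2)"
    by (rule un) (use sub rs in auto)
  moreover have "(LINT x|lebesgue_on (?B \<union> (?R \<union> ?L)). (u x)\<^sup>2) \<le> (LINT x|lebesgue_on ?B. (u x)\<^sup>2) + (LINT x|lebesgue_on (?R \<union> ?L). (u x)\<^sup>2)"
    by (rule un) (use sub rs in auto)
  moreover have "(LINT x|lebesgue_on (?R \<union> ?L). (u x)\<^sup>2) \<le> (LINT x|lebesgue_on ?R. (u x)\<^sup>2) + (LINT x|lebesgue_on ?L. (u x)\<^sup>2)"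
    by (rule un) (use sub rs in auto)
  \<comment> \<open>The pieces add up to 48 + 240 + 4 * 11100 = 44688.\<close>
  ultimately have "(LINT x|lebesgue_on ?S. (u x)\<^sup>2) \<le> 45000 * D"
    using X Ch sides D0 by linarith
  then show ?thesis by (simp add: D_def)
qed

section \<open>The trial function and the upper bound for the second eigenvalue\<close>

lemma DERIV_max_0_power2: "((\<lambda>z. (max 0 z)\<^sup>2) has_real_derivative 2 * max 0 z) (at (z :: real))"
proof -
  consider "z > 0" | "z < 0" | "z = 0" by linarith
  then show ?thesis
  proof cases
    case 1
    have "((\<lambda>z. z\<^sup>2) has_real_derivative 2 * z) (at z)" by (auto intro!: derivative_eq_intros)
    then have "((\<lambda>z. (max 0 z)\<^sup>2) has_real_derivative 2 * z) (at z)"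
      by (rule has_field_derivative_transform_within_open[where S = "{0<..}"]) (use 1 in auto)
    then show ?thesis using 1 by simp
  next
    case 2
    have "((\<lambda>z. 0) has_real_derivative 0) (at z)" by simp
    then have "((\<lambda>z. (max 0 z)\<^sup>2) has_real_derivative 0) (at z)"
      by (rule has_field_derivative_transform_within_open[where S = "{..<0}"]) (use 2 in auto)
    then show ?thesis using 2 by simp
  next
    case 3
    have "((\<lambda>h::real. (max 0 h)\<^sup>2 / h) \<longlongrightarrow> 0) (at 0)"
    proof (rule Lim_null_comparison[where g = abs])
      show "\<forall>\<^sub>F h in at 0. norm ((max 0 h)\<^sup>2 / h) \<le> \<bar>h :: real\<bar>"
        by (intro always_eventually allI) (auto simp: max_def power2_eq_square)
      show "(abs \<longlongrightarrow> (0::real)) (at 0)" using tendsto_rabs_zero[OF tendsto_ident_at] by simp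
    qed
    then have "((\<lambda>z. (max 0 z)\<^sup>2) has_real_derivative 0) (at (0::real))" by (simp add: DERIV_def)
    then show ?thesis using 3 by simp
  qed
qed

text \<open>A cutoff from \<open>[-1, 1]\<close> to \<open>[-2, 2]\<close>; the squares of the positive parts make it \<open>C\<^sup>1\<close>.\<close>

definition cutoff :: "real \<Rightarrow> real" where
  "cutoff t = (max 0 (9 - (max 0 (t\<^sup>2 - 1))\<^sup>2))\<^sup>2 / 81"

definition cutoff' :: "real \<Rightarrow> real" where
  "cutoff' t = - 8 * t * max 0 (t\<^sup>2 - 1) * max 0 (9 - (max 0 (t\<^sup>2 - 1))\<^sup>2) / 81"

lemma DERIV_cutoff: "(cutoff has_real_derivative cutoff' t) (at t)"
proof -
  have 1: "((\<lambda>t. 9 - (max 0 (t\<^sup>2 - 1))\<^sup>2) has_real_derivative - (2 * max 0 (t\<^sup>2 - 1) * (2 * t))) (at t)"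
  proof -
    have "((\<lambda>t. t\<^sup>2 - 1) has_real_derivative 2 * t) (at t)" by (auto intro!: derivative_eq_intros)
    from DERIV_diff[OF DERIV_const DERIV_chain2[OF DERIV_max_0_power2 this], of 9] show ?thesis by simp
  qed
  show ?thesis
    unfolding cutoff_def [abs_def]
    by (rule DERIV_cong[OF DERIV_cdivide[OF DERIV_chain2[OF DERIV_max_0_power2 1]]]) (simp add: cutoff'_def)
qed

lemma continuous_cutoff: "continuous_on UNIV cutoff" "continuous_on UNIV cutoff'"
  unfolding cutoff_def [abs_def] cutoff'_def [abs_def] by (auto intro!: continuous_intros)

lemma cutoff_inner: "\<bar>t\<bar> \<le> 1 \<Longrightarrow> cutoff t = 1" "\<bar>t\<bar> \<le> 1 \<Longrightarrow> cutoff' t = 0"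
proof -
  assume "\<bar>t\<bar> \<le> 1"
  then have "t\<^sup>2 \<le> 1" by (simp add: abs_square_le_1)
  then have "max 0 (t\<^sup>2 - 1) = 0" by simp
  then show "cutoff t = 1" "cutoff' t = 0" by (simp_all add: cutoff_def cutoff'_def)
qed

lemma cutoff_outer: "\<bar>t\<bar> \<ge> 2 \<Longrightarrow> cutoff t = 0" "\<bar>t\<bar> \<ge> 2 \<Longrightarrow> cutoff' t = 0"
proof -
  assume "\<bar>t\<bar> \<ge> 2"
  then have "t\<^sup>2 \<ge> 4" using abs_le_square_iff[of 2 t] by simp
  \<comment> \<open>The 9 in \<open>cutoff\<close> is (2^2 - 1)^2, which makes the outer positive
    part vanish from 2 on.\<close>
  then have "(max 0 (t\<^sup>2 - 1))\<^sup>2 \<ge> 3\<^sup>2" by (intro power_mono) auto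
  then have "max 0 (9 - (max 0 (t\<^sup>2 - 1))\<^sup>2) = 0" by simp
  then show "cutoff t = 0" "cutoff' t = 0" by (simp_all add: cutoff_def cutoff'_def)
qed

lemma cutoff'_bound: "\<bar>cutoff' t\<bar> \<le> 6"
proof (cases "\<bar>t\<bar> \<ge> 2")
  case False
  then have t: "\<bar>t\<bar> \<le> 2" "t\<^sup>2 \<le> 4" using abs_le_square_iff[of t 2] by auto
  have "\<bar>cutoff' t\<bar> = 8 * \<bar>t\<bar> * \<bar>max 0 (t\<^sup>2 - 1)\<bar> * \<bar>max 0 (9 - (max 0 (t\<^sup>2 - 1))\<^sup>2)\<bar> / 81"
    by (simp add: cutoff'_def abs_mult)
  \<comment> \<open>The factors are bounded on [-2, 2] one by one; 432 / 81 is less than 6.\<close>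
  also have "8 * \<bar>t\<bar> * \<bar>max 0 (t\<^sup>2 - 1)\<bar> * \<bar>max 0 (9 - (max 0 (t\<^sup>2 - 1))\<^sup>2)\<bar> \<le> 8 * 2 * 3 * 9"
    using t by (intro mult_mono) auto
  finally show ?thesis by simp
qed (simp add: cutoff_outer)

text \<open>The product of two cutoffs is 1 on the square and 0 on the ring, so inside the domain
  its gradient lives in the strip. There the first factor is constantly 1, and the Dirichlet
  integral is at most 36 times the area 12 w. Subtracting the mean c leaves a squared norm of at
  least 12/5, and 432 / (12/5) = 180.\<close>

lemma ring_domain_eigenvalue_le:
  assumes w: "0 < w" "w < 1"
  shows "neumann_eigenvalue (ring_domain w) 2 \<le> 180 * w"
proof -
  let ?S = "ring_domain w"
  define v where "v x = cutoff (x $ 1) * cutoff (x $ 2)" for x :: "real^2"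
  define G where "G x = (cutoff' (x $ 1) * cutoff (x $ 2)) *\<^sub>R axis 1 1 + (cutoff (x $ 1) * cutoff' (x $ 2)) *\<^sub>R (axis 2 1 :: real^2)" for x :: "real^2"
  have Gi: "G x $ 1 = cutoff' (x $ 1) * cutoff (x $ 2)" "G x $ 2 = cutoff (x $ 1) * cutoff' (x $ 2)" for x
    by (auto simp: G_def axis_def)
  have SS: "?S \<in> sets lebesgue" using lmeasurable_ring_domain by (rule fmeasurableD)
  have rs: "rect a b c d \<in> sets lebesgue" for a b c d using lmeasurable_rect by (rule fmeasurableD)
  have sub: "rect (-1) 1 (-1) 1 \<subseteq> ?S" "rect (-w) w (-3) 3 \<subseteq> ?S" "rect 2 3 (-3) 3 \<subseteq> ?S"
    unfolding ring_domain_def by auto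
  have H: "has_H1_gradient ?S v G"
  proof (rule has_H1_gradient_C1[OF _ _ lmeasurable_ring_domain bounded_ring_domain])
    show "(v has_derivative (\<lambda>h. G x \<bullet> h)) (at x)" for x
    proof -
      have "(v has_derivative (\<lambda>h. cutoff (x $ 1) * (h $ 2 * cutoff' (x $ 2)) + (h $ 1 * cutoff' (x $ 1)) * cutoff (x $ 2))) (at x)"
        unfolding v_def [abs_def] by (rule has_derivative_mult[OF has_derivative_component has_derivative_component]; rule DERIV_cutoff)
      then show ?thesis by (rule has_derivative_eq_rhs) (simp add: inner_vec_def sum_2 Gi fun_eq_iff)
    qed
    show "continuous_on UNIV G"
      unfolding G_def [abs_def]
      by (intro continuous_intros continuous_on_compose2[OF continuous_cutoff(1)] continuous_on_compose2[OF continuous_cutoff(2)]) auto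
  qed
  note vs = has_H1_gradientD(1)[OF H]
  have pos: "measure lebesgue ?S > 0"
  proof -
    have "measure lebesgue (rect (-1) 1 (-1) 1) \<le> measure lebesgue ?S"
      by (rule measure_mono_fmeasurable[OF sub(1) rs lmeasurable_ring_domain])
    then show ?thesis by (simp add: measure_rect)
  qed
  define c where "c = (LINT x|lebesgue_on ?S. v x) / measure lebesgue ?S"
  have H0: "has_H1_gradient ?S (\<lambda>x. v x - c) G"
    using has_H1_gradient_lincomb[OF H has_H1_gradient_const[OF lmeasurable_ring_domain bounded_ring_domain, of w c] lmeasurable_ring_domain, of 1 "-1"]
    by simp
  interpret finite_measure "lebesgue_on ?S" by (rule finite_measure_lebesgue_on[OF lmeasurable_ring_domain])
  have mean: "(LINT x|lebesgue_on ?S. v x - c) = 0"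
    using square_integrable_on_real(3)[OF vs lmeasurable_ring_domain] pos SS by (simp add: c_def measure_lebesgue_on_space)
  have i0: "integrable (lebesgue_on ?S) (\<lambda>x. (v x - c)\<^sup>2)"
    by (rule square_integrable_on_real(1)[OF has_H1_gradientD(1)[OF H0]])
  have const: "(LINT x|lebesgue_on Q. (v x - c)\<^sup>2) = (y - c)\<^sup>2 * measure lebesgue Q" if "Q \<in> sets lebesgue" "\<And>x. x \<in> Q \<Longrightarrow> v x = y" for Q y
  proof -
    have "(LINT x|lebesgue_on Q. (v x - c)\<^sup>2) = (LINT x|lebesgue_on Q. (y - c)\<^sup>2)"
      by (rule Bochner_Integration.integral_cong) (use that in \<open>auto simp: space_restrict_space\<close>)
    then show ?thesis using that(1) by (simp add: measure_lebesgue_on_space)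
  qed
  have "(LINT x|lebesgue_on (rect (-1) 1 (-1) 1). (v x - c)\<^sup>2) + (LINT x|lebesgue_on (rect 2 3 (-3) 3). (v x - c)\<^sup>2) \<le>
    (LINT x|lebesgue_on ?S. (v x - c)\<^sup>2)"
    by (rule integral_lebesgue_on_disjoint[OF i0 SS rs sub(1) rs sub(3)]) (auto simp: rect_def)
  moreover have "(LINT x|lebesgue_on (rect (-1) 1 (-1) 1). (v x - c)\<^sup>2) = (1 - c)\<^sup>2 * 4"
  proof -
    have "v x = 1" if "x \<in> rect (-1) 1 (-1) 1" for x
      using that by (auto simp: v_def cutoff_inner rect_def)
    from const[OF rs this] show ?thesis by (simp add: measure_rect)
  qed
  moreover have "(LINT x|lebesgue_on (rect 2 3 (-3) 3). (v x - c)\<^sup>2) = (0 - c)\<^sup>2 * 6"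
  proof -
    have "v x = 0" if "x \<in> rect 2 3 (-3) 3" for x
      using that by (auto simp: v_def cutoff_outer rect_def)
    from const[OF rs this] show ?thesis by (simp add: measure_rect)
  qed
  \<comment> \<open>The minimum over c, attained at 2/5; the weights are the areas of the square and
    of one side of the ring.\<close>
  moreover have "24 / 10 \<le> (1 - c)\<^sup>2 * 4 + (0 - c)\<^sup>2 * 6"
    using zero_le_power2[of "5 * c - 2"] by (simp add: power2_eq_square algebra_simps)
  ultimately have lower: "24 / 10 \<le> (LINT x|lebesgue_on ?S. (v x - c)\<^sup>2)" by linarith
  have Gbound: "(norm (G x))\<^sup>2 \<le> 36 * indicator (rect (-w) w (-3) 3) x" if "x \<in> ?S" for x
  proof (cases "x \<in> rect (-w) w (-3) 3")
    case True
    then have "\<bar>x $ 1\<bar> \<le> 1" using w by (auto simp: rect_def)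
    then have "(norm (G x))\<^sup>2 = (cutoff' (x $ 2))\<^sup>2" by (simp add: norm_power2_vec2 Gi cutoff_inner)
    also have "\<dots> \<le> 6\<^sup>2" using cutoff'_bound[of "x $ 2"] abs_le_square_iff[of "cutoff' (x $ 2)" 6] by simp
    finally show ?thesis using True by simp
  next
    case False
    have "\<bar>x $ 1\<bar> \<ge> 2 \<or> \<bar>x $ 2\<bar> \<ge> 2 \<or> \<bar>x $ 1\<bar> \<le> 1 \<and> \<bar>x $ 2\<bar> \<le> 1"
      using that False w unfolding ring_domain_iff[OF w] rect_def by auto
    then have "G x = 0"
      by (auto simp: vec_eq_iff forall_2 Gi cutoff_inner cutoff_outer)
    then show ?thesis by simp
  qed
  have "(LINT x|lebesgue_on ?S. (norm (G x))\<^sup>2) \<le> (LINT x|lebesgue_on ?S. 36 * indicator (rect (-w) w (-3) 3) x)"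
  proof (rule integral_mono)
    show "integrable (lebesgue_on ?S) (\<lambda>x. (norm (G x))\<^sup>2)"
      using has_H1_gradientD(2)[OF H] by (simp add: square_integrable_on_def)
    show "integrable (lebesgue_on ?S) (\<lambda>x. 36 * indicator (rect (-w) w (-3) 3) x :: real)"
      using rs[of "-w" w "-3" 3] SS sub(2)
      by (intro integrable_mult_right integrable_real_indicator)
        (auto simp: sets_restrict_space_iff emeasure_finite less_top[symmetric])
    show "(norm (G x))\<^sup>2 \<le> 36 * indicator (rect (-w) w (-3) 3) x" if "x \<in> space (lebesgue_on ?S)" for x
      using Gbound[of x] that by (simp add: space_restrict_space)
  qed
  also have "\<dots> = 36 * measure lebesgue (rect (-w) w (-3) 3)"
    using rs[of "-w" w "-3" 3] SS sub(2) by (simp add: measure_restrict_space sets_restrict_space_iff Int_absorb2)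
  also have "\<dots> = 432 * w" using w by (simp add: measure_rect)
  finally have upper: "(LINT x|lebesgue_on ?S. (norm (G x))\<^sup>2) \<le> 432 * w" .
  have "neumann_eigenvalue ?S 2 * (LINT x|lebesgue_on ?S. (v x - c)\<^sup>2) \<le> (LINT x|lebesgue_on ?S. (norm (G x))\<^sup>2)"
    by (rule neumann_eigenvalue_2_le[OF lmeasurable_ring_domain bounded_ring_domain pos _ H0 mean])
      (rule finite_rank_gap_ring_domain[OF w(1)])
  with upper have "neumann_eigenvalue ?S 2 * (LINT x|lebesgue_on ?S. (v x - c)\<^sup>2) \<le> 432 * w" by linarith
  then show ?thesis
  proof (cases "neumann_eigenvalue ?S 2 \<le> 0")
    case False
    then have "neumann_eigenvalue ?S 2 * (24 / 10) \<le> neumann_eigenvalue ?S 2 * (LINT x|lebesgue_on ?S. (v x - c)\<^sup>2)"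
      using lower by (intro mult_left_mono) auto
    also have "\<dots> \<le> 432 * w" by fact
    finally show ?thesis by simp
  qed (use w in simp)
qed

lemma ring_domain_symmetric_eigenfunctions:
  assumes w: "0 < w" "w \<le> 1 / 10 ^ 7"
    and \<psi>: "neumann_eigenfunction (ring_domain w) (neumann_eigenvalue (ring_domain w) 2) \<psi>"
  shows "symmetric_on_closure (ring_domain w) \<psi>"
proof -
  have w1: "w < 1" using w by simp
  show ?thesis
  proof (rule neumann_eigenspace_symmetric[OF open_ring_domain lmeasurable_ring_domain uminus_ring_domain])
    show "45000 * neumann_eigenvalue (ring_domain w) 2 < 1"
      using ring_domain_eigenvalue_le[OF w(1) w1] w by simp
    show "\<psi> \<in> neumann_eigenspace (ring_domain w) (neumann_eigenvalue (ring_domain w) 2)"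
      using \<psi> by (simp add: neumann_eigenfunction_def)
  qed (rule ring_domain_odd_Poincare[OF w(1) w1])
qed

section \<open>The boundary of the domain\<close>

text \<open>The rectangles are added one at a time, each meeting the union so far in an explicit
  point; the strip comes first, since it links the square to the ring.\<close>

lemma connected_ring_domain:
  assumes "0 < w" "w < 1" shows "connected (ring_domain w)"
proof -
  have c: "connected (rect a b c d)" for a b c d
    by (rule convex_connected[OF convex_rect])
  have mem: "vector [p, q] \<in> rect a b c d \<longleftrightarrow> a < p \<and> p < b \<and> c < q \<and> q < d" for p q a b c d
    by (simp add: rect_def)
  let ?X = "rect (-1) 1 (-1) 1" and ?C = "rect (-w) w (-3) 3" and ?T = "rect (-3) 3 2 3"
    and ?B = "rect (-3) 3 (-3) (-2)" and ?R = "rect 2 3 (-3) 3" and ?L = "rect (-3) (-2) (-3) 3"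
  have "vector [0, 0] \<in> ?C \<inter> ?X" using assms by (simp add: mem)
  then have 1: "connected (?C \<union> ?X)" by (intro connected_Un c) blast
  have "vector [0, 5 / 2] \<in> (?C \<union> ?X) \<inter> ?T" using assms by (simp add: mem)
  then have 2: "connected (?C \<union> ?X \<union> ?T)" by (intro connected_Un[OF 1] c) blast
  have "vector [0, - 5 / 2] \<in> (?C \<union> ?X \<union> ?T) \<inter> ?B" using assms by (simp add: mem)
  then have 3: "connected (?C \<union> ?X \<union> ?T \<union> ?B)" by (intro connected_Un[OF 2] c) blast
  have "vector [5 / 2, 5 / 2] \<in> (?C \<union> ?X \<union> ?T \<union> ?B) \<inter> ?R" using assms by (simp add: mem)
  then have 4: "connected (?C \<union> ?X \<union> ?T \<union> ?B \<union> ?R)" by (intro connected_Un[OF 3] c) blast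
  have "vector [- 5 / 2, 5 / 2] \<in> (?C \<union> ?X \<union> ?T \<union> ?B \<union> ?R) \<inter> ?L" using assms by (simp add: mem)
  then have 5: "connected (?C \<union> ?X \<union> ?T \<union> ?B \<union> ?R \<union> ?L)" by (intro connected_Un[OF 4] c) blast
  have "ring_domain w = ?C \<union> ?X \<union> ?T \<union> ?B \<union> ?R \<union> ?L"
    unfolding ring_domain_def by blast
  with 5 show ?thesis by simp
qed

text \<open>The condition of \<open>lipschitz_boundary\<close> at a single point, split off so that
  edges and corners can be treated separately.\<close>

definition lipschitz_graph_at :: "(real^2) set \<Rightarrow> real^2 \<Rightarrow> bool" where
  "lipschitz_graph_at S p \<longleftrightarrow> (\<exists>r (T :: real^2 \<Rightarrow> real^2) (\<gamma> :: real \<Rightarrow> real) L.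
     r > 0 \<and> orthogonal_transformation T \<and> L-lipschitz_on UNIV \<gamma> \<and>
     S \<inter> ball p r = {x \<in> ball p r. \<gamma> (T x $ 1) < T x $ 2})"

lemma orthogonal_transformation_vec2:
  fixes a b c d :: real
  assumes "a\<^sup>2 + c\<^sup>2 = 1" "b\<^sup>2 + d\<^sup>2 = 1" "a * b + c * d = 0"
  shows "orthogonal_transformation (\<lambda>x :: real^2. vector [a * x $ 1 + b * x $ 2, c * x $ 1 + d * x $ 2] :: real^2)"
  unfolding orthogonal_transformation
proof (intro conjI allI)
  let ?T = "\<lambda>x :: real^2. vector [a * x $ 1 + b * x $ 2, c * x $ 1 + d * x $ 2] :: real^2"
  show "linear ?T"
    by (rule linearI) (simp_all add: vec_eq_iff forall_2 algebra_simps)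
  fix v :: "real^2"
  have "(norm (?T v))\<^sup>2 = (a\<^sup>2 + c\<^sup>2) * (v $ 1)\<^sup>2 + (b\<^sup>2 + d\<^sup>2) * (v $ 2)\<^sup>2 + 2 * (a * b + c * d) * (v $ 1 * v $ 2)"
    unfolding norm_power2_vec2 by (simp add: power2_eq_square algebra_simps)
  also have "\<dots> = (norm v)\<^sup>2" unfolding assms by (simp add: norm_power2_vec2)
  finally show "norm (?T v) = norm v" by (rule power2_eq_imp_eq) auto
qed

text \<open>T brings the i-th coordinate, with the sign \<sigma>, into second place; the graph is
  then constant.\<close>

lemma lipschitz_graph_at_halfplane:
  assumes r: "r > 0" and \<sigma>: "\<sigma> = 1 \<or> \<sigma> = -1"
    and eq: "\<And>x. x \<in> ball p r \<Longrightarrow> x \<in> S \<longleftrightarrow> 0 < \<sigma> * (x $ i - p $ i)"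
  shows "lipschitz_graph_at S p"
proof -
  have s: "\<sigma>\<^sup>2 = 1" using \<sigma> by auto
  define T :: "real^2 \<Rightarrow> real^2" where
    "T = (if i = 1 then (\<lambda>x. vector [0 * x $ 1 + 1 * x $ 2, \<sigma> * x $ 1 + 0 * x $ 2])
      else (\<lambda>x. vector [1 * x $ 1 + 0 * x $ 2, 0 * x $ 1 + \<sigma> * x $ 2]))"
  have "orthogonal_transformation T"
  proof (cases "i = 1")
    case True
    show ?thesis unfolding T_def if_P[OF True] by (rule orthogonal_transformation_vec2) (use s in auto)
  next
    case False
    show ?thesis unfolding T_def if_not_P[OF False] by (rule orthogonal_transformation_vec2) (use s in auto)
  qed
  moreover have "T x $ 2 = \<sigma> * x $ i" for x
    using exhaust_2[of i] by (auto simp: T_def)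
  moreover have "0-lipschitz_on UNIV (\<lambda>t :: real. \<sigma> * p $ i)" by (rule lipschitz_on_constant)
  moreover have "S \<inter> ball p r = {x \<in> ball p r. \<sigma> * p $ i < \<sigma> * x $ i}"
    using eq by (auto simp: right_diff_distrib)
  ultimately show ?thesis
    unfolding lipschitz_graph_at_def using r
    by (intro exI[of _ r] exI[of _ T] exI[of _ "\<lambda>t. \<sigma> * p $ i"] exI[of _ 0]) simp
qed

text \<open>At a corner the coordinates are rotated by \<open>\<pi>/4\<close>, which turns a quadrant and its complement
  into the regions above the graphs of \<open>\<bar>t\<bar>\<close> and \<open>- \<bar>t\<bar>\<close>.\<close>

lemma lipschitz_graph_at_corner:
  assumes r: "r > 0" and \<sigma>: "\<sigma> = 1 \<or> \<sigma> = -1" and \<tau>: "\<tau> = 1 \<or> \<tau> = -1"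
    and eq: "(\<forall>x \<in> ball p r. x \<in> S \<longleftrightarrow> 0 < \<sigma> * (x $ 1 - p $ 1) \<and> 0 < \<tau> * (x $ 2 - p $ 2)) \<or>
      (\<forall>x \<in> ball p r. x \<in> S \<longleftrightarrow> 0 < \<sigma> * (x $ 1 - p $ 1) \<or> 0 < \<tau> * (x $ 2 - p $ 2))"
  shows "lipschitz_graph_at S p"
proof -
  have s: "\<sigma>\<^sup>2 = 1" "\<tau>\<^sup>2 = 1" using \<sigma> \<tau> by auto
  \<comment> \<open>The common value of sine and cosine at \<pi>/4.\<close>
  define h where "h = 1 / sqrt (2 :: real)"
  have h: "h > 0" "h\<^sup>2 = 1 / 2" by (auto simp: h_def power_divide)
  define T :: "real^2 \<Rightarrow> real^2" where
    "T = (\<lambda>x. vector [h * \<sigma> * x $ 1 + - h * \<tau> * x $ 2, h * \<sigma> * x $ 1 + h * \<tau> * x $ 2])"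
  have T: "orthogonal_transformation T"
    unfolding T_def by (rule orthogonal_transformation_vec2) (auto simp: power_mult_distrib s h)
  define a where "a x = \<sigma> * (x $ 1 - p $ 1)" for x :: "real^2"
  define b where "b x = \<tau> * (x $ 2 - p $ 2)" for x :: "real^2"
  have Tab: "T x $ 1 - T p $ 1 = h * (a x - b x)" "T x $ 2 = T p $ 2 + h * (a x + b x)" for x
    by (auto simp: T_def a_def b_def algebra_simps)
  have habs: "\<bar>T x $ 1 - T p $ 1\<bar> = h * \<bar>a x - b x\<bar>" for x
    unfolding Tab using h(1) by (simp add: abs_mult)
  \<comment> \<open>u + v - \<bar>u - v\<bar> is twice the minimum of u and v, and u + v + \<bar>u -
    v\<bar> is twice their maximum.\<close>
  have quadrant: "\<bar>u - v\<bar> < u + v \<longleftrightarrow> 0 < u \<and> 0 < v" "- \<bar>u - v\<bar> < u + v \<longleftrightarrow> 0 < u \<or> 0 < v" for u v :: real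
    by (auto simp: abs_if)
  have mult_h: "h * u < h * v \<longleftrightarrow> u < v" for u v
    by (rule mult_less_cancel_left_pos[OF h(1)])
  from eq show ?thesis
  proof
    assume eq: "\<forall>x \<in> ball p r. x \<in> S \<longleftrightarrow> 0 < \<sigma> * (x $ 1 - p $ 1) \<and> 0 < \<tau> * (x $ 2 - p $ 2)"
    let ?\<gamma> = "\<lambda>t. T p $ 2 + \<bar>t - T p $ 1\<bar>"
    have "?\<gamma> (T x $ 1) < T x $ 2 \<longleftrightarrow> 0 < a x \<and> 0 < b x" for x
      by (simp only: habs Tab(2)[of x] add_less_cancel_left mult_h quadrant)
    then have "S \<inter> ball p r = {x \<in> ball p r. ?\<gamma> (T x $ 1) < T x $ 2}"
      using eq by (auto simp: a_def b_def)
    moreover have "1-lipschitz_on UNIV ?\<gamma>" by (rule lipschitz_onI) (auto simp: dist_real_def)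
    ultimately show ?thesis unfolding lipschitz_graph_at_def using r T by blast
  next
    assume eq: "\<forall>x \<in> ball p r. x \<in> S \<longleftrightarrow> 0 < \<sigma> * (x $ 1 - p $ 1) \<or> 0 < \<tau> * (x $ 2 - p $ 2)"
    let ?\<gamma> = "\<lambda>t. T p $ 2 + - \<bar>t - T p $ 1\<bar>"
    have "?\<gamma> (T x $ 1) < T x $ 2 \<longleftrightarrow> 0 < a x \<or> 0 < b x" for x
      by (simp only: habs Tab(2)[of x] add_less_cancel_left mult_minus_right[symmetric] mult_h quadrant)
    then have "S \<inter> ball p r = {x \<in> ball p r. ?\<gamma> (T x $ 1) < T x $ 2}"
      using eq by (auto simp: a_def b_def)
    moreover have "1-lipschitz_on UNIV ?\<gamma>" by (rule lipschitz_onI) (auto simp: dist_real_def)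
    ultimately show ?thesis unfolding lipschitz_graph_at_def using r T by blast
  qed
qed

text \<open>Membership depends only on comparing \<bar>x1\<bar> and \<bar>x2\<bar> with w, 1, 2 and
  3. In a small ball around p every comparison with a number other than the coordinate of p itself
  keeps its outcome, so the domain is locally given by the remaining one or two: a half plane, a
  quadrant or the complement of one.\<close>

lemma lipschitz_boundary_ring_domain:
  assumes w: "0 < w" "w < 1" shows "lipschitz_boundary (ring_domain w)"
proof -
  let ?S = "ring_domain w"
  have "lipschitz_graph_at ?S p" if p: "p \<in> frontier ?S" for p
  proof -
    let ?a = "\<bar>p $ 1\<bar>" and ?b = "\<bar>p $ 2\<bar>"
    have "closed {x :: real^2. \<bar>x $ 1\<bar> \<le> 3 \<and> \<bar>x $ 2\<bar> \<le> 3 \<and>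
      (\<bar>x $ 1\<bar> \<ge> 2 \<or> \<bar>x $ 2\<bar> \<ge> 2 \<or> \<bar>x $ 1\<bar> \<le> w \<or> \<bar>x $ 1\<bar> \<le> 1 \<and> \<bar>x $ 2\<bar> \<le> 1)}"
      by (intro closed_Collect_conj closed_Collect_disj closed_Collect_le continuous_intros)
    moreover have "?S \<subseteq> {x :: real^2. \<bar>x $ 1\<bar> \<le> 3 \<and> \<bar>x $ 2\<bar> \<le> 3 \<and>
      (\<bar>x $ 1\<bar> \<ge> 2 \<or> \<bar>x $ 2\<bar> \<ge> 2 \<or> \<bar>x $ 1\<bar> \<le> w \<or> \<bar>x $ 1\<bar> \<le> 1 \<and> \<bar>x $ 2\<bar> \<le> 1)}"
      using ring_domain_iff[OF w] by auto
    ultimately have "closure ?S \<subseteq> {x :: real^2. \<bar>x $ 1\<bar> \<le> 3 \<and> \<bar>x $ 2\<bar> \<le> 3 \<and>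
      (\<bar>x $ 1\<bar> \<ge> 2 \<or> \<bar>x $ 2\<bar> \<ge> 2 \<or> \<bar>x $ 1\<bar> \<le> w \<or> \<bar>x $ 1\<bar> \<le> 1 \<and> \<bar>x $ 2\<bar> \<le> 1)}"
      by (intro closure_minimal)
    with p have cl: "?a \<le> 3" "?b \<le> 3" "?a \<ge> 2 \<or> ?b \<ge> 2 \<or> ?a \<le> w \<or> ?a \<le> 1 \<and> ?b \<le> 1"
      unfolding frontier_def by auto
    have "p \<notin> ?S" using p frontier_disjoint_eq[of ?S] open_ring_domain[of w] by auto
    then have ncl: "?a = 3 \<or> ?b = 3 \<or> ?a \<le> 2 \<and> ?b \<le> 2 \<and> ?a \<ge> w \<and> (?a \<ge> 1 \<or> ?b \<ge> 1)"
      using cl(1,2) unfolding ring_domain_iff[OF w] by argo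
    \<comment> \<open>The thresholds; r will be at most the distance to each one that p does not
      hit. 0 is included so that in the ball a nonzero coordinate keeps its sign, which turns
      comparisons of absolute values into linear ones.\<close>
    define C where "C = {0, w, 1, 2, 3 :: real}"
    define R where "R = insert 1 ((\<lambda>c. \<bar>?a - c\<bar>) ` (C - {?a}) \<union> (\<lambda>c. \<bar>?b - c\<bar>) ` (C - {?b}))"
    define r where "r = Min R"
    have R: "finite R" "R \<noteq> {}" by (auto simp: R_def C_def)
    have r: "r > 0" unfolding r_def using R by (subst Min_gr_iff) (auto simp: R_def)
    have rc: "r \<le> \<bar>?a - c\<bar>" if "c \<in> C" "c \<noteq> ?a" for c
      unfolding r_def using R(1) that by (intro Min_le) (auto simp: R_def)
    have rd: "r \<le> \<bar>?b - c\<bar>" if "c \<in> C" "c \<noteq> ?b" for c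
      unfolding r_def using R(1) that by (intro Min_le) (auto simp: R_def)
    define \<epsilon> where "\<epsilon> i = (if p $ i \<ge> 0 then 1 else -1 :: real)" for i
    have \<epsilon>: "\<epsilon> i = 1 \<or> \<epsilon> i = -1" "- \<epsilon> i = 1 \<or> - \<epsilon> i = -1" for i by (auto simp: \<epsilon>_def)
    have near: "\<bar>x $ i - p $ i\<bar> < r" if "x \<in> ball p r" for x i
      using that component_le_norm_cart[of "x - p" i] by (simp add: dist_norm norm_minus_commute)
    have cmpa: "?a < c \<Longrightarrow> \<bar>x $ 1\<bar> < c" "c < ?a \<Longrightarrow> c < \<bar>x $ 1\<bar>"
      "?a < c \<Longrightarrow> \<not> c < \<bar>x $ 1\<bar>" "c < ?a \<Longrightarrow> \<not> \<bar>x $ 1\<bar> < c" if "x \<in> ball p r" "c \<in> C" for x c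
      using near[OF that(1), of 1] rc[OF that(2)] by linarith+
    have cmpb: "?b < c \<Longrightarrow> \<bar>x $ 2\<bar> < c" "c < ?b \<Longrightarrow> c < \<bar>x $ 2\<bar>"
      "?b < c \<Longrightarrow> \<not> c < \<bar>x $ 2\<bar>" "c < ?b \<Longrightarrow> \<not> \<bar>x $ 2\<bar> < c" if "x \<in> ball p r" "c \<in> C" for x c
      using near[OF that(1), of 2] rd[OF that(2)] by linarith+
    have sgna: "\<bar>x $ 1\<bar> < ?a \<longleftrightarrow> 0 < - \<epsilon> 1 * (x $ 1 - p $ 1)" "?a < \<bar>x $ 1\<bar> \<longleftrightarrow> 0 < \<epsilon> 1 * (x $ 1 - p $ 1)"
      if "x \<in> ball p r" "?a > 0" for x
      using near[OF that(1), of 1] rc[of 0] that(2) by (auto simp: \<epsilon>_def C_def abs_if split: if_splits)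
    have sgnb: "\<bar>x $ 2\<bar> < ?b \<longleftrightarrow> 0 < - \<epsilon> 2 * (x $ 2 - p $ 2)" "?b < \<bar>x $ 2\<bar> \<longleftrightarrow> 0 < \<epsilon> 2 * (x $ 2 - p $ 2)"
      if "x \<in> ball p r" "?b > 0" for x
      using near[OF that(1), of 2] rd[of 0] that(2) by (auto simp: \<epsilon>_def C_def abs_if split: if_splits)
    have C: "w \<in> C" "1 \<in> C" "2 \<in> C" "3 \<in> C" by (auto simp: C_def)
    note cmp = cmpa[OF _ C(1)] cmpa[OF _ C(2)] cmpa[OF _ C(3)] cmpa[OF _ C(4)]
      cmpb[OF _ C(1)] cmpb[OF _ C(2)] cmpb[OF _ C(3)] cmpb[OF _ C(4)]
    note hp = lipschitz_graph_at_halfplane[OF r] and co = lipschitz_graph_at_corner[OF r]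
    note iff = ring_domain_iff[OF w]
    \<comment> \<open>The twelve types of boundary points, up to signs. Cases 3 and 12 are convex
      corners, cases 4, 7 and 9 re-entrant ones; the others lie on edges.\<close>
    consider "?a = 3" "?b < 3" | "?b = 3" "?a < 3" | "?a = 3" "?b = 3"
      | "?a = 2" "?b = 2" | "?a = 2" "?b < 2" | "?b = 2" "w < ?a" "?a < 2" | "?b = 2" "?a = w"
      | "?a = w" "1 < ?b" "?b < 2" | "?a = w" "?b = 1"
      | "?a = 1" "?b < 1" | "?b = 1" "w < ?a" "?a < 1" | "?a = 1" "?b = 1"
      using cl ncl w by argo
    then show ?thesis
    proof cases
      case 1
      show ?thesis
      proof (rule hp[OF \<epsilon>(2)[of 1]])
        fix x assume x: "x \<in> ball p r"
        show "x \<in> ?S \<longleftrightarrow> 0 < - \<epsilon> 1 * (x $ 1 - p $ 1)"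
          using 1 w sgna[OF x] by (simp add: iff cmp[OF x])
      qed
    next
      case 2
      show ?thesis
      proof (rule hp[OF \<epsilon>(2)[of 2]])
        fix x assume x: "x \<in> ball p r"
        show "x \<in> ?S \<longleftrightarrow> 0 < - \<epsilon> 2 * (x $ 2 - p $ 2)"
          using 2 w sgnb[OF x] by (simp add: iff cmp[OF x])
      qed
    next
      case 3
      show ?thesis
      proof (rule co[OF \<epsilon>(2)[of 1] \<epsilon>(2)[of 2]], rule disjI1, rule ballI)
        fix x assume x: "x \<in> ball p r"
        show "x \<in> ?S \<longleftrightarrow> 0 < - \<epsilon> 1 * (x $ 1 - p $ 1) \<and> 0 < - \<epsilon> 2 * (x $ 2 - p $ 2)"
          using 3 w sgna[OF x] sgnb[OF x] by (simp add: iff cmp[OF x])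
      qed
    next
      case 4
      show ?thesis
      proof (rule co[OF \<epsilon>(1)[of 1] \<epsilon>(1)[of 2]], rule disjI2, rule ballI)
        fix x assume x: "x \<in> ball p r"
        show "x \<in> ?S \<longleftrightarrow> 0 < \<epsilon> 1 * (x $ 1 - p $ 1) \<or> 0 < \<epsilon> 2 * (x $ 2 - p $ 2)"
          using 4 w sgna[OF x] sgnb[OF x] by (simp add: iff cmp[OF x])
      qed
    next
      case 5
      show ?thesis
      proof (rule hp[OF \<epsilon>(1)[of 1]])
        fix x assume x: "x \<in> ball p r"
        show "x \<in> ?S \<longleftrightarrow> 0 < \<epsilon> 1 * (x $ 1 - p $ 1)"
          using 5 w sgna[OF x] by (simp add: iff cmp[OF x])
      qed
    next
      case 6
      show ?thesis
      proof (rule hp[OF \<epsilon>(1)[of 2]])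
        fix x assume x: "x \<in> ball p r"
        show "x \<in> ?S \<longleftrightarrow> 0 < \<epsilon> 2 * (x $ 2 - p $ 2)"
          using 6 w sgnb[OF x] by (simp add: iff cmp[OF x])
      qed
    next
      case 7
      show ?thesis
      proof (rule co[OF \<epsilon>(2)[of 1] \<epsilon>(1)[of 2]], rule disjI2, rule ballI)
        fix x assume x: "x \<in> ball p r"
        show "x \<in> ?S \<longleftrightarrow> 0 < - \<epsilon> 1 * (x $ 1 - p $ 1) \<or> 0 < \<epsilon> 2 * (x $ 2 - p $ 2)"
          using 7 w sgna[OF x] sgnb[OF x] by (simp add: iff cmp[OF x]) blast
      qed
    next
      case 8
      show ?thesis
      proof (rule hp[OF \<epsilon>(2)[of 1]])
        fix x assume x: "x \<in> ball p r"
        show "x \<in> ?S \<longleftrightarrow> 0 < - \<epsilon> 1 * (x $ 1 - p $ 1)"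
          using 8 w sgna[OF x] by (simp add: iff cmp[OF x])
      qed
    next
      case 9
      show ?thesis
      proof (rule co[OF \<epsilon>(2)[of 1] \<epsilon>(2)[of 2]], rule disjI2, rule ballI)
        fix x assume x: "x \<in> ball p r"
        show "x \<in> ?S \<longleftrightarrow> 0 < - \<epsilon> 1 * (x $ 1 - p $ 1) \<or> 0 < - \<epsilon> 2 * (x $ 2 - p $ 2)"
          using 9 w sgna[OF x] sgnb[OF x] by (simp add: iff cmp[OF x])
      qed
    next
      case 10
      show ?thesis
      proof (rule hp[OF \<epsilon>(2)[of 1]])
        fix x assume x: "x \<in> ball p r"
        show "x \<in> ?S \<longleftrightarrow> 0 < - \<epsilon> 1 * (x $ 1 - p $ 1)"
          using 10 w sgna[OF x] by (simp add: iff cmp[OF x])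
      qed
    next
      case 11
      show ?thesis
      proof (rule hp[OF \<epsilon>(2)[of 2]])
        fix x assume x: "x \<in> ball p r"
        show "x \<in> ?S \<longleftrightarrow> 0 < - \<epsilon> 2 * (x $ 2 - p $ 2)"
          using 11 w sgnb[OF x] by (simp add: iff cmp[OF x])
      qed
    next
      case 12
      show ?thesis
      proof (rule co[OF \<epsilon>(2)[of 1] \<epsilon>(2)[of 2]], rule disjI1, rule ballI)
        fix x assume x: "x \<in> ball p r"
        show "x \<in> ?S \<longleftrightarrow> 0 < - \<epsilon> 1 * (x $ 1 - p $ 1) \<and> 0 < - \<epsilon> 2 * (x $ 2 - p $ 2)"
          using 12 w sgna[OF x] sgnb[OF x] by (simp add: iff cmp[OF x])
      qed
    qed
  qed
  then show ?thesis unfolding lipschitz_boundary_def lipschitz_graph_at_def by blast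
qed

section \<open>The homeomorphism with a disk with two holes\<close>

text \<open>The image of A is described by the inverse map, as a preimage; membership in the new set
  is then decided by substituting into the description of A.\<close>

lemma homeomorphic_preimage:
  fixes f g :: "'a::topological_space \<Rightarrow> 'a"
  assumes "continuous_on UNIV f" "continuous_on UNIV g" "\<And>x. g (f x) = x" "\<And>y. f (g y) = y"
  shows "A homeomorphic {y. g y \<in> A}"
  unfolding homeomorphic_def homeomorphism_def
proof (rule exI[of _ f], rule exI[of _ g], intro conjI ballI)
  show "f ` A = {y. g y \<in> A}" using assms(3,4) by (auto simp: image_iff) metis
  show "g ` {y. g y \<in> A} = A" using assms(3) by (auto simp: image_iff) metis
  show "continuous_on A f" "continuous_on {y. g y \<in> A} g"
    using assms(1,2) by (auto intro: continuous_on_subset)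
qed (use assms in auto)

text \<open>The map \<open>t \<mapsto> t * stretch p q L M t\<close> of the half line is piecewise linear: it sends
  \<open>0, p, L\<close> to \<open>0, q, M\<close> and has slope \<open>1\<close> beyond \<open>L\<close>. Exchanging \<open>p, L\<close> with \<open>q, M\<close> inverts it.\<close>

definition stretch :: "real \<Rightarrow> real \<Rightarrow> real \<Rightarrow> real \<Rightarrow> real \<Rightarrow> real" where
  "stretch p q L M t = (q + (M - q) / (L - p) * (min (max t p) L - p) + max (t - L) 0) / max t p"

context
  fixes p q L M :: real
  assumes pq: "0 < p" "p < L" "0 < q" "q < M"
begin

lemma stretch_inner: "t \<le> p \<Longrightarrow> stretch p q L M t = q / p"
  using pq by (simp add: stretch_def max_def min_def)

lemma stretch_middle: "p \<le> t \<Longrightarrow> t \<le> L \<Longrightarrow> t * stretch p q L M t = q + (M - q) / (L - p) * (t - p)"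
  using pq by (simp add: stretch_def)

lemma stretch_outer: "L \<le> t \<Longrightarrow> t * stretch p q L M t = M + (t - L)"
  using pq by (simp add: stretch_def)

lemma stretch_middle_bounds:
  assumes "p \<le> t" "t \<le> L"
  shows "q \<le> t * stretch p q L M t" "t * stretch p q L M t \<le> M"
    "p < t \<Longrightarrow> q < t * stretch p q L M t" "t < L \<Longrightarrow> t * stretch p q L M t < M"
proof -
  let ?k = "(M - q) / (L - p)"
  have k: "?k > 0" "?k * (L - p) = M - q" using pq by auto
  have "?k * (t - p) \<le> ?k * (L - p)" using assms k by (intro mult_left_mono) auto
  moreover have "0 \<le> ?k * (t - p)" by (rule mult_nonneg_nonneg) (use assms k(1) in auto)
  moreover have "0 < ?k * (t - p)" if "p < t" by (rule mult_pos_pos) (use that k(1) in auto)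
  moreover have "?k * (t - p) < ?k * (L - p)" if "t < L" using that k by (intro mult_strict_left_mono) auto
  ultimately show "q \<le> t * stretch p q L M t" "t * stretch p q L M t \<le> M"
    "p < t \<Longrightarrow> q < t * stretch p q L M t" "t < L \<Longrightarrow> t * stretch p q L M t < M"
    unfolding stretch_middle[OF assms] k(2) by linarith+
qed

lemma stretch_pos: "0 \<le> t \<Longrightarrow> 0 < stretch p q L M t"
proof -
  assume t: "0 \<le> t"
  consider "t \<le> p" | "p \<le> t" "t \<le> L" | "L \<le> t" by linarith
  then show ?thesis
  proof cases
    case 1 then show ?thesis using pq by (simp add: stretch_inner)
  next
    case 2
    then have "0 < t * stretch p q L M t" using stretch_middle_bounds(1)[OF 2] pq by linarith
    then show ?thesis using t by (simp add: zero_less_mult_iff)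
  next
    case 3
    then have "0 < t * stretch p q L M t" using stretch_outer[OF 3] pq by linarith
    then show ?thesis using t by (simp add: zero_less_mult_iff)
  qed
qed

text \<open>The map increases and sends p to q and L to M, so comparisons with the breakpoints carry
  over.\<close>

lemma stretch_less_iff:
  assumes "0 \<le> t"
  shows "t * stretch p q L M t < q \<longleftrightarrow> t < p" "t * stretch p q L M t \<le> q \<longleftrightarrow> t \<le> p"
    "t * stretch p q L M t < M \<longleftrightarrow> t < L" "t * stretch p q L M t \<le> M \<longleftrightarrow> t \<le> L"
proof -
  have inner: "t * stretch p q L M t < q \<longleftrightarrow> t < p" "t * stretch p q L M t \<le> q" if "t \<le> p"
    using that pq by (auto simp: stretch_inner field_simps)
  consider "t \<le> p" | "p < t" "t < L" | "L \<le> t" by linarith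
  then have *: "(t * stretch p q L M t < q \<longleftrightarrow> t < p) \<and> (t * stretch p q L M t \<le> q \<longleftrightarrow> t \<le> p) \<and>
    (t * stretch p q L M t < M \<longleftrightarrow> t < L) \<and> (t * stretch p q L M t \<le> M \<longleftrightarrow> t \<le> L)"
  proof cases
    case 1 then show ?thesis using inner pq by linarith
  next
    case 2 then show ?thesis using stretch_middle_bounds[of t] pq by linarith
  next
    case 3 then show ?thesis using stretch_outer[of t] pq by linarith
  qed
  show "t * stretch p q L M t < q \<longleftrightarrow> t < p" "t * stretch p q L M t \<le> q \<longleftrightarrow> t \<le> p"
    "t * stretch p q L M t < M \<longleftrightarrow> t < L" "t * stretch p q L M t \<le> M \<longleftrightarrow> t \<le> L"
    using * by blast+
qed

end

text \<open>The inverse is stated for the factors, not for their products with t, because the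
  factors later multiply vectors and t = 0 has to be covered. For t <= p both factors are constant;
  beyond, the identity is multiplied by t > 0.\<close>

lemma stretch_inverse:
  assumes pq: "0 < p" "p < L" "0 < q" "q < M" and t: "0 \<le> t"
  shows "stretch q p M L (t * stretch p q L M t) * stretch p q L M t = 1"
proof -
  note pq' = pq(3,4,1,2)
  let ?u = "t * stretch p q L M t"
  show ?thesis
  proof (cases "t \<le> p")
    case True
    then have "?u \<le> q" using stretch_less_iff(2)[OF pq t] by blast
    then show ?thesis using stretch_inner[OF pq True] stretch_inner[OF pq', of ?u] pq by simp
  next
    case False
    have u: "?u > 0" using stretch_pos[OF pq t] False pq by simp
    have "?u * stretch q p M L ?u = t"
    proof (cases "t \<le> L")
      case True
      have b: "q \<le> ?u" "?u \<le> M" using stretch_middle_bounds(1,2)[OF pq] False True by auto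
      have eq: "?u = q + (M - q) / (L - p) * (t - p)" using stretch_middle[OF pq] False True by auto
      have "?u * stretch q p M L ?u = p + (L - p) / (M - q) * (?u - q)" by (rule stretch_middle[OF pq' b])
      also have "?u - q = (M - q) / (L - p) * (t - p)" using eq by linarith
      also have "p + (L - p) / (M - q) * ((M - q) / (L - p) * (t - p)) = t" using pq by simp
      finally show ?thesis .
    next
      case False
      then have eq: "?u = M + (t - L)" using stretch_outer[OF pq] by simp
      then have "?u * stretch q p M L ?u = L + (?u - M)" using False by (intro stretch_outer[OF pq']) simp
      then show ?thesis using eq by simp
    qed
    then have "t * (stretch q p M L ?u * stretch p q L M t) = t * 1" by (simp add: mult_ac)
    then show ?thesis using False pq by simp
  qed
qed

lemma signed_stretch_inverse:
  assumes "0 < p" "p < L" "0 < q" "q < L"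
  shows "u * stretch p q L L \<bar>u\<bar> * stretch q p L L \<bar>u * stretch p q L L \<bar>u\<bar>\<bar> = u"
proof -
  have "\<bar>u * stretch p q L L \<bar>u\<bar>\<bar> = \<bar>u\<bar> * stretch p q L L \<bar>u\<bar>"
    using stretch_pos[OF assms, of "\<bar>u\<bar>"] by (simp add: abs_mult)
  then show ?thesis using stretch_inverse[OF assms, of "\<bar>u\<bar>"] by (simp add: mult.assoc mult.commute)
qed

lemma stretch_fixed: "0 < p \<Longrightarrow> p < L \<Longrightarrow> 0 < q \<Longrightarrow> q < L \<Longrightarrow> L \<le> t \<Longrightarrow> stretch p q L L t = 1"
  using stretch_outer[of p L q L t] by simp

lemma continuous_on_stretch [continuous_intros]:
  fixes p q L M t :: "'a::topological_space \<Rightarrow> real"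
  assumes "continuous_on S p" "continuous_on S q" "continuous_on S L" "continuous_on S M" "continuous_on S t"
    "\<And>x. x \<in> S \<Longrightarrow> 0 < p x" "\<And>x. x \<in> S \<Longrightarrow> p x < L x"
  shows "continuous_on S (\<lambda>x. stretch (p x) (q x) (L x) (M x) (t x))"
proof -
  have "L x - p x \<noteq> 0" "max (t x) (p x) \<noteq> 0" if "x \<in> S" for x
    using assms(6,7)[OF that] by (auto simp: max_def)
  then show ?thesis unfolding stretch_def by (intro continuous_intros assms) auto
qed

lemma pair_vec_eta: "pair_vec (x $ 1, x $ 2) = x"
  by (auto simp: vec_eq_iff forall_2)

text \<open>Each vertical line is mapped to itself, with parameters that depend continuously on the
  line. The height k(y1) plays in the new set the role that p has in A, and from L on nothing
  moves.\<close>

lemma vertical_stretch_homeomorphic: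
  fixes k :: "real \<Rightarrow> real" and A :: "(real^2) set"
  assumes k: "continuous_on UNIV k" "\<And>x. 0 < k x" "\<And>x. k x < L" and p: "0 < p" "p < L"
  shows "A homeomorphic {y :: real^2. pair_vec (y $ 1, y $ 2 * stretch (k (y $ 1)) p L L \<bar>y $ 2\<bar>) \<in> A}"
    (is "_ homeomorphic {y. ?g y \<in> A}")
proof -
  let ?f = "\<lambda>y :: real^2. pair_vec (y $ 1, y $ 2 * stretch p (k (y $ 1)) L L \<bar>y $ 2\<bar>)"
  have kc: "continuous_on UNIV (\<lambda>y :: real^2. k (y $ 1))"
    by (rule continuous_on_compose2[OF k(1)]) (auto intro!: continuous_intros)
  have c: "continuous_on UNIV ?f" "continuous_on UNIV ?g"
    using k p by (auto intro!: continuous_intros kc)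
  have "?g (?f x) = x" "?f (?g x) = x" for x
    by (simp_all only: pair_vec_nth fst_conv snd_conv signed_stretch_inverse[OF p k(2,3)]
        signed_stretch_inverse[OF k(2,3) p] pair_vec_eta)
  with c show ?thesis by (rule homeomorphic_preimage)
qed

text \<open>Here the variable breakpoint is on the side of A: a boundary curve \<bar>x1\<bar> =
  k(x2) becomes the straight line \<bar>y1\<bar> = p.\<close>

lemma horizontal_stretch_homeomorphic:
  fixes k :: "real \<Rightarrow> real" and A :: "(real^2) set"
  assumes k: "continuous_on UNIV k" "\<And>x. 0 < k x" "\<And>x. k x < L" and p: "0 < p" "p < L"
  shows "A homeomorphic {y :: real^2. pair_vec (y $ 1 * stretch p (k (y $ 2)) L L \<bar>y $ 1\<bar>, y $ 2) \<in> A}"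
    (is "_ homeomorphic {y. ?g y \<in> A}")
proof -
  let ?f = "\<lambda>y :: real^2. pair_vec (y $ 1 * stretch (k (y $ 2)) p L L \<bar>y $ 1\<bar>, y $ 2)"
  have kc: "continuous_on UNIV (\<lambda>y :: real^2. k (y $ 2))"
    by (rule continuous_on_compose2[OF k(1)]) (auto intro!: continuous_intros)
  have c: "continuous_on UNIV ?f" "continuous_on UNIV ?g"
    using k p by (auto intro!: continuous_intros kc)
  have "?g (?f x) = x" "?f (?g x) = x" for x
    by (simp_all only: pair_vec_nth fst_conv snd_conv signed_stretch_inverse[OF p k(2,3)]
        signed_stretch_inverse[OF k(2,3) p] pair_vec_eta)
  with c show ?thesis by (rule homeomorphic_preimage)
qed

section \<open>Homeomorphisms that move points along rays\<close>

definition radial_stretch ::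
    "('a \<Rightarrow> real) \<Rightarrow> ('a \<Rightarrow> real) \<Rightarrow> ('a \<Rightarrow> real) \<Rightarrow> ('a \<Rightarrow> real) \<Rightarrow> ('a \<Rightarrow> real) \<Rightarrow> 'a \<Rightarrow> 'a::real_normed_vector" where
  "radial_stretch N P Q L M v = stretch (P v) (Q v) (L v) (M v) (N v) *\<^sub>R v"

text \<open>N is a gauge, and P, Q, L, M depend only on the direction of v, so the map keeps each
  ray and acts on it as a stretch; exchanging P, L with Q, M gives the inverse. The bounds \<delta>
  and K control the factor near the origin, where data that depend on the direction need not have a
  limit.\<close>

locale radial =
  fixes N P Q L M :: "'a::real_normed_vector \<Rightarrow> real" and \<delta> K :: real
  assumes N: "continuous_on UNIV N" "\<And>a v. 0 \<le> a \<Longrightarrow> N (a *\<^sub>R v) = a * N v" "\<And>v. 0 \<le> N v"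
    and cont: "continuous_on (- {0}) P" "continuous_on (- {0}) Q" "continuous_on (- {0}) L" "continuous_on (- {0}) M"
    and scale: "\<And>a v. 0 < a \<Longrightarrow> P (a *\<^sub>R v) = P v" "\<And>a v. 0 < a \<Longrightarrow> Q (a *\<^sub>R v) = Q v"
      "\<And>a v. 0 < a \<Longrightarrow> L (a *\<^sub>R v) = L v" "\<And>a v. 0 < a \<Longrightarrow> M (a *\<^sub>R v) = M v"
    and less: "\<And>v. v \<noteq> 0 \<Longrightarrow> P v < L v" "\<And>v. v \<noteq> 0 \<Longrightarrow> Q v < M v"
    and \<delta>: "0 < \<delta>" "\<And>v. v \<noteq> 0 \<Longrightarrow> \<delta> \<le> P v" "\<And>v. v \<noteq> 0 \<Longrightarrow> \<delta> \<le> Q v"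
    and K: "\<And>v. v \<noteq> 0 \<Longrightarrow> Q v \<le> K"
begin

lemma pos: "v \<noteq> 0 \<Longrightarrow> 0 < P v" "v \<noteq> 0 \<Longrightarrow> 0 < Q v"
  using \<delta> less_le_trans by blast+

lemma norm_radial_stretch: "v \<noteq> 0 \<Longrightarrow> N (radial_stretch N P Q L M v) = N v * stretch (P v) (Q v) (L v) (M v) (N v)"
  unfolding radial_stretch_def
  using N(2)[of "stretch (P v) (Q v) (L v) (M v) (N v)" v] stretch_pos[OF pos(1) less(1) pos(2) less(2) N(3), of v]
  by (simp add: less_imp_le mult.commute)

text \<open>Close to 0 the gauge is below \<delta> <= P, so the factor is the inner slope Q / P, at
  most K / \<delta>. Away from 0 the map is composed of continuous ones.\<close>

lemma continuous_radial_stretch: "continuous_on UNIV (radial_stretch N P Q L M)"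
proof -
  have "isCont (radial_stretch N P Q L M) v" for v
  proof (cases "v = 0")
    case False
    have "continuous_on (- {0}) (radial_stretch N P Q L M)"
      unfolding radial_stretch_def [abs_def]
      by (intro continuous_intros cont continuous_on_subset[OF N(1)]) (use pos less in auto)
    then show ?thesis using False by (simp add: continuous_on_eq_continuous_at open_Compl)
  next
    case True
    have N0: "N 0 = 0" using N(2)[of 0 0] by simp
    have "isCont N 0" using N(1) by (simp add: continuous_on_eq_continuous_at)
    then have "\<forall>\<^sub>F v in at 0. N v < \<delta>"
      using order_tendstoD(2)[of N "N 0" "at 0" \<delta>] \<delta>(1) N0 by (simp add: isCont_def)
    then have "\<forall>\<^sub>F v in at 0. norm (radial_stretch N P Q L M v) \<le> K / \<delta> * norm v"
    proof eventually_elim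
      case (elim v)
      show ?case
      proof (cases "v = 0")
        case False
        have "N v \<le> P v" using elim \<delta>(2)[OF False] by linarith
        then have s: "stretch (P v) (Q v) (L v) (M v) (N v) = Q v / P v"
          by (rule stretch_inner[OF pos(1)[OF False] less(1)[OF False] pos(2)[OF False] less(2)[OF False]])
        have "Q v / P v \<le> K / \<delta>"
          using K[OF False] \<delta>(1) \<delta>(2,3)[OF False] by (intro frac_le) auto
        from mult_right_mono[OF this norm_ge_zero[of v]] show ?thesis
          using pos[OF False] by (simp add: radial_stretch_def s)
      qed (simp add: radial_stretch_def)
    qed
    moreover have "((\<lambda>v::'a. K / \<delta> * norm v) \<longlongrightarrow> 0) (at 0)"
      using tendsto_norm_zero[OF tendsto_ident_at[of "0::'a" UNIV]] by (rule tendsto_mult_right_zero)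
    ultimately have "(radial_stretch N P Q L M \<longlongrightarrow> 0) (at 0)"
      by (rule Lim_null_comparison)
    then show ?thesis using True by (simp add: isCont_def radial_stretch_def)
  qed
  then show ?thesis by (simp add: continuous_on_eq_continuous_at)
qed

lemma radial_stretch_inverse: "radial_stretch N Q P M L (radial_stretch N P Q L M v) = v"
proof (cases "v = 0")
  case False
  let ?s = "stretch (P v) (Q v) (L v) (M v) (N v)"
  have s: "?s > 0" by (rule stretch_pos[OF pos(1) less(1) pos(2) less(2) N(3)]) (use False in auto)
  have "radial_stretch N Q P M L (?s *\<^sub>R v) = (stretch (Q v) (P v) (M v) (L v) (N v * ?s) * ?s) *\<^sub>R v"
    unfolding radial_stretch_def using s scale N(2)[of ?s v] by (simp add: mult.commute less_imp_le)
  also have "\<dots> = v"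
    by (subst stretch_inverse[OF pos(1) less(1) pos(2) less(2) N(3)]) (use False in auto)
  finally show ?thesis by (simp add: radial_stretch_def)
qed (simp add: radial_stretch_def)

end

lemma radial_stretch_homeomorphic:
  fixes c :: "'a::real_normed_vector"
  assumes r: "radial N P Q L M \<delta> K" "radial N Q P M L \<delta> K"
  shows "A homeomorphic {y. c + radial_stretch N P Q L M (y - c) \<in> A}"
proof (rule homeomorphic_preimage[where f = "\<lambda>y. c + radial_stretch N Q P M L (y - c)"])
  show "continuous_on UNIV (\<lambda>y. c + radial_stretch N P Q L M (y - c))"
    by (intro continuous_intros continuous_on_compose2[OF radial.continuous_radial_stretch[OF r(1)]]) auto
  show "continuous_on UNIV (\<lambda>y. c + radial_stretch N Q P M L (y - c))"
    by (intro continuous_intros continuous_on_compose2[OF radial.continuous_radial_stretch[OF r(2)]]) auto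
qed (simp_all add: radial.radial_stretch_inverse[OF r(1)] radial.radial_stretch_inverse[OF r(2)])

lemma abs_signed_stretch:
  assumes "0 < p" "p < L" "0 < q" "q < L"
  shows "\<bar>u * stretch p q L L \<bar>u\<bar>\<bar> = \<bar>u\<bar> * stretch p q L L \<bar>u\<bar>"
  using stretch_pos[OF assms, of "\<bar>u\<bar>"] by (simp add: abs_mult)

lemma signed_stretch_less_iff:
  assumes "0 < p" "p < L" "0 < q" "q < L"
  shows "\<bar>u * stretch p q L L \<bar>u\<bar>\<bar> < q \<longleftrightarrow> \<bar>u\<bar> < p"
    "L \<le> c \<Longrightarrow> \<bar>u * stretch p q L L \<bar>u\<bar>\<bar> < c \<longleftrightarrow> \<bar>u\<bar> < c"
    "\<bar>u * stretch p q L L \<bar>u\<bar>\<bar> > L \<longleftrightarrow> \<bar>u\<bar> > L"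
proof -
  note eq = abs_signed_stretch[OF assms, of u] and iff = stretch_less_iff[OF assms abs_ge_zero[of u]]
  show "\<bar>u * stretch p q L L \<bar>u\<bar>\<bar> < q \<longleftrightarrow> \<bar>u\<bar> < p" unfolding eq by (rule iff(1))
  show "\<bar>u * stretch p q L L \<bar>u\<bar>\<bar> > L \<longleftrightarrow> \<bar>u\<bar> > L" unfolding eq using iff(4) by linarith
  show "\<bar>u * stretch p q L L \<bar>u\<bar>\<bar> < c \<longleftrightarrow> \<bar>u\<bar> < c" if "L \<le> c"
  proof (cases "\<bar>u\<bar> < L")
    case True
    then show ?thesis unfolding eq using iff(3) that by linarith
  next
    case False
    then have "\<bar>u\<bar> * stretch p q L L \<bar>u\<bar> = L + (\<bar>u\<bar> - L)" by (intro stretch_outer[OF assms]) simp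
    then have "\<bar>u\<bar> * stretch p q L L \<bar>u\<bar> = \<bar>u\<bar>" by linarith
    then show ?thesis unfolding eq by (simp only:)
  qed
qed

text \<open>A vertical stretch turns the top and bottom sides of the inner square into slanted ones, so that
  the inner boundary of each hole becomes a graph over the second coordinate; a horizontal stretch
  then straightens this graph.\<close>

lemma ring_domain_homeomorphic_rectangular_holes:
  assumes w: "0 < w" "w < 1"
  shows "ring_domain w homeomorphic
    {y :: real^2. \<bar>y $ 1\<bar> < 3 \<and> \<bar>y $ 2\<bar> < 3 \<and> (\<bar>y $ 1\<bar> < 1 \<or> \<bar>y $ 1\<bar> > 2 \<or> \<bar>y $ 2\<bar> > 2)}"
proof -
  \<comment> \<open>Both functions clamp the slanted line \<bar>x1\<bar> + \<bar>x2\<bar> = 2: k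
    reads it as a height over the first coordinate between 1 and 2 - w, l as a width over the second
    between w and 1.\<close>
  define k where "k t = max 1 (min (2 - w) (2 - \<bar>t\<bar>))" for t
  define l where "l t = max w (min 1 (2 - \<bar>t\<bar>))" for t
  have k: "continuous_on UNIV k" "0 < k t" "k t < 2" for t
    using w by (auto simp: k_def [abs_def] intro!: continuous_intros)
  have l: "continuous_on UNIV l" "0 < l t" "l t < 2" for t
    using w by (auto simp: l_def [abs_def] intro!: continuous_intros)
  let ?A = "{y :: real^2. \<bar>y $ 1\<bar> < 3 \<and> \<bar>y $ 2\<bar> < 3 \<and> (\<bar>y $ 1\<bar> < l (y $ 2) \<or> \<bar>y $ 1\<bar> > 2 \<or> \<bar>y $ 2\<bar> > 2)}"
  have "ring_domain w homeomorphic {y :: real^2. pair_vec (y $ 1, y $ 2 * stretch (k (y $ 1)) 1 2 2 \<bar>y $ 2\<bar>) \<in> ring_domain w}"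
    by (rule vertical_stretch_homeomorphic[OF k]) auto
  also have "{y :: real^2. pair_vec (y $ 1, y $ 2 * stretch (k (y $ 1)) 1 2 2 \<bar>y $ 2\<bar>) \<in> ring_domain w} = ?A"
  proof (rule Collect_cong)
    fix y :: "real^2"
    note iff = signed_stretch_less_iff[OF k(2,3)[of "y $ 1"], where q = 1 and u = "y $ 2", simplified]
    \<comment> \<open>Within the square of half width 2 the two readings of the slanted line
      describe the same region; a coordinate beyond 2 makes both sides true, apart from the outer
      bounds.\<close>
    have claim: "(\<bar>y $ 1\<bar> < w \<or> \<bar>y $ 1\<bar> < 1 \<and> \<bar>y $ 2\<bar> < k (y $ 1)) \<longleftrightarrow> \<bar>y $ 1\<bar> < l (y $ 2)"
      if "\<bar>y $ 1\<bar> \<le> 2" "\<bar>y $ 2\<bar> \<le> 2"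
    proof -
      have "(a < w \<or> a < 1 \<and> b < max 1 (min (2 - w) (2 - a))) \<longleftrightarrow> a < max w (min 1 (2 - b))" if "a \<ge> 0" "b \<ge> 0" for a b
        using w that by (auto simp: less_max_iff_disj)
      then show ?thesis by (simp add: k_def l_def)
    qed
    show "pair_vec (y $ 1, y $ 2 * stretch (k (y $ 1)) 1 2 2 \<bar>y $ 2\<bar>) \<in> ring_domain w \<longleftrightarrow>
      \<bar>y $ 1\<bar> < 3 \<and> \<bar>y $ 2\<bar> < 3 \<and> (\<bar>y $ 1\<bar> < l (y $ 2) \<or> \<bar>y $ 1\<bar> > 2 \<or> \<bar>y $ 2\<bar> > 2)"
      unfolding ring_domain_iff[OF w] pair_vec_nth fst_conv snd_conv iff(1) iff(3) iff(2)[of 3, simplified]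
      using claim by (cases "\<bar>y $ 1\<bar> \<le> 2 \<and> \<bar>y $ 2\<bar> \<le> 2") auto
  qed
  also have "?A homeomorphic {y :: real^2. pair_vec (y $ 1 * stretch 1 (l (y $ 2)) 2 2 \<bar>y $ 1\<bar>, y $ 2) \<in> ?A}"
    by (rule horizontal_stretch_homeomorphic[OF l]) auto
  also have "{y :: real^2. pair_vec (y $ 1 * stretch 1 (l (y $ 2)) 2 2 \<bar>y $ 1\<bar>, y $ 2) \<in> ?A} =
    {y. \<bar>y $ 1\<bar> < 3 \<and> \<bar>y $ 2\<bar> < 3 \<and> (\<bar>y $ 1\<bar> < 1 \<or> \<bar>y $ 1\<bar> > 2 \<or> \<bar>y $ 2\<bar> > 2)}"
  proof (rule Collect_cong)
    fix y :: "real^2"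
    note iff = signed_stretch_less_iff[OF _ _ l(2,3)[of "y $ 2"], where p = 1 and u = "y $ 1", simplified]
    show "pair_vec (y $ 1 * stretch 1 (l (y $ 2)) 2 2 \<bar>y $ 1\<bar>, y $ 2) \<in> ?A \<longleftrightarrow>
      \<bar>y $ 1\<bar> < 3 \<and> \<bar>y $ 2\<bar> < 3 \<and> (\<bar>y $ 1\<bar> < 1 \<or> \<bar>y $ 1\<bar> > 2 \<or> \<bar>y $ 2\<bar> > 2)"
      unfolding mem_Collect_eq pair_vec_nth fst_conv snd_conv iff(1) iff(3) iff(2)[of 3, simplified] ..
  qed
  finally show ?thesis .
qed

lemma homeomorphic_scale_second:
  fixes A :: "(real^2) set"
  assumes "a \<noteq> 0"
  shows "A homeomorphic {y :: real^2. pair_vec (y $ 1, a * y $ 2) \<in> A}"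
  by (rule homeomorphic_preimage[where f = "\<lambda>y. pair_vec (y $ 1, y $ 2 / a)"])
    (use assms in \<open>auto intro!: continuous_intros simp: pair_vec_eta\<close>)

text \<open>The gauge of a rectangle with sides in the ratio a : 1. The second coordinate is
  compressed by 4 to make the 1 by 4 holes square, so the outer boundary belongs to a = 4 and the
  holes to a = 1.\<close>

definition sup_norm :: "real \<Rightarrow> real^2 \<Rightarrow> real" where
  "sup_norm a v = max \<bar>v $ 1\<bar> (a * \<bar>v $ 2\<bar>)"

lemma sup_norm_continuous: "continuous_on S (sup_norm a)"
  unfolding sup_norm_def [abs_def] by (intro continuous_intros)

lemma sup_norm_scaleR: "0 \<le> b \<Longrightarrow> sup_norm a (b *\<^sub>R v) = b * sup_norm a v"
  by (simp add: sup_norm_def abs_mult max_mult_distrib_left mult.left_commute)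

lemma sup_norm_iff:
  "sup_norm a v \<le> b \<longleftrightarrow> \<bar>v $ 1\<bar> \<le> b \<and> a * \<bar>v $ 2\<bar> \<le> b"
  "sup_norm a v < b \<longleftrightarrow> \<bar>v $ 1\<bar> < b \<and> a * \<bar>v $ 2\<bar> < b"
  by (auto simp: sup_norm_def)

lemma sup_norm_nonneg: "0 \<le> sup_norm a v"
  by (simp add: sup_norm_def le_max_iff_disj)

lemma sup_norm_pos: "0 < a \<Longrightarrow> v \<noteq> 0 \<Longrightarrow> 0 < sup_norm a v"
  by (auto simp: sup_norm_def less_max_iff_disj vec_eq_iff forall_2)

lemma sup_norm_bounds:
  assumes "1 \<le> a"
  shows "sup_norm a v \<le> a * norm v" "a * norm v \<le> (a + 1) * sup_norm a v"
proof -
  have n: "norm v \<le> a * norm v" using assms by (simp add: mult_le_cancel_right1)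
  have c: "\<bar>v $ 1\<bar> \<le> norm v" "\<bar>v $ 2\<bar> \<le> norm v" using component_le_norm_cart by auto
  have "a * \<bar>v $ 2\<bar> \<le> a * norm v" using c assms by (intro mult_left_mono) auto
  then show "sup_norm a v \<le> a * norm v" using n c by (simp add: sup_norm_def)
  have "norm v \<le> \<bar>v $ 1\<bar> + \<bar>v $ 2\<bar>" using norm_le_l1_cart[of v] by (simp add: sum_2)
  then have "a * norm v \<le> a * (\<bar>v $ 1\<bar> + \<bar>v $ 2\<bar>)" using assms by (intro mult_left_mono) auto
  also have "\<dots> = a * \<bar>v $ 1\<bar> + a * \<bar>v $ 2\<bar>" by (simp add: distrib_left)
  also have "\<dots> \<le> a * sup_norm a v + sup_norm a v"
    using assms by (intro add_mono mult_left_mono) (auto simp: sup_norm_def)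
  finally show "a * norm v \<le> (a + 1) * sup_norm a v" by (simp add: algebra_simps)
qed

text \<open>The first map turns the ball of radius \<open>1/2\<close> into the square of the same width and is the
  identity outside a larger square; the second turns the ball of radius \<open>4\<close> into the rectangle
  \<open>(-3, 3) \<times> (-3/4, 3/4)\<close> and is the identity in a smaller one.\<close>

definition square_radius :: "real^2 \<Rightarrow> real" where
  "square_radius v = sup_norm 1 v / (2 * norm v)"

text \<open>\<open>square_radius v\<close> is the gauge of the point where the ray of v meets the
  circle of radius 1/2, so a stretch that moves it to 1/2 takes the circle to the square.\<close>

lemma square_radius_bounds: "v \<noteq> 0 \<Longrightarrow> 1 / 4 \<le> square_radius v" "v \<noteq> 0 \<Longrightarrow> square_radius v \<le> 1 / 2"
  using sup_norm_bounds[of 1 v] by (auto simp: square_radius_def field_simps)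

lemma radial_square:
  "radial (sup_norm 1) square_radius (\<lambda>v. 1/2) (\<lambda>v. 5/8) (\<lambda>v. 5/8) (1/4) 1"
  "radial (sup_norm 1) (\<lambda>v. 1/2) square_radius (\<lambda>v. 5/8) (\<lambda>v. 5/8) (1/4) 1"
proof -
  have c: "continuous_on (- {0}) square_radius"
    unfolding square_radius_def [abs_def] by (intro continuous_intros sup_norm_continuous) auto
  have s: "square_radius (a *\<^sub>R v) = square_radius v" if "0 < a" for a v
    using that by (simp add: square_radius_def sup_norm_scaleR)
  show "radial (sup_norm 1) square_radius (\<lambda>v. 1/2) (\<lambda>v. 5/8) (\<lambda>v. 5/8) (1/4) 1"
    "radial (sup_norm 1) (\<lambda>v. 1/2) square_radius (\<lambda>v. 5/8) (\<lambda>v. 5/8) (1/4) 1"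
    by (unfold_locales; use c s square_radius_bounds in \<open>force simp: sup_norm_continuous sup_norm_scaleR sup_norm_nonneg intro: continuous_intros\<close>)+
qed

text \<open>The gauge of the point where the ray of v meets the circle of radius 4. It is at least
  16/5, which leaves room for the breakpoint 5/2.\<close>

definition rectangle_radius :: "real^2 \<Rightarrow> real" where
  "rectangle_radius v = 4 * sup_norm 4 v / norm v"

lemma rectangle_radius_bounds: "v \<noteq> 0 \<Longrightarrow> 16 / 5 \<le> rectangle_radius v"
  using sup_norm_bounds[of 4 v] by (auto simp: rectangle_radius_def field_simps)

lemma radial_rectangle:
  "radial (sup_norm 4) (\<lambda>v. 5/2) (\<lambda>v. 5/2) rectangle_radius (\<lambda>v. 3) (5/2) (5/2)"
  "radial (sup_norm 4) (\<lambda>v. 5/2) (\<lambda>v. 5/2) (\<lambda>v. 3) rectangle_radius (5/2) (5/2)"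
proof -
  have c: "continuous_on (- {0}) rectangle_radius"
    unfolding rectangle_radius_def [abs_def] by (intro continuous_intros sup_norm_continuous) auto
  have s: "rectangle_radius (a *\<^sub>R v) = rectangle_radius v" if "0 < a" for a v
    using that by (simp add: rectangle_radius_def sup_norm_scaleR)
  have b: "5/2 < rectangle_radius v" if "v \<noteq> 0" for v
    using rectangle_radius_bounds[OF that] by simp
  show "radial (sup_norm 4) (\<lambda>v. 5/2) (\<lambda>v. 5/2) rectangle_radius (\<lambda>v. 3) (5/2) (5/2)"
    "radial (sup_norm 4) (\<lambda>v. 5/2) (\<lambda>v. 5/2) (\<lambda>v. 3) rectangle_radius (5/2) (5/2)"
    by (unfold_locales; use c s b in \<open>force simp: sup_norm_continuous sup_norm_scaleR sup_norm_nonneg intro: continuous_intros\<close>)+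
qed

text \<open>5/8 exceeds 1/2, and the squares of this half width around (3/2, 0) and (-3/2, 0) still
  lie in the rectangle, as 17/8 < 3 and 5/8 < 3/4, and are disjoint.\<close>

definition round_square :: "real^2 \<Rightarrow> real^2" where
  "round_square = radial_stretch (sup_norm 1) square_radius (\<lambda>v. 1/2) (\<lambda>v. 5/8) (\<lambda>v. 5/8)"

text \<open>The rectangle of gauge 5/2, which stays fixed, contains both disks: their points have
  \<bar>x1\<bar> <= 2 and 4 \<bar>x2\<bar> <= 2.\<close>

definition round_rectangle :: "real^2 \<Rightarrow> real^2" where
  "round_rectangle = radial_stretch (sup_norm 4) (\<lambda>v. 5/2) (\<lambda>v. 5/2) rectangle_radius (\<lambda>v. 3)"

lemma sup_norm_0: "sup_norm a 0 = 0"
  by (simp add: sup_norm_def)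

lemma round_square:
  "sup_norm 1 (round_square v) \<le> 1/2 \<longleftrightarrow> norm v \<le> 1/2"
  "round_square v = v \<or> sup_norm 1 v \<le> 5/8 \<and> sup_norm 1 (round_square v) \<le> 5/8"
proof -
  have "(sup_norm 1 (round_square v) \<le> 1/2 \<longleftrightarrow> norm v \<le> 1/2) \<and>
    (round_square v = v \<or> sup_norm 1 v \<le> 5/8 \<and> sup_norm 1 (round_square v) \<le> 5/8)"
  proof (cases "v = 0")
    case True
    then show ?thesis by (simp add: round_square_def radial_stretch_def sup_norm_0)
  next
    case False
    have b: "0 < square_radius v" "square_radius v < 5/8" "0 < (1/2::real)" "1/2 < (5/8::real)"
      using square_radius_bounds[OF False] by auto
    have eq: "sup_norm 1 (round_square v) = sup_norm 1 v * stretch (square_radius v) (1/2) (5/8) (5/8) (sup_norm 1 v)"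
      unfolding round_square_def by (rule radial.norm_radial_stretch[OF radial_square(1) False])
    note iff = stretch_less_iff[OF b sup_norm_nonneg[of 1 v]]
    have "sup_norm 1 v \<le> square_radius v \<longleftrightarrow> norm v \<le> 1/2"
      using sup_norm_pos[of 1, OF _ False] False by (simp add: square_radius_def field_simps)
    moreover have "round_square v = v" if "5/8 \<le> sup_norm 1 v"
      using stretch_fixed[OF b that] by (simp add: round_square_def radial_stretch_def)
    ultimately show ?thesis using iff(2,4) unfolding eq by linarith
  qed
  then show "sup_norm 1 (round_square v) \<le> 1/2 \<longleftrightarrow> norm v \<le> 1/2"
    "round_square v = v \<or> sup_norm 1 v \<le> 5/8 \<and> sup_norm 1 (round_square v) \<le> 5/8" by blast+
qed

lemma round_rectangle:
  "sup_norm 4 (round_rectangle v) < 3 \<longleftrightarrow> norm v < 4"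
  "round_rectangle v = v \<or> sup_norm 4 v > 5/2 \<and> sup_norm 4 (round_rectangle v) > 5/2"
proof -
  have "(sup_norm 4 (round_rectangle v) < 3 \<longleftrightarrow> norm v < 4) \<and>
    (round_rectangle v = v \<or> sup_norm 4 v > 5/2 \<and> sup_norm 4 (round_rectangle v) > 5/2)"
  proof (cases "v = 0")
    case True
    then show ?thesis by (simp add: round_rectangle_def radial_stretch_def sup_norm_0)
  next
    case False
    have b: "0 < (5/2::real)" "5/2 < rectangle_radius v" "0 < (5/2::real)" "5/2 < (3::real)"
      using rectangle_radius_bounds[OF False] by auto
    have eq: "sup_norm 4 (round_rectangle v) = sup_norm 4 v * stretch (5/2) (5/2) (rectangle_radius v) 3 (sup_norm 4 v)"
      unfolding round_rectangle_def by (rule radial.norm_radial_stretch[OF radial_rectangle(1) False])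
    note iff = stretch_less_iff[OF b sup_norm_nonneg[of 4 v]]
    have "sup_norm 4 v < rectangle_radius v \<longleftrightarrow> norm v < 4"
      using sup_norm_pos[of 4, OF _ False] False by (simp add: rectangle_radius_def field_simps)
    moreover have "round_rectangle v = v" if "sup_norm 4 v \<le> 5/2"
      using stretch_inner[OF b that] by (simp add: round_rectangle_def radial_stretch_def)
    ultimately show ?thesis using iff(2,3) unfolding eq by linarith
  qed
  then show "sup_norm 4 (round_rectangle v) < 3 \<longleftrightarrow> norm v < 4"
    "round_rectangle v = v \<or> sup_norm 4 v > 5/2 \<and> sup_norm 4 (round_rectangle v) > 5/2" by blast+
qed

lemma round_square_homeomorphic: "A homeomorphic {y. c + round_square (y - c) \<in> A}"
  unfolding round_square_def by (rule radial_stretch_homeomorphic[OF radial_square])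

lemma round_rectangle_homeomorphic: "A homeomorphic {y. round_rectangle y \<in> A}"
  using radial_stretch_homeomorphic[OF radial_rectangle, of A 0] by (simp add: round_rectangle_def)

text \<open>Each boundary component is rounded by a map that moves only points for which the
  conditions at the other components hold, before and after. So from \<open>?A2\<close> to
  \<open>?A5\<close> a single condition changes at a time.\<close>

lemma ring_domain_homeomorphic_disk:
  assumes w: "0 < w" "w < 1"
  shows "\<exists>D. disk_with_two_holes D \<and> ring_domain w homeomorphic D"
proof -
  define c where "c = pair_vec (3/2, 0)"
  have c: "c $ 1 = 3/2" "c $ 2 = 0" by (auto simp: c_def)
  let ?R = "\<lambda>y. sup_norm 4 y < 3"
  let ?A1 = "{y :: real^2. \<bar>y $ 1\<bar> < 3 \<and> \<bar>y $ 2\<bar> < 3 \<and> (\<bar>y $ 1\<bar> < 1 \<or> \<bar>y $ 1\<bar> > 2 \<or> \<bar>y $ 2\<bar> > 2)}"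
  let ?A2 = "{y. ?R y \<and> \<not> sup_norm 1 (y - c) \<le> 1/2 \<and> \<not> sup_norm 1 (y + c) \<le> 1/2}"
  let ?A3 = "{y. ?R y \<and> \<not> norm (y - c) \<le> 1/2 \<and> \<not> sup_norm 1 (y + c) \<le> 1/2}"
  let ?A4 = "{y. ?R y \<and> \<not> norm (y - c) \<le> 1/2 \<and> \<not> norm (y + c) \<le> 1/2}"
  let ?A5 = "{y. norm y < 4 \<and> \<not> norm (y - c) \<le> 1/2 \<and> \<not> norm (y + c) \<le> 1/2}"
  have "ring_domain w homeomorphic ?A1"
    by (rule ring_domain_homeomorphic_rectangular_holes[OF w])
  also have "?A1 homeomorphic {y :: real^2. pair_vec (y $ 1, 4 * y $ 2) \<in> ?A1}"
    by (rule homeomorphic_scale_second) simp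
  also have "{y :: real^2. pair_vec (y $ 1, 4 * y $ 2) \<in> ?A1} = ?A2"
  proof (rule Collect_cong)
    fix y :: "real^2"
    have "\<bar>y $ 1 - 3/2\<bar> \<le> 1/2 \<longleftrightarrow> 1 \<le> y $ 1 \<and> y $ 1 \<le> 2" "\<bar>y $ 1 + 3/2\<bar> \<le> 1/2 \<longleftrightarrow> - 2 \<le> y $ 1 \<and> y $ 1 \<le> - 1"
      by (rule iffI; linarith)+
    moreover have "\<bar>4 * y $ 2\<bar> = 4 * \<bar>y $ 2\<bar>" by (simp add: abs_mult)
    ultimately show "pair_vec (y $ 1, 4 * y $ 2) \<in> ?A1 \<longleftrightarrow> ?R y \<and> \<not> sup_norm 1 (y - c) \<le> 1/2 \<and> \<not> sup_norm 1 (y + c) \<le> 1/2"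
      unfolding mem_Collect_eq sup_norm_iff pair_vec_nth fst_conv snd_conv vector_minus_component vector_add_component c
        diff_zero add_0_right mult_1 by argo
  qed
  also have "?A2 homeomorphic {y. c + round_square (y - c) \<in> ?A2}"
    by (rule round_square_homeomorphic)
  also have "{y. c + round_square (y - c) \<in> ?A2} = ?A3"
  proof (rule Collect_cong)
    fix y
    let ?z = "c + round_square (y - c)"
    \<comment> \<open>The region moved by this map lies inside the outer rectangle and off the left
      hole, so these two conditions hold there for a point and its image alike.\<close>
    have box: "?R z \<and> \<not> sup_norm 1 (z + c) \<le> 1/2" if "sup_norm 1 (z - c) \<le> 5/8" for z
    proof -
      have "\<bar>z $ 1 - 3/2\<bar> \<le> 5/8" "\<bar>z $ 2\<bar> \<le> 5/8" using that unfolding sup_norm_iff by (simp_all only: vector_minus_component c diff_zero mult_1)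
      then have "\<bar>z $ 1\<bar> < 3" "4 * \<bar>z $ 2\<bar> < 3" "\<bar>z $ 1 + 3/2\<bar> > 1/2" by linarith+
      then show ?thesis unfolding sup_norm_iff vector_add_component c by linarith
    qed
    have "?z = y \<or> sup_norm 1 (y - c) \<le> 5/8 \<and> sup_norm 1 (?z - c) \<le> 5/8"
      using round_square(2)[of "y - c"] by auto
    then have "?R ?z \<and> \<not> sup_norm 1 (?z + c) \<le> 1/2 \<longleftrightarrow> ?R y \<and> \<not> sup_norm 1 (y + c) \<le> 1/2"
      using box by metis
    moreover have "sup_norm 1 (?z - c) \<le> 1/2 \<longleftrightarrow> norm (y - c) \<le> 1/2"
      using round_square(1)[of "y - c"] by simp
    ultimately show "?z \<in> ?A2 \<longleftrightarrow> ?R y \<and> \<not> norm (y - c) \<le> 1/2 \<and> \<not> sup_norm 1 (y + c) \<le> 1/2"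
      unfolding mem_Collect_eq by blast
  qed
  also have "?A3 homeomorphic {y. - c + round_square (y - (- c)) \<in> ?A3}"
    by (rule round_square_homeomorphic)
  also have "{y. - c + round_square (y - (- c)) \<in> ?A3} = ?A4"
  proof (rule Collect_cong)
    fix y
    let ?z = "- c + round_square (y - (- c))"
    have box: "?R z \<and> \<not> norm (z - c) \<le> 1/2" if "sup_norm 1 (z + c) \<le> 5/8" for z
    proof -
      have "\<bar>z $ 1 + 3/2\<bar> \<le> 5/8" "\<bar>z $ 2\<bar> \<le> 5/8" using that unfolding sup_norm_iff by (simp_all only: vector_add_component c add_0_right mult_1)
      then have *: "\<bar>z $ 1\<bar> < 3" "4 * \<bar>z $ 2\<bar> < 3" "\<bar>z $ 1 - 3/2\<bar> > 1/2" by linarith+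
      have "norm (z - c) > 1/2" using component_le_norm_cart[of "z - c" 1] *(3) unfolding vector_minus_component c by linarith
      then show ?thesis using * unfolding sup_norm_iff by linarith
    qed
    have "?z = y \<or> sup_norm 1 (y + c) \<le> 5/8 \<and> sup_norm 1 (?z + c) \<le> 5/8"
      using round_square(2)[of "y + c"] by auto
    then have "?R ?z \<and> \<not> norm (?z - c) \<le> 1/2 \<longleftrightarrow> ?R y \<and> \<not> norm (y - c) \<le> 1/2"
      using box by metis
    moreover have "sup_norm 1 (?z + c) \<le> 1/2 \<longleftrightarrow> norm (y + c) \<le> 1/2"
      using round_square(1)[of "y + c"] by simp
    ultimately show "?z \<in> ?A3 \<longleftrightarrow> ?R y \<and> \<not> norm (y - c) \<le> 1/2 \<and> \<not> norm (y + c) \<le> 1/2"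
      unfolding mem_Collect_eq by blast
  qed
  also have "?A4 homeomorphic {y. round_rectangle y \<in> ?A4}"
    by (rule round_rectangle_homeomorphic)
  also have "{y. round_rectangle y \<in> ?A4} = ?A5"
  proof (rule Collect_cong)
    fix y
    \<comment> \<open>The outer map moves only points of gauge above 5/2, and these lie outside both
      disks.\<close>
    have out: "\<not> norm (z - c) \<le> 1/2 \<and> \<not> norm (z + c) \<le> 1/2" if "sup_norm 4 z > 5/2" for z
    proof -
      have *: "\<bar>z $ 1\<bar> > 5/2 \<or> 4 * \<bar>z $ 2\<bar> > 5/2" using that unfolding sup_norm_def less_max_iff_disj .
      have "\<bar>z $ 1 - 3/2\<bar> \<le> norm (z - c)" "\<bar>z $ 2\<bar> \<le> norm (z - c)"
        "\<bar>z $ 1 + 3/2\<bar> \<le> norm (z + c)" "\<bar>z $ 2\<bar> \<le> norm (z + c)"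
        using component_le_norm_cart[of "z - c" 1] component_le_norm_cart[of "z - c" 2]
          component_le_norm_cart[of "z + c" 1] component_le_norm_cart[of "z + c" 2]
        unfolding vector_minus_component vector_add_component c diff_zero add_0_right by auto
      then show ?thesis using * by linarith
    qed
    have "\<not> norm (round_rectangle y - c) \<le> 1/2 \<and> \<not> norm (round_rectangle y + c) \<le> 1/2 \<longleftrightarrow>
      \<not> norm (y - c) \<le> 1/2 \<and> \<not> norm (y + c) \<le> 1/2"
      using round_rectangle(2)[of y] out by metis
    then show "round_rectangle y \<in> ?A4 \<longleftrightarrow> norm y < 4 \<and> \<not> norm (y - c) \<le> 1/2 \<and> \<not> norm (y + c) \<le> 1/2"
      using round_rectangle(1)[of y] unfolding mem_Collect_eq by blast
  qed
  finally have hom: "ring_domain w homeomorphic ?A5" .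
  have "(norm c)\<^sup>2 = (3/2)\<^sup>2" using norm_power2_vec2[of c] by (simp add: c power2_eq_square)
  then have nc: "norm c = 3/2" by (rule power2_eq_imp_eq) auto
  have "disk_with_two_holes ?A5"
    unfolding disk_with_two_holes_def
  proof (rule exI[of _ 0], rule exI[of _ 4], rule exI[of _ c], rule exI[of _ "1/2"], rule exI[of _ "- c"],
      rule exI[of _ "1/2"], intro conjI)
    show "cball c (1/2) \<subseteq> ball 0 4" "cball (- c) (1/2) \<subseteq> ball 0 4"
      using nc by (auto simp: cball_subset_ball_iff)
    show "cball c (1/2) \<inter> cball (- c) (1/2) = {}"
    proof -
      have "dist c (- c) = 3" using nc norm_scaleR[of 2 c] by (simp add: dist_norm scaleR_2)
      then show ?thesis by (simp add: disjoint_cballI)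
    qed
    show "?A5 = ball 0 4 - (cball c (1/2) \<union> cball (- c) (1/2))"
      by (auto simp: dist_norm norm_minus_commute add.commute) 
  qed auto
  with hom show ?thesis by blast
qed

theorem theorem1p4:
  shows "\<exists>\<Omega> :: (real^2) set.
    bounded_lipschitz_domain \<Omega> \<and>
    (\<forall>x. x \<in> \<Omega> \<longleftrightarrow> - x \<in> \<Omega>) \<and>
    (\<exists>D. disk_with_two_holes D \<and> \<Omega> homeomorphic D) \<and>
    (\<forall>\<psi>. neumann_eigenfunction \<Omega> (neumann_eigenvalue \<Omega> 2) \<psi> \<longrightarrow> symmetric_on_closure \<Omega> \<psi>)"
proof (rule exI[of _ "ring_domain (1 / 10 ^ 7)"], intro conjI allI impI)
  let ?w = "1 / 10 ^ 7 :: real"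
  have w: "0 < ?w" "?w < 1" by simp_all
  show "bounded_lipschitz_domain (ring_domain ?w)"
    unfolding bounded_lipschitz_domain_def
    using open_ring_domain connected_ring_domain[OF w] bounded_ring_domain lipschitz_boundary_ring_domain[OF w]
    by blast
  show "x \<in> ring_domain ?w \<longleftrightarrow> - x \<in> ring_domain ?w" for x
    using uminus_image_mem[OF uminus_ring_domain, of x ?w] by blast
  show "\<exists>D. disk_with_two_holes D \<and> ring_domain ?w homeomorphic D"
    by (rule ring_domain_homeomorphic_disk[OF w])
  fix \<psi>
  assume "neumann_eigenfunction (ring_domain ?w) (neumann_eigenvalue (ring_domain ?w) 2) \<psi>"
  then show "symmetric_on_closure (ring_domain ?w) \<psi>"
    by (intro ring_domain_symmetric_eigenfunctions[OF w(1)]) simp_all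
qed

end
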